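(* Let $d\ge1$, let $m_1,\dots,m_d\in\mathbb{N}\cup\{\infty\}$, and let $\beta_1,\dots,\beta_d\ge 1$ be real numbers. Let $Q=[0,1)^d$ and let $\tilde Q\subset\mathbb{R}^d$ be the split cube determined by the sequences $(a_{j,k})$ and $(b_{j,k})$ as described in the context. If $\frac{b_{j,k}}{\beta_k}\in\mathbb{Z}$ for all $k=1,\dots,d$ and all $j$, then the set $$\mathcal{B}^*=\{e^{2\pi i\,x\cdot(n+\vec\delta_n^* )}\}_{n\in\mathbb{Z}^d}$$ is an exponential basis for $L^2(\tilde Q)$. Moreover, $\mathcal{B}^*$ has the same frame constants for $L^2(\tilde Q)$ and for $L^2(Q)$.
   Context: Split cube: for each $k=1,\dots,d$ let $0=a_{0,k}<a_{1,k}<\dots$ be such that the intervals $I_{j,k}=[a_{j,k},a_{j+1,k})$, $0\le j<m_k$, partition $[0,1)$ (if $m_k$ is finite, $a_{m_k,k}=1$; if $m_k=\infty$, $a_{j,k}<1$ for all $j$ and $a_{j,k}\to1$), and let $0=b_{0,k}<b_{1,k}<\dots$ (indices $0\le j<m_k$) be strictly increasing real numbers. For $\vec j=(j_1,\dots,j_d)$ with $0\le j_k<m_k$, put $R_{\vec j}=I_{j_1,1}\times I_{j_2,2}\times\dots\times I_{j_d,d}$ and $\vec\beta_{\vec j}=(b_{j_1,1},b_{j_2,2},\dots,b_{j_d,d})$. Then $Q=\bigcup_{\vec j}R_{\vec j}$, and $\tilde Q=\bigcup_{\vec j}\big(\vec\beta_{\vec j}+R_{\vec j}\big)$. Frequencies: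 for $n=(n_1,\dots,n_d)\in\mathbb{Z}^d$, $\vec\delta_n^*=(\delta_{n_1}^*,\dots,\delta_{n_d}^* )$, where for each $k$ $$\delta_{n_k}^*=\begin{cases}\frac{\lfloor\beta_kn_k\rfloor+1}{\beta_k}-n_k&\text{if }\{\beta_kn_k\}\ge\frac12,\\ \frac{\lfloor\beta_kn_k\rfloor}{\beta_k}-n_k&\text{if }\{\beta_kn_k\}<\frac12,\end{cases}$$ with $\lfloor x\rfloor$ the largest integer $\le x$ and $\{x\}=x-\lfloor x\rfloor$. An exponential basis for $L^2(D)$, $D\subset\mathbb{R}^d$ measurable, is an unconditional Schauder basis of $L^2(D)$ of the form $\{e^{2\pi i\lambda_n\cdot x}\}$ with $\lambda_n\in\mathbb{R}^d$ (for sets of finite measure, equivalently, a Riesz basis of such exponentials). Constants $A,B>0$ are frame constants of a Riesz basis $\{v_n\}$ of a Hilbert space $H$ if $A\sum|c_n|^2\le\|\sum c_nv_n\|^2\le B\sum|c_n|^2$ for all finite scalar sequences $(c_n)$ and $A\|w\|^2\le\sum_n|\langle w,v_n\rangle|^2\le B\|w\|^2$ for all $w\in H$. *)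

theory Defs
  imports "HOL-Analysis.Analysis" "HOL-Library.Extended_Nat"
begin

text \<open>
  Throughout, \<open>\<real>\<^sup>d\<close> is \<^typ>\<open>real ^ 'd\<close>, \<open>\<int>\<^sup>d\<close> is \<^typ>\<open>int ^ 'd\<close>, and the coordinate
  \<open>k = 1, \<dots>, d\<close> ranges over the finite type \<^typ>\<open>'d\<close>.
\<close>

section \<open>The Hilbert space of square integrable functions\<close>

text \<open>
  Elements of \<open>L\<^sup>2(D)\<close> are handled through representatives; all notions below are invariant under
  changing a function on a null subset of \<open>D\<close>, and ``equality in \<open>L\<^sup>2(D)\<close>'' enters only through
  the seminorm \<open>l2_norm\<close>.
\<close>

definition l2_space :: "'a::euclidean_space set \<Rightarrow> ('a \<Rightarrow> complex) set" where
  "l2_space D = {f. f \<in> borel_measurable (lebesgue_on D) \<and>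
                    integrable (lebesgue_on D) (\<lambda>x. (cmod (f x))\<^sup>2)}"

definition l2_inner :: "'a::euclidean_space set \<Rightarrow> ('a \<Rightarrow> complex) \<Rightarrow> ('a \<Rightarrow> complex) \<Rightarrow> complex" where
  "l2_inner D f g = (LINT x|lebesgue_on D. f x * cnj (g x))"

definition l2_norm :: "'a::euclidean_space set \<Rightarrow> ('a \<Rightarrow> complex) \<Rightarrow> real" where
  "l2_norm D f = sqrt (LINT x|lebesgue_on D. (cmod (f x))\<^sup>2)"


section \<open>Bases and frame constants\<close>

definition schauder_basis :: "'a::euclidean_space set \<Rightarrow> (nat \<Rightarrow> 'a \<Rightarrow> complex) \<Rightarrow> bool" where
  "schauder_basis D v \<longleftrightarrow>
     (\<forall>k. v k \<in> l2_space D) \<and>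
     (\<forall>f\<in>l2_space D. \<exists>!c :: nat \<Rightarrow> complex.
        (\<lambda>N. l2_norm D (\<lambda>x. f x - (\<Sum>k<N. c k * v k x))) \<longlonglongrightarrow> 0)"

text \<open>
  A Schauder basis is unconditional iff all its rearrangements are Schauder bases. As \<open>\<int>\<^sup>d\<close> carries
  no preferred order, this is expressed by requiring it of every enumeration of \<open>\<int>\<^sup>d\<close>
  (which is countably infinite, so the condition is not vacuous).
\<close>

definition unconditional_schauder_basis ::
    "(real ^ 'd) set \<Rightarrow> (int ^ 'd \<Rightarrow> real ^ 'd \<Rightarrow> complex) \<Rightarrow> bool" where
  "unconditional_schauder_basis D v \<longleftrightarrow>
     (\<forall>e :: nat \<Rightarrow> int ^ 'd. bij e \<longrightarrow> schauder_basis D (\<lambda>k. v (e k)))"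

definition expo :: "real ^ 'd \<Rightarrow> real ^ 'd \<Rightarrow> complex" where
  "expo l x = exp (2 * of_real pi * \<i> * of_real (l \<bullet> x))"

definition exponential_basis :: "(real ^ 'd) set \<Rightarrow> (int ^ 'd \<Rightarrow> real ^ 'd \<Rightarrow> complex) \<Rightarrow> bool" where
  "exponential_basis D v \<longleftrightarrow>
     D \<in> sets lebesgue \<and>
     (\<exists>freq :: int ^ 'd \<Rightarrow> real ^ 'd. v = (\<lambda>n. expo (freq n))) \<and>
     unconditional_schauder_basis D v"

text \<open>
  The existence of constants as below already says that \<open>v\<close> is a Riesz basis of \<open>L\<^sup>2(D)\<close>: the first
  pair of inequalities makes it a Riesz sequence, the second one makes it complete.
\<close>

definition frame_constants ::
    "'a::euclidean_space set \<Rightarrow> ('i \<Rightarrow> 'a \<Rightarrow> complex) \<Rightarrow> real \<Rightarrow> real \<Rightarrow> bool" where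
  "frame_constants D v A B \<longleftrightarrow>
     0 < A \<and> 0 < B \<and>
     (\<forall>n. v n \<in> l2_space D) \<and>
     (\<forall>F (c :: 'i \<Rightarrow> complex). finite F \<longrightarrow>
        A * (\<Sum>n\<in>F. (cmod (c n))\<^sup>2) \<le> (l2_norm D (\<lambda>x. \<Sum>n\<in>F. c n * v n x))\<^sup>2 \<and>
        (l2_norm D (\<lambda>x. \<Sum>n\<in>F. c n * v n x))\<^sup>2 \<le> B * (\<Sum>n\<in>F. (cmod (c n))\<^sup>2)) \<and>
     (\<forall>w\<in>l2_space D.
        (\<lambda>n. (cmod (l2_inner D w (v n)))\<^sup>2) summable_on UNIV \<and>
        A * (l2_norm D w)\<^sup>2 \<le> (\<Sum>\<^sub>\<infinity>n. (cmod (l2_inner D w (v n)))\<^sup>2) \<and>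
        (\<Sum>\<^sub>\<infinity>n. (cmod (l2_inner D w (v n)))\<^sup>2) \<le> B * (l2_norm D w)\<^sup>2)"


section \<open>The split cube\<close>

text \<open>
  Only the values \<open>a j\<close> with \<open>j \<le> m\<close> and \<open>b j\<close> with \<open>j < m\<close> matter. Note that \<open>m = 0\<close> is
  impossible in the next definition.
\<close>

definition unit_subdivision :: "enat \<Rightarrow> (nat \<Rightarrow> real) \<Rightarrow> bool" where
  "unit_subdivision m a \<longleftrightarrow>
     a 0 = 0 \<and>
     (\<forall>j. enat j < m \<longrightarrow> a j < a (Suc j)) \<and>
     (case m of enat M \<Rightarrow> a M = 1 | \<infinity> \<Rightarrow> (\<forall>j. a j < 1) \<and> a \<longlonglongrightarrow> 1)"

definition shift_sequence :: "enat \<Rightarrow> (nat \<Rightarrow> real) \<Rightarrow> bool" where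
  "shift_sequence m b \<longleftrightarrow>
     b 0 = 0 \<and> (\<forall>j. enat (Suc j) < m \<longrightarrow> b j < b (Suc j))"

definition box_piece :: "('d \<Rightarrow> nat \<Rightarrow> real) \<Rightarrow> nat ^ 'd \<Rightarrow> (real ^ 'd) set" where
  "box_piece a j = {x. \<forall>k. x $ k \<in> {a k (j $ k)..<a k (Suc (j $ k))}}"

definition shift_vec :: "('d \<Rightarrow> nat \<Rightarrow> real) \<Rightarrow> nat ^ 'd \<Rightarrow> real ^ 'd" where
  "shift_vec b j = (\<chi> k. b k (j $ k))"

definition half_open_cube :: "(real ^ 'd) set" where
  "half_open_cube = {x. \<forall>k. x $ k \<in> {0..<1}}"

definition split_cube ::
    "('d \<Rightarrow> enat) \<Rightarrow> ('d \<Rightarrow> nat \<Rightarrow> real) \<Rightarrow> ('d \<Rightarrow> nat \<Rightarrow> real) \<Rightarrow> (real ^ 'd) set" where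
  "split_cube m a b =
     (\<Union>j\<in>{j. \<forall>k. enat (j $ k) < m k}. (\<lambda>x. shift_vec b j + x) ` box_piece a j)"


section \<open>The frequencies\<close>

definition delta_star :: "real \<Rightarrow> int \<Rightarrow> real" where
  "delta_star \<beta> n =
     (if frac (\<beta> * of_int n) \<ge> 1 / 2
      then (of_int \<lfloor>\<beta> * of_int n\<rfloor> + 1) / \<beta> - of_int n
      else of_int \<lfloor>\<beta> * of_int n\<rfloor> / \<beta> - of_int n)"

definition delta_star_vec :: "('d \<Rightarrow> real) \<Rightarrow> int ^ 'd \<Rightarrow> real ^ 'd" where
  "delta_star_vec \<beta> n = (\<chi> k. delta_star (\<beta> k) (n $ k))"

definition B_star :: "('d \<Rightarrow> real) \<Rightarrow> int ^ 'd \<Rightarrow> real ^ 'd \<Rightarrow> complex" where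
  "B_star \<beta> n = expo ((\<chi> k. of_int (n $ k)) + delta_star_vec \<beta> n)"


section \<open>The conditions on the subdivision points do describe partitions\<close>

lemma unit_subdivision_mono:
  assumes "unit_subdivision m a" "i < j" "enat j \<le> m"
  shows "a i < a j"
  using assms(2,3)
proof (induction j)
  case 0
  then show ?case by simp
next
  case (Suc j)
  have jm: "enat j < m"
    using Suc.prems(2) by (metis Suc_ile_eq)
  then have step: "a j < a (Suc j)"
    using assms(1) by (simp add: unit_subdivision_def)
  show ?case
  proof (cases "i = j")
    case True
    then show ?thesis using step by simp
  next
    case False
    then have "a i < a j" using Suc jm by simp
    then show ?thesis using step by simp
  qed
qed

lemma unit_subdivision_Union:
  assumes "unit_subdivision m a"
  shows "(\<Union>j\<in>{j. enat j < m}. {a j..<a (Suc j)}) = {0..<1}"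
proof
  have a0: "a 0 = 0" using assms by (simp add: unit_subdivision_def)
  show "(\<Union>j\<in>{j. enat j < m}. {a j..<a (Suc j)}) \<subseteq> {0..<1}"
  proof
    fix x assume "x \<in> (\<Union>j\<in>{j. enat j < m}. {a j..<a (Suc j)})"
    then obtain j where j: "enat j < m" "a j \<le> x" "x < a (Suc j)" by auto
    have "a 0 \<le> a j"
      using unit_subdivision_mono[OF assms, of 0 j] j(1) by (cases j) (auto intro: less_imp_le)
    moreover have "a (Suc j) \<le> 1"
    proof (cases m)
      case (enat M)
      then have "Suc j \<le> M" "a M = 1"
        using j(1) assms by (auto simp: unit_subdivision_def)
      then show ?thesis
        using unit_subdivision_mono[OF assms, of "Suc j" M] enat
        by (cases "Suc j = M") auto
    next
      case infinity
      then show ?thesis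
        using assms by (auto simp: unit_subdivision_def intro: less_imp_le)
    qed
    ultimately show "x \<in> {0..<1}" using j a0 by auto
  qed
  show "{0..<1} \<subseteq> (\<Union>j\<in>{j. enat j < m}. {a j..<a (Suc j)})"
  proof
    fix x :: real assume x: "x \<in> {0..<1}"
    have ex: "\<exists>i. enat i \<le> m \<and> x < a i"
    proof (cases m)
      case (enat M)
      then show ?thesis using assms x by (auto simp: unit_subdivision_def)
    next
      case infinity
      then have "a \<longlonglongrightarrow> 1" using assms by (simp add: unit_subdivision_def)
      then have "eventually (\<lambda>i. x < a i) sequentially"
        using x by (intro order_tendstoD) auto
      then show ?thesis using infinity by (auto simp: eventually_sequentially)
    qed
    define i where "i = (LEAST i. enat i \<le> m \<and> x < a i)"
    have i: "enat i \<le> m" "x < a i"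
      using LeastI_ex[OF ex] by (auto simp: i_def)
    then obtain j where ij: "i = Suc j" using x a0 by (cases i) auto
    have jm: "enat j < m" using i(1) ij by (simp add: Suc_ile_eq)
    have "\<not> x < a j"
      using not_less_Least[of j "\<lambda>i. enat i \<le> m \<and> x < a i"] jm ij by (auto simp: i_def)
    then show "x \<in> (\<Union>j\<in>{j. enat j < m}. {a j..<a (Suc j)})"
      using i jm ij by force
  qed
qed

lemma unit_subdivision_disjoint:
  assumes "unit_subdivision m a"
  shows "disjoint_family_on (\<lambda>j. {a j..<a (Suc j)}) {j. enat j < m}"
proof -
  have *: "{a i..<a (Suc i)} \<inter> {a j..<a (Suc j)} = {}" if "i < j" "enat j < m" for i j
  proof -
    have "a (Suc i) \<le> a j"
      using unit_subdivision_mono[OF assms, of "Suc i" j] that by (cases "Suc i = j") (auto intro: less_imp_le)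
    then show ?thesis by auto
  qed
  show ?thesis
    unfolding disjoint_family_on_def
  proof (intro ballI impI)
    fix i j assume "i \<in> {j. enat j < m}" "j \<in> {j. enat j < m}" "i \<noteq> j"
    then show "{a i..<a (Suc i)} \<inter> {a j..<a (Suc j)} = {}"
      using *[of i j] *[of j i] by (cases "i < j") auto
  qed
qed

end

theory Submission
  imports Defs
begin

text \<open>
  In each coordinate the frequency \<open>n + \<delta>\<^sup>*\<close> is \<open>r / \<beta>\<close>, where \<open>r\<close> is the integer nearest to \<open>\<beta> n\<close>. If a
  shift is an integer multiple of \<open>\<beta>\<close> in every coordinate, then all functions of the system are
  invariant under it (\<open>B_star_shift_invariant\<close>). The map that moves the pieces of the unit cube to the
  pieces of the split cube preserves measure, and by this invariance it carries the system on one set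
  to the same system on the other. Hence the two systems have the same frame constants
  (\<open>frame_constants_transfer\<close>), and the theorem reduces to the claim that the system is a Riesz basis on
  the cube.

  On the cube the system is a tensor product, and tensor products of Riesz bases are Riesz bases
  (\<open>tensor_system_riesz_basis\<close>). This leaves dimension one: the frequencies \<open>round (\<beta> n) / \<beta>\<close> give a Riesz
  basis on \<open>[0, 1)\<close> (\<open>rounded_frequencies_basis\<close>). They differ from the integers by at most
  \<open>1 / (2 \<beta>)\<close>, so for \<open>\<beta> > 2\<close> this is Kadec's one quarter theorem (\<open>kadec\<close>), and for \<open>\<beta> = 1\<close> and
  \<open>\<beta> = 2\<close> they are the integers themselves. For \<open>1 < \<beta> < 2\<close> the deviation is too large, but the integers
  that are not of the form \<open>round (\<beta> n)\<close> are rounded multiples of \<open>\<beta> / (\<beta> - 1) > 2\<close>, up to a shift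
  (\<open>beatty_partition\<close>). Kadec's theorem applies to them, on the complement of \<open>[0, 1/\<beta>)\<close> in \<open>[0, 1)\<close>, and
  complementary frequencies form Riesz bases on complementary sets (\<open>riesz_basis_complement\<close>).

  Throughout, a Riesz basis is a system with dense span that satisfies the Riesz inequalities for
  finite sums. This implies the frame inequalities with the same constants and unconditional
  convergence of the expansions (\<open>riesz_basis_frame_constants\<close>, \<open>riesz_basis_unconditional\<close>).
\<close>

section \<open>The seminormed space of square integrable functions\<close>

lemma l2_spaceD:
  assumes "f \<in> l2_space D"
  shows "f \<in> borel_measurable (lebesgue_on D)" "integrable (lebesgue_on D) (\<lambda>x. (cmod (f x))\<^sup>2)"
  using assms by (auto simp: l2_space_def)

lemma l2_prod_integrable:
  assumes f: "f \<in> l2_space D" and g: "g \<in> l2_space D"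
  shows "integrable (lebesgue_on D) (\<lambda>x. f x * cnj (g x))"
proof (rule Bochner_Integration.integrable_bound)
  show "integrable (lebesgue_on D) (\<lambda>x. (cmod (f x))\<^sup>2 + (cmod (g x))\<^sup>2)"
    using f g by (intro Bochner_Integration.integrable_add l2_spaceD)
  have cnj_measurable: "cnj \<in> borel_measurable borel"
    by (intro borel_measurable_continuous_onI continuous_intros)
  show "(\<lambda>x. f x * cnj (g x)) \<in> borel_measurable (lebesgue_on D)"
    by (intro borel_measurable_times l2_spaceD(1)[OF f]
          measurable_compose[OF l2_spaceD(1)[OF g] cnj_measurable])
  have "s * t \<le> s\<^sup>2 + t\<^sup>2" if "s \<ge> 0" "t \<ge> 0" for s t :: real
  proof -
    have "0 \<le> (s - t)\<^sup>2" "0 \<le> s * t" using that by simp_all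
    then show ?thesis by (simp add: power2_diff)
  qed
  then show "AE x in lebesgue_on D. norm (f x * cnj (g x)) \<le> norm ((cmod (f x))\<^sup>2 + (cmod (g x))\<^sup>2)"
    by (simp add: norm_mult)
qed

lemma l2_zero [simp]: "(\<lambda>x. 0) \<in> l2_space D"
  by (simp add: l2_space_def)

lemma l2_scale:
  assumes "f \<in> l2_space D"
  shows "(\<lambda>x. c * f x) \<in> l2_space D"
  using assms by (auto simp: l2_space_def norm_mult power_mult_distrib)

lemma l2_add:
  assumes f: "f \<in> l2_space D" and g: "g \<in> l2_space D"
  shows "(\<lambda>x. f x + g x) \<in> l2_space D"
  unfolding l2_space_def mem_Collect_eq
proof
  show m: "(\<lambda>x. f x + g x) \<in> borel_measurable (lebesgue_on D)"
    by (intro borel_measurable_add l2_spaceD(1)[OF f] l2_spaceD(1)[OF g])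
  have "(cmod (z + w))\<^sup>2 \<le> 2 * (cmod z)\<^sup>2 + 2 * (cmod w)\<^sup>2" for z w
  proof -
    have "(cmod (z + w))\<^sup>2 \<le> (cmod z + cmod w)\<^sup>2"
      by (intro power_mono norm_triangle_ineq) auto
    also have "\<dots> \<le> 2 * (cmod z)\<^sup>2 + 2 * (cmod w)\<^sup>2"
      using sum_squares_bound[of "cmod z" "cmod w"] by (simp add: power2_sum)
    finally show ?thesis .
  qed
  then show "integrable (lebesgue_on D) (\<lambda>x. (cmod (f x + g x))\<^sup>2)"
    using m by (intro Bochner_Integration.integrable_bound[OF Bochner_Integration.integrable_add[OF
      integrable_mult_right[OF l2_spaceD(2)[OF f], of 2] integrable_mult_right[OF l2_spaceD(2)[OF g], of 2]]])
      auto
qed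

lemma l2_diff:
  assumes "f \<in> l2_space D" and "g \<in> l2_space D"
  shows "(\<lambda>x. f x - g x) \<in> l2_space D"
  using l2_add[OF assms(1) l2_scale[OF assms(2), of "-1"]] by simp

lemma l2_sum:
  assumes "\<And>n. n \<in> F \<Longrightarrow> g n \<in> l2_space D"
  shows "(\<lambda>x. \<Sum>n\<in>F. g n x) \<in> l2_space D"
  using assms by (induction F rule: infinite_finite_induct) (auto intro: l2_add)

lemma l2_lincomb:
  assumes "\<And>n. v n \<in> l2_space D"
  shows "(\<lambda>x. \<Sum>n\<in>F. c n * v n x) \<in> l2_space D"
  by (intro l2_sum l2_scale assms)

lemma l2_space_cong:
  assumes "\<And>x. x \<in> D \<Longrightarrow> f x = g x"
  shows "f \<in> l2_space D \<longleftrightarrow> g \<in> l2_space D"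
proof -
  have sp: "x \<in> space (lebesgue_on D) \<Longrightarrow> x \<in> D" for x by (simp add: space_restrict_space)
  show ?thesis unfolding l2_space_def mem_Collect_eq
    by (intro conj_cong measurable_cong Bochner_Integration.integrable_cong) (auto dest!: sp simp: assms)
qed

lemma l2_inner_cong:
  assumes "\<And>x. x \<in> D \<Longrightarrow> f x = f' x" "\<And>x. x \<in> D \<Longrightarrow> g x = g' x"
  shows "l2_inner D f g = l2_inner D f' g'"
  unfolding l2_inner_def using assms
  by (intro Bochner_Integration.integral_cong) (auto simp: space_restrict_space)

lemma l2_norm_cong:
  assumes "\<And>x. x \<in> D \<Longrightarrow> cmod (f x) = cmod (g x)"
  shows "l2_norm D f = l2_norm D g"
  unfolding l2_norm_def using assms
  by (intro arg_cong[of _ _ sqrt] Bochner_Integration.integral_cong) (auto simp: space_restrict_space)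

lemma l2_norm_nonneg [simp]: "0 \<le> l2_norm D f"
  by (simp add: l2_norm_def)

lemma l2_norm_square: "(l2_norm D f)\<^sup>2 = (LINT x|lebesgue_on D. (cmod (f x))\<^sup>2)"
  by (simp add: l2_norm_def)

lemma l2_inner_self: "l2_inner D f f = complex_of_real ((l2_norm D f)\<^sup>2)"
  by (simp add: l2_inner_def l2_norm_square complex_norm_square[symmetric] flip: integral_complex_of_real)

lemma l2_inner_commute: "l2_inner D g f = cnj (l2_inner D f g)"
proof -
  have "l2_inner D g f = (LINT x|lebesgue_on D. cnj (f x * cnj (g x)))"
    by (simp add: l2_inner_def mult.commute)
  then show ?thesis unfolding l2_inner_def by (simp only: Bochner_Integration.integral_cnj)
qed

lemma l2_inner_scale_left: "l2_inner D (\<lambda>x. c * f x) g = c * l2_inner D f g"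
  by (simp add: l2_inner_def mult.assoc)

lemma l2_inner_scale_right: "l2_inner D f (\<lambda>x. c * g x) = cnj c * l2_inner D f g"
  by (metis complex_cnj_mult l2_inner_commute l2_inner_scale_left)

lemma l2_inner_add_left:
  assumes "f \<in> l2_space D" "g \<in> l2_space D" "h \<in> l2_space D"
  shows "l2_inner D (\<lambda>x. f x + g x) h = l2_inner D f h + l2_inner D g h"
  using l2_prod_integrable[OF assms(1,3)] l2_prod_integrable[OF assms(2,3)]
  by (simp add: l2_inner_def distrib_right)

lemma l2_inner_diff_left:
  assumes "f \<in> l2_space D" "g \<in> l2_space D" "h \<in> l2_space D"
  shows "l2_inner D (\<lambda>x. f x - g x) h = l2_inner D f h - l2_inner D g h"
  using l2_prod_integrable[OF assms(1,3)] l2_prod_integrable[OF assms(2,3)]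
  by (simp add: l2_inner_def left_diff_distrib)

lemma l2_inner_diff_right:
  assumes "f \<in> l2_space D" "g \<in> l2_space D" "h \<in> l2_space D"
  shows "l2_inner D f (\<lambda>x. g x - h x) = l2_inner D f g - l2_inner D f h"
  using l2_inner_diff_left[OF assms(2,3,1)] by (metis complex_cnj_diff l2_inner_commute)

lemma l2_inner_lincomb_left:
  assumes "\<And>n. v n \<in> l2_space D" "g \<in> l2_space D"
  shows "l2_inner D (\<lambda>x. \<Sum>n\<in>F. c n * v n x) g = (\<Sum>n\<in>F. c n * l2_inner D (v n) g)"
proof (induction F rule: infinite_finite_induct)
  case (insert n F)
  then show ?case
    using l2_inner_add_left[OF l2_scale[OF assms(1), of "c n" n] l2_lincomb[of v D c F, OF assms(1)] assms(2)]
    by (simp add: l2_inner_scale_left)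
qed (auto simp: l2_inner_def)

lemma l2_inner_lincomb_right:
  assumes "\<And>n. v n \<in> l2_space D" "g \<in> l2_space D"
  shows "l2_inner D g (\<lambda>x. \<Sum>n\<in>F. c n * v n x) = (\<Sum>n\<in>F. cnj (c n) * l2_inner D g (v n))"
proof -
  have "l2_inner D g (\<lambda>x. \<Sum>n\<in>F. c n * v n x) = cnj (\<Sum>n\<in>F. c n * l2_inner D (v n) g)"
    by (subst l2_inner_commute, subst l2_inner_lincomb_left[OF assms]) simp
  also have "\<dots> = (\<Sum>n\<in>F. cnj (c n) * cnj (l2_inner D (v n) g))" by (simp add: cnj_sum)
  also have "\<dots> = (\<Sum>n\<in>F. cnj (c n) * l2_inner D g (v n))" by (simp add: l2_inner_commute[of D g])
  finally show ?thesis .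
qed

lemma l2_norm_scale: "l2_norm D (\<lambda>x. c * f x) = cmod c * l2_norm D f"
  by (simp add: l2_norm_def norm_mult power_mult_distrib real_sqrt_mult)

lemma l2_norm_minus_commute: "l2_norm D (\<lambda>x. f x - g x) = l2_norm D (\<lambda>x. g x - f x)"
  by (intro l2_norm_cong norm_minus_commute)

lemma l2_norm_zero [simp]: "l2_norm D (\<lambda>x. 0) = 0"
  by (simp add: l2_norm_def)

lemma l2_norm_diff_square:
  assumes "f \<in> l2_space D" "g \<in> l2_space D"
  shows "(l2_norm D (\<lambda>x. f x - g x))\<^sup>2 = (l2_norm D f)\<^sup>2 - 2 * Re (l2_inner D f g) + (l2_norm D g)\<^sup>2"
proof -
  have "complex_of_real ((l2_norm D (\<lambda>x. f x - g x))\<^sup>2)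
      = l2_inner D f f - l2_inner D g f - (l2_inner D f g - l2_inner D g g)"
    unfolding l2_inner_self[symmetric]
    by (simp add: l2_inner_diff_left l2_inner_diff_right l2_diff assms)
  then have "(l2_norm D (\<lambda>x. f x - g x))\<^sup>2
      = Re (l2_inner D f f - l2_inner D g f - (l2_inner D f g - l2_inner D g g))"
    by (metis Re_complex_of_real)
  also have "\<dots> = (l2_norm D f)\<^sup>2 - 2 * Re (l2_inner D f g) + (l2_norm D g)\<^sup>2"
    by (simp add: l2_inner_self l2_inner_commute[of D g f])
  finally show ?thesis .
qed

lemma l2_Cauchy_Schwarz:
  assumes f: "f \<in> l2_space D" and g: "g \<in> l2_space D"
  shows "cmod (l2_inner D f g) \<le> l2_norm D f * l2_norm D g"
proof -
  define p where "p = l2_inner D f g"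
  \<comment> \<open>Expand \<open>0 \<le> \<parallel>f - t p g\<parallel>\<^sup>2\<close>; as \<open>p = \<langle>f, g\<rangle>\<close>, the mixed term is real.\<close>
  have *: "2 * t * (cmod p)\<^sup>2 \<le> (l2_norm D f)\<^sup>2 + t\<^sup>2 * (cmod p)\<^sup>2 * (l2_norm D g)\<^sup>2" for t :: real
  proof -
    have "Re (l2_inner D f (\<lambda>x. (of_real t * p) * g x)) = t * (cmod p)\<^sup>2"
      unfolding l2_inner_scale_right p_def[symmetric]
      by (simp add: complex_norm_square[symmetric] cmod_power2 power2_eq_square[of "Re p"] power2_eq_square[of "Im p"] algebra_simps del: of_real_power)
    then have "0 \<le> (l2_norm D f)\<^sup>2 - 2 * (t * (cmod p)\<^sup>2) + (l2_norm D (\<lambda>x. (of_real t * p) * g x))\<^sup>2"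
      using l2_norm_diff_square[OF f l2_scale[OF g, of "of_real t * p"]] by (metis zero_le_power2)
    then show ?thesis by (simp add: l2_norm_scale norm_mult power_mult_distrib)
  qed
  show ?thesis
  proof (cases "p = 0")
    case False
    define P where "P = (cmod p)\<^sup>2"
    have P: "P > 0" using False by (simp add: P_def)
    have "P \<le> (l2_norm D f)\<^sup>2 * (l2_norm D g)\<^sup>2"
    proof (cases "l2_norm D g = 0")
      case True
      then have "2 * ((l2_norm D f)\<^sup>2 / P) * P \<le> (l2_norm D f)\<^sup>2"
        using *[of "(l2_norm D f)\<^sup>2 / P"] by (simp add: P_def)
      then have "(l2_norm D f)\<^sup>2 \<le> 0" using P by simp
      then have "2 * P \<le> 0" using *[of 1] True by (simp add: P_def)
      with P show ?thesis by simp
    next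
      case False
      then have G: "(l2_norm D g)\<^sup>2 > 0" by simp
      have "2 * (1 / (l2_norm D g)\<^sup>2) * P \<le> (l2_norm D f)\<^sup>2 + (1 / (l2_norm D g)\<^sup>2)\<^sup>2 * P * (l2_norm D g)\<^sup>2"
        using *[of "1 / (l2_norm D g)\<^sup>2"] by (simp add: P_def)
      also have "(1 / (l2_norm D g)\<^sup>2)\<^sup>2 * P * (l2_norm D g)\<^sup>2 = P / (l2_norm D g)\<^sup>2"
        using G by (simp add: power2_eq_square)
      finally have "P / (l2_norm D g)\<^sup>2 \<le> (l2_norm D f)\<^sup>2" by simp
      then show ?thesis using G by (simp add: divide_le_eq)
    qed
    then have "(cmod p)\<^sup>2 \<le> (l2_norm D f * l2_norm D g)\<^sup>2" by (simp add: P_def power_mult_distrib)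
    then show ?thesis unfolding p_def by (rule power2_le_imp_le) simp
  qed (simp add: p_def)
qed

lemma l2_norm_triangle_diff:
  assumes f: "f \<in> l2_space D" and g: "g \<in> l2_space D"
  shows "l2_norm D (\<lambda>x. f x - g x) \<le> l2_norm D f + l2_norm D g"
proof (rule power2_le_imp_le)
  have "- Re (l2_inner D f g) \<le> l2_norm D f * l2_norm D g"
    using l2_Cauchy_Schwarz[OF assms] abs_Re_le_cmod[of "l2_inner D f g"] by linarith
  then show "(l2_norm D (\<lambda>x. f x - g x))\<^sup>2 \<le> (l2_norm D f + l2_norm D g)\<^sup>2"
    by (simp add: l2_norm_diff_square[OF assms] power2_sum)
qed simp

lemma l2_norm_triangle:
  assumes f: "f \<in> l2_space D" and g: "g \<in> l2_space D"
  shows "l2_norm D (\<lambda>x. f x + g x) \<le> l2_norm D f + l2_norm D g"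
  using l2_norm_triangle_diff[OF f l2_scale[OF g, of "-1"]] l2_norm_scale[of D "-1" g] by simp

lemma l2_norm_triangle_mid:
  assumes f: "f \<in> l2_space D" and g: "g \<in> l2_space D" and h: "h \<in> l2_space D"
  shows "l2_norm D (\<lambda>x. f x - h x) \<le> l2_norm D (\<lambda>x. f x - g x) + l2_norm D (\<lambda>x. g x - h x)"
  using l2_norm_triangle[OF l2_diff[OF f g] l2_diff[OF g h]] by simp


section \<open>Riesz sequences and Riesz bases\<close>

definition lin_span :: "('i \<Rightarrow> 'a \<Rightarrow> complex) \<Rightarrow> ('a \<Rightarrow> complex) set" where
  "lin_span v = {g. \<exists>F c. finite F \<and> g = (\<lambda>x. \<Sum>n\<in>F. c n * v n x)}"

definition l2_closure :: "'a::euclidean_space set \<Rightarrow> ('a \<Rightarrow> complex) set \<Rightarrow> ('a \<Rightarrow> complex) set" where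
  "l2_closure D V = {f \<in> l2_space D. \<forall>\<epsilon>>0. \<exists>g\<in>V. l2_norm D (\<lambda>x. f x - g x) < \<epsilon>}"

definition riesz_sequence ::
    "'a::euclidean_space set \<Rightarrow> ('i \<Rightarrow> 'a \<Rightarrow> complex) \<Rightarrow> real \<Rightarrow> real \<Rightarrow> bool" where
  "riesz_sequence D v A B \<longleftrightarrow>
     0 < A \<and> 0 < B \<and> (\<forall>n. v n \<in> l2_space D) \<and>
     (\<forall>F (c :: 'i \<Rightarrow> complex). finite F \<longrightarrow>
        A * (\<Sum>n\<in>F. (cmod (c n))\<^sup>2) \<le> (l2_norm D (\<lambda>x. \<Sum>n\<in>F. c n * v n x))\<^sup>2 \<and>
        (l2_norm D (\<lambda>x. \<Sum>n\<in>F. c n * v n x))\<^sup>2 \<le> B * (\<Sum>n\<in>F. (cmod (c n))\<^sup>2))"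

text \<open>
  The synthesis inequalities of \<open>frame_constants\<close> together with density of the span. Density
  stands in for the analysis inequalities because it is what limits, changes of variable and tensor
  products act on directly; \<open>riesz_basis_frame_constants\<close> recovers the latter with the same
  constants \<open>A\<close> and \<open>B\<close>.
\<close>

definition riesz_basis ::
    "'a::euclidean_space set \<Rightarrow> ('i \<Rightarrow> 'a \<Rightarrow> complex) \<Rightarrow> real \<Rightarrow> real \<Rightarrow> bool" where
  "riesz_basis D v A B \<longleftrightarrow> riesz_sequence D v A B \<and> l2_space D \<subseteq> l2_closure D (lin_span v)"

lemma riesz_sequenceD:
  assumes "riesz_sequence D v A B"
  shows "0 < A" "0 < B" "v n \<in> l2_space D"
    "finite F \<Longrightarrow> A * (\<Sum>n\<in>F. (cmod (c n))\<^sup>2) \<le> (l2_norm D (\<lambda>x. \<Sum>n\<in>F. c n * v n x))\<^sup>2"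
    "finite F \<Longrightarrow> (l2_norm D (\<lambda>x. \<Sum>n\<in>F. c n * v n x))\<^sup>2 \<le> B * (\<Sum>n\<in>F. (cmod (c n))\<^sup>2)"
  using assms unfolding riesz_sequence_def by blast+

lemma lin_spanI: "finite F \<Longrightarrow> (\<lambda>x. \<Sum>n\<in>F. c n * v n x) \<in> lin_span v"
  by (auto simp: lin_span_def)

lemma lin_span_member: "v n \<in> lin_span v"
  using lin_spanI[of "{n}" "\<lambda>_. 1" v] by simp

lemma lin_span_scale:
  assumes "g \<in> lin_span v"
  shows "(\<lambda>x. c * g x) \<in> lin_span v"
proof -
  obtain F d where F: "finite F" "g = (\<lambda>x. \<Sum>n\<in>F. d n * v n x)" using assms by (auto simp: lin_span_def)
  have "(\<lambda>x. c * g x) = (\<lambda>x. \<Sum>n\<in>F. (c * d n) * v n x)"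
    by (simp add: F(2) sum_distrib_left mult.assoc)
  then show ?thesis using lin_spanI[OF F(1)] by simp
qed

lemma lin_span_add:
  assumes "g \<in> lin_span v" "h \<in> lin_span v"
  shows "(\<lambda>x. g x + h x) \<in> lin_span v"
proof -
  obtain F c where F: "finite F" "g = (\<lambda>x. \<Sum>n\<in>F. c n * v n x)" using assms(1) by (auto simp: lin_span_def)
  obtain G d where G: "finite G" "h = (\<lambda>x. \<Sum>n\<in>G. d n * v n x)" using assms(2) by (auto simp: lin_span_def)
  have "(\<Sum>n\<in>F. c n * v n x) + (\<Sum>n\<in>G. d n * v n x)
      = (\<Sum>n\<in>F\<union>G. ((if n \<in> F then c n else 0) + (if n \<in> G then d n else 0)) * v n x)" for x
  proof -
    have "(\<Sum>n\<in>F. c n * v n x) = (\<Sum>n\<in>F\<union>G. (if n \<in> F then c n else 0) * v n x)"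
      using F(1) G(1) by (intro sum.mono_neutral_cong_left) auto
    moreover have "(\<Sum>n\<in>G. d n * v n x) = (\<Sum>n\<in>F\<union>G. (if n \<in> G then d n else 0) * v n x)"
      using F(1) G(1) by (intro sum.mono_neutral_cong_left) auto
    ultimately show ?thesis by (simp only: distrib_right sum.distrib)
  qed
  then have "(\<lambda>x. g x + h x)
      = (\<lambda>x. \<Sum>n\<in>F\<union>G. ((if n \<in> F then c n else 0) + (if n \<in> G then d n else 0)) * v n x)"
    unfolding F(2) G(2) by (rule ext)
  moreover have "finite (F \<union> G)" using F(1) G(1) by simp
  ultimately show ?thesis by (simp only: lin_spanI)
qed

lemma lin_span_subset_l2:
  assumes "\<And>n. v n \<in> l2_space D" "g \<in> lin_span v"
  shows "g \<in> l2_space D"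
  using assms by (auto simp: lin_span_def intro: l2_lincomb)

lemma l2_closureE:
  assumes "f \<in> l2_closure D V" "\<epsilon> > 0"
  obtains g where "g \<in> V" "l2_norm D (\<lambda>x. f x - g x) < \<epsilon>"
  using assms by (auto simp: l2_closure_def)

lemma l2_closure_l2: "f \<in> l2_closure D V \<Longrightarrow> f \<in> l2_space D"
  by (simp add: l2_closure_def)

lemma l2_closure_superset: "V \<subseteq> l2_space D \<Longrightarrow> V \<subseteq> l2_closure D V"
  by (auto simp: l2_closure_def intro!: bexI)

lemma l2_closure_closed:
  assumes V: "V \<subseteq> l2_space D" and f: "f \<in> l2_space D"
    and ap: "\<And>\<epsilon>. \<epsilon> > 0 \<Longrightarrow> \<exists>g\<in>l2_closure D V. l2_norm D (\<lambda>x. f x - g x) < \<epsilon>"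
  shows "f \<in> l2_closure D V"
  unfolding l2_closure_def mem_Collect_eq
proof (intro conjI f allI impI)
  fix \<epsilon> :: real assume "\<epsilon> > 0"
  then have e2: "\<epsilon> / 2 > 0" by simp
  obtain g where g: "g \<in> l2_closure D V" "l2_norm D (\<lambda>x. f x - g x) < \<epsilon> / 2" using ap[OF e2] by blast
  obtain h where h: "h \<in> V" "l2_norm D (\<lambda>x. g x - h x) < \<epsilon> / 2" using g(1) e2 by (rule l2_closureE)
  have "l2_norm D (\<lambda>x. f x - h x) < \<epsilon>"
    using l2_norm_triangle_mid[OF f l2_closure_l2[OF g(1)], of h] g(2) h V by auto
  with h(1) show "\<exists>h\<in>V. l2_norm D (\<lambda>x. f x - h x) < \<epsilon>" by blast
qed

lemma l2_closure_span_add: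
  assumes v: "\<And>n. v n \<in> l2_space D"
    and f: "f \<in> l2_closure D (lin_span v)" and g: "g \<in> l2_closure D (lin_span v)"
  shows "(\<lambda>x. f x + g x) \<in> l2_closure D (lin_span v)"
  unfolding l2_closure_def mem_Collect_eq
proof (intro conjI allI impI l2_add l2_closure_l2[OF f] l2_closure_l2[OF g])
  fix \<epsilon> :: real assume "\<epsilon> > 0"
  then have e2: "\<epsilon> / 2 > 0" by simp
  obtain f' where f': "f' \<in> lin_span v" "l2_norm D (\<lambda>x. f x - f' x) < \<epsilon> / 2" using f e2 by (rule l2_closureE)
  obtain g' where g': "g' \<in> lin_span v" "l2_norm D (\<lambda>x. g x - g' x) < \<epsilon> / 2" using g e2 by (rule l2_closureE)
  have "l2_norm D (\<lambda>x. (f x - f' x) + (g x - g' x)) < \<epsilon>"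
    using l2_norm_triangle[OF l2_diff[OF l2_closure_l2[OF f] lin_span_subset_l2[OF v f'(1)]]
        l2_diff[OF l2_closure_l2[OF g] lin_span_subset_l2[OF v g'(1)]]] f'(2) g'(2) by simp
  then have "l2_norm D (\<lambda>x. (f x + g x) - (f' x + g' x)) < \<epsilon>" by (simp add: algebra_simps)
  then show "\<exists>h\<in>lin_span v. l2_norm D (\<lambda>x. f x + g x - h x) < \<epsilon>"
    using lin_span_add[OF f'(1) g'(1)] by (intro bexI[of _ "\<lambda>x. f' x + g' x"])
qed

lemma l2_closure_span_scale:
  assumes v: "\<And>n. v n \<in> l2_space D" and f: "f \<in> l2_closure D (lin_span v)"
  shows "(\<lambda>x. c * f x) \<in> l2_closure D (lin_span v)"
  unfolding l2_closure_def mem_Collect_eq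
proof (intro conjI allI impI l2_scale l2_closure_l2[OF f])
  fix \<epsilon> :: real assume e: "\<epsilon> > 0"
  then have "\<epsilon> / (cmod c + 1) > 0" by (intro divide_pos_pos) (auto simp: add_nonneg_pos)
  then obtain g where g: "g \<in> lin_span v" "l2_norm D (\<lambda>x. f x - g x) < \<epsilon> / (cmod c + 1)"
    using f by (metis l2_closureE)
  have "l2_norm D (\<lambda>x. c * f x - c * g x) = cmod c * l2_norm D (\<lambda>x. f x - g x)"
    by (simp add: l2_norm_scale flip: right_diff_distrib)
  also have "\<dots> \<le> (cmod c + 1) * l2_norm D (\<lambda>x. f x - g x)" by (intro mult_right_mono) auto
  also have "\<dots> < \<epsilon>" using g(2) by (simp add: less_divide_eq mult.commute add_nonneg_pos split: if_splits)
  finally show "\<exists>h\<in>lin_span v. l2_norm D (\<lambda>x. c * f x - h x) < \<epsilon>"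
    using lin_span_scale[OF g(1)] by (intro bexI[of _ "\<lambda>x. c * g x"])
qed

lemma l2_closure_span_lincomb:
  assumes v: "\<And>n. v n \<in> l2_space D" and g: "\<And>i. i \<in> F \<Longrightarrow> g i \<in> l2_closure D (lin_span v)"
  shows "(\<lambda>x. \<Sum>i\<in>F. c i * g i x) \<in> l2_closure D (lin_span v)"
  using g
proof (induction F rule: infinite_finite_induct)
  case (insert i F)
  have "(\<lambda>x. c i * g i x + (\<Sum>i\<in>F. c i * g i x)) \<in> l2_closure D (lin_span v)"
    using insert by (intro l2_closure_span_add l2_closure_span_scale v) auto
  then show ?case using insert by simp
qed (use lin_spanI[of "{}" _ v] l2_closure_superset[of "lin_span v" D] lin_span_subset_l2[of v D] v in auto)

text \<open>
  The approximation step can be repeated on the remainder \<open>w - s\<close>, which then shrinks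
  geometrically. In this form an estimate of the kind \<open>\<parallel>1 - T\<parallel> < 1\<close>, for an operator \<open>T\<close> with values
  in the closed span, gives density at once.
\<close>

lemma dense_by_contraction:
  assumes v: "\<And>n. v n \<in> l2_space D" and q: "0 \<le> q" "q < 1"
    and step: "\<And>w. w \<in> l2_space D \<Longrightarrow> \<exists>s\<in>lin_span v. l2_norm D (\<lambda>x. w x - s x) \<le> q * l2_norm D w"
  shows "l2_space D \<subseteq> l2_closure D (lin_span v)"
proof
  fix w :: "'b \<Rightarrow> complex" assume w: "w \<in> l2_space D"
  have iter: "\<exists>s\<in>lin_span v. l2_norm D (\<lambda>x. w x - s x) \<le> q ^ k * l2_norm D w" for k
  proof (induction k)
    case 0
    show ?case using lin_spanI[of "{}" "\<lambda>_. 0" v] by (intro bexI[of _ "\<lambda>x. 0"]) auto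
  next
    case (Suc k)
    then obtain s where s: "s \<in> lin_span v" "l2_norm D (\<lambda>x. w x - s x) \<le> q ^ k * l2_norm D w" by blast
    obtain t where t: "t \<in> lin_span v"
        "l2_norm D (\<lambda>x. (w x - s x) - t x) \<le> q * l2_norm D (\<lambda>x. w x - s x)"
      using step[OF l2_diff[OF w lin_span_subset_l2[OF v s(1)]]] by blast
    have "l2_norm D (\<lambda>x. w x - (s x + t x)) \<le> q ^ Suc k * l2_norm D w"
      using t(2) mult_left_mono[OF s(2) q(1)] by (simp add: diff_diff_eq mult.assoc)
    then show ?case using lin_span_add[OF s(1) t(1)] by (intro bexI[of _ "\<lambda>x. s x + t x"])
  qed
  show "w \<in> l2_closure D (lin_span v)"
    unfolding l2_closure_def mem_Collect_eq
  proof (intro conjI w allI impI)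
    fix \<epsilon> :: real assume e: "\<epsilon> > 0"
    then have "\<epsilon> / (l2_norm D w + 1) > 0" by (intro divide_pos_pos) (auto simp: add_nonneg_pos)
    then obtain k where k: "q ^ k < \<epsilon> / (l2_norm D w + 1)" using q(2) by (metis real_arch_pow_inv)
    have "q ^ k * l2_norm D w \<le> q ^ k * (l2_norm D w + 1)" using q by (intro mult_left_mono) auto
    also have "\<dots> < \<epsilon>" using k by (simp add: less_divide_eq add_nonneg_pos split: if_splits)
    finally show "\<exists>s\<in>lin_span v. l2_norm D (\<lambda>x. w x - s x) < \<epsilon>"
      using iter[of k] by force
  qed
qed

text \<open>
  The lower Riesz bound makes the coefficients of any approximants of \<open>f\<close> a Cauchy sequence in
  \<open>\<ell>\<^sup>2\<close>; the limit \<open>c\<close> exists because \<open>\<ell>\<^sup>2\<close> is complete, and the upper bound turns closeness of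
  coefficients back into closeness of sums. Convergence holds along the directed set of all finite
  index sets, which is what independence of the enumeration requires.
\<close>

lemma riesz_expansion:
  assumes R: "riesz_basis D v A B" and f: "f \<in> l2_space D"
  obtains c where "\<And>\<epsilon>. \<epsilon> > 0 \<Longrightarrow> \<exists>F0. finite F0 \<and>
      (\<forall>F. finite F \<longrightarrow> F0 \<subseteq> F \<longrightarrow> l2_norm D (\<lambda>x. f x - (\<Sum>n\<in>F. c n * v n x)) < \<epsilon>)"
proof -
  have rs: "riesz_sequence D v A B" using R by (simp add: riesz_basis_def)
  note A = riesz_sequenceD(1)[OF rs] and B = riesz_sequenceD(2)[OF rs]
    and v = riesz_sequenceD(3)[OF rs] and lower = riesz_sequenceD(4)[OF rs]
    and upper = riesz_sequenceD(5)[OF rs]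
  have fc: "f \<in> l2_closure D (lin_span v)" using R f by (auto simp: riesz_basis_def)
  define good where "good j p \<longleftrightarrow> finite (fst p) \<and>
      l2_norm D (\<lambda>x. f x - (\<Sum>n\<in>fst p. snd p n * v n x)) < inverse (real (Suc j)) \<and>
      (\<forall>n. n \<notin> fst p \<longrightarrow> snd p n = 0)" for j p
  have "\<exists>p. good j p" for j
  proof -
    obtain g where "g \<in> lin_span v" "l2_norm D (\<lambda>x. f x - g x) < inverse (real (Suc j))"
      using l2_closureE[OF fc, of "inverse (real (Suc j))"] by auto
    then obtain F d where "finite F" "l2_norm D (\<lambda>x. f x - (\<Sum>n\<in>F. d n * v n x)) < inverse (real (Suc j))"
      by (auto simp: lin_span_def)
    then show ?thesis unfolding good_def
      by (intro exI[of _ "(F, \<lambda>n. if n \<in> F then d n else 0)"]) (auto cong: sum.cong)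
  qed
  then obtain p where p: "\<And>j. good j (p j)" by metis
  define S where "S j = fst (p j)" for j
  define d where "d j = snd (p j)" for j
  define g where "g j = (\<lambda>x. \<Sum>n\<in>S j. d j n * v n x)" for j
  have S: "finite (S j)" and off: "n \<notin> S j \<Longrightarrow> d j n = 0"
    and apx: "l2_norm D (\<lambda>x. f x - g j x) < inverse (real (Suc j))" for j n
    using p[of j] by (auto simp: good_def S_def d_def g_def)
  have g: "g j \<in> l2_space D" for j unfolding g_def by (intro l2_lincomb v)
  have g_super: "g j x = (\<Sum>n\<in>F. d j n * v n x)" if "finite F" "S j \<subseteq> F" for F j x
    unfolding g_def using that off by (intro sum.mono_neutral_left) auto
  have diff: "A * (\<Sum>n\<in>F. (cmod (d j n - d i n))\<^sup>2) \<le> (inverse (real (Suc j)) + inverse (real (Suc i)))\<^sup>2"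
    if "finite F" for F i j
  proof -
    let ?G = "F \<union> S i \<union> S j"
    have G: "finite ?G" using that S by auto
    have "A * (\<Sum>n\<in>F. (cmod (d j n - d i n))\<^sup>2) \<le> A * (\<Sum>n\<in>?G. (cmod (d j n - d i n))\<^sup>2)"
      using A G by (intro mult_left_mono sum_mono2) auto
    also have "\<dots> \<le> (l2_norm D (\<lambda>x. \<Sum>n\<in>?G. (d j n - d i n) * v n x))\<^sup>2"
      using lower[OF G, of "\<lambda>n. d j n - d i n"] .
    also have "(\<lambda>x. \<Sum>n\<in>?G. (d j n - d i n) * v n x) = (\<lambda>x. g j x - g i x)"
      using g_super[OF G, of j] g_super[OF G, of i] by (simp add: left_diff_distrib sum_subtractf sup.coboundedI2 sup.coboundedI1)
    also have "(l2_norm D (\<lambda>x. g j x - g i x))\<^sup>2 \<le> (inverse (real (Suc j)) + inverse (real (Suc i)))\<^sup>2"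
    proof (intro power_mono l2_norm_nonneg)
      show "l2_norm D (\<lambda>x. g j x - g i x) \<le> inverse (real (Suc j)) + inverse (real (Suc i))"
        using l2_norm_triangle_mid[OF g[of j] f g[of i]] apx[of i] apx[of j]
        unfolding l2_norm_minus_commute[of D "g j" f] by linarith
    qed
    finally show ?thesis .
  qed
  have conv: "\<exists>c. (\<lambda>i. d i n) \<longlonglongrightarrow> c" for n
  proof -
    have "Cauchy (\<lambda>i. d i n)"
    proof (rule CauchyI)
      fix e :: real assume e: "e > 0"
      obtain M where M: "inverse (real (Suc M)) < sqrt A * e / 2" using e A reals_Archimedean[of "sqrt A * e / 2"] by auto
      show "\<exists>M. \<forall>m\<ge>M. \<forall>k\<ge>M. norm (d m n - d k n) < e"
      proof (intro exI[of _ M] allI impI)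
        fix m k assume mk: "M \<le> m" "M \<le> k"
        then have "inverse (real (Suc m)) \<le> inverse (real (Suc M))" "inverse (real (Suc k)) \<le> inverse (real (Suc M))"
          by (auto intro!: le_imp_inverse_le)
        then have "inverse (real (Suc m)) + inverse (real (Suc k)) < sqrt A * e" using M by linarith
        then have "(inverse (real (Suc m)) + inverse (real (Suc k)))\<^sup>2 < (sqrt A * e)\<^sup>2"
          by (intro power_strict_mono) auto
        also have "(sqrt A * e)\<^sup>2 = A * e\<^sup>2" using A by (simp add: power_mult_distrib)
        finally have "A * (\<Sum>n\<in>{n}. (cmod (d m n - d k n))\<^sup>2) < A * e\<^sup>2"
          using diff[of "{n}" m k, OF finite.insertI[OF finite.emptyI]] by linarith
        then have "(cmod (d m n - d k n))\<^sup>2 < e\<^sup>2" using A by simp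
        then show "norm (d m n - d k n) < e" using e by (simp add: power2_less_imp_less)
      qed
    qed
    then show ?thesis by (auto simp: Cauchy_convergent_iff convergent_def)
  qed
  then obtain c where c: "\<And>n. (\<lambda>i. d i n) \<longlonglongrightarrow> c n" by metis
  have dc: "A * (\<Sum>n\<in>F. (cmod (d j n - c n))\<^sup>2) \<le> (inverse (real (Suc j)))\<^sup>2" if "finite F" for F j
  proof (rule tendsto_le[OF sequentially_bot])
    show "(\<lambda>i. A * (\<Sum>n\<in>F. (cmod (d j n - d i n))\<^sup>2)) \<longlonglongrightarrow> A * (\<Sum>n\<in>F. (cmod (d j n - c n))\<^sup>2)"
      by (intro tendsto_intros c)
    show "(\<lambda>i. (inverse (real (Suc j)) + inverse (real (Suc i)))\<^sup>2) \<longlonglongrightarrow> (inverse (real (Suc j)))\<^sup>2"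
      using tendsto_power[OF tendsto_add[OF tendsto_const LIMSEQ_inverse_real_of_nat], of _ 2] by simp
    show "\<forall>\<^sub>F i in sequentially. A * (\<Sum>n\<in>F. (cmod (d j n - d i n))\<^sup>2) \<le> (inverse (real (Suc j)) + inverse (real (Suc i)))\<^sup>2"
      using diff[OF that] by simp
  qed
  define K where "K = 1 + sqrt (B / A)"
  have K: "K > 0" using A B by (simp add: K_def add_pos_nonneg)
  have est: "l2_norm D (\<lambda>x. f x - (\<Sum>n\<in>F. c n * v n x)) \<le> K * inverse (real (Suc j))"
    if F: "finite F" "S j \<subseteq> F" for F j
  proof -
    let ?s = "\<lambda>x. \<Sum>n\<in>F. c n * v n x"
    have s: "?s \<in> l2_space D" by (intro l2_lincomb v)
    have "(\<lambda>x. g j x - ?s x) = (\<lambda>x. \<Sum>n\<in>F. (d j n - c n) * v n x)"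
      using g_super[OF F] by (simp add: left_diff_distrib sum_subtractf)
    then have "(l2_norm D (\<lambda>x. g j x - ?s x))\<^sup>2 \<le> B * (\<Sum>n\<in>F. (cmod (d j n - c n))\<^sup>2)"
      using upper[OF F(1), of "\<lambda>n. d j n - c n"] by simp
    also have "\<dots> = B / A * (A * (\<Sum>n\<in>F. (cmod (d j n - c n))\<^sup>2))" using A by simp
    also have "\<dots> \<le> B / A * (inverse (real (Suc j)))\<^sup>2" using dc[OF F(1), of j] A B by (intro mult_left_mono) auto
    also have "\<dots> = (sqrt (B / A) * inverse (real (Suc j)))\<^sup>2" using A B by (simp add: power_mult_distrib)
    finally have "l2_norm D (\<lambda>x. g j x - ?s x) \<le> sqrt (B / A) * inverse (real (Suc j))"
      by (rule power2_le_imp_le) (use A B in simp)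
    then show ?thesis
      using l2_norm_triangle_mid[OF f g[of j] s] apx[of j] unfolding K_def by (simp add: algebra_simps)
  qed
  have close: "\<exists>F0. finite F0 \<and>
      (\<forall>F. finite F \<longrightarrow> F0 \<subseteq> F \<longrightarrow> l2_norm D (\<lambda>x. f x - (\<Sum>n\<in>F. c n * v n x)) < \<epsilon>)"
    if "\<epsilon> > 0" for \<epsilon>
  proof -
    have "\<epsilon> / K > 0" using that K by simp
    then obtain j where j: "inverse (real (Suc j)) < \<epsilon> / K" using reals_Archimedean by blast
    have small: "K * inverse (real (Suc j)) < \<epsilon>"
      using mult_strict_left_mono[OF j K] K by simp
    show ?thesis
    proof (intro exI[of _ "S j"] conjI S allI impI)
      fix F assume F: "finite F" "S j \<subseteq> F"
      show "l2_norm D (\<lambda>x. f x - (\<Sum>n\<in>F. c n * v n x)) < \<epsilon>"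
        by (rule le_less_trans[OF est[OF F] small])
    qed
  qed
  show ?thesis by (rule that) (rule close)
qed

lemma cmod_sum_mult_le:
  fixes c z :: "'i \<Rightarrow> complex"
  shows "cmod (\<Sum>n\<in>F. c n * z n) \<le> sqrt (\<Sum>n\<in>F. (cmod (c n))\<^sup>2) * sqrt (\<Sum>n\<in>F. (cmod (z n))\<^sup>2)"
proof -
  have "cmod (\<Sum>n\<in>F. c n * z n) \<le> (\<Sum>n\<in>F. cmod (c n) * cmod (z n))"
    using norm_sum[of "\<lambda>n. c n * z n" F] by (simp add: norm_mult)
  also have "\<dots> \<le> sqrt ((\<Sum>n\<in>F. (cmod (c n))\<^sup>2) * (\<Sum>n\<in>F. (cmod (z n))\<^sup>2))"
    by (intro real_le_rsqrt Cauchy_Schwarz_ineq_sum)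
  finally show ?thesis by (simp add: real_sqrt_mult)
qed

text \<open>
  With \<open>z\<close> the coefficients of \<open>w\<close> on \<open>F\<close> and \<open>S = \<Sum>|z|\<^sup>2\<close>, one has
  \<open>S = \<langle>w, \<Sum> z v\<rangle> \<le> \<parallel>w\<parallel> \<surd>(B S)\<close>.
\<close>

lemma riesz_sequence_Bessel:
  assumes R: "riesz_sequence D v A B" and w: "w \<in> l2_space D" and F: "finite F"
  shows "(\<Sum>n\<in>F. (cmod (l2_inner D w (v n)))\<^sup>2) \<le> B * (l2_norm D w)\<^sup>2"
proof -
  define z where "z n = l2_inner D w (v n)" for n
  define S where "S = (\<Sum>n\<in>F. (cmod (z n))\<^sup>2)"
  note B = riesz_sequenceD(2)[OF R] and v = riesz_sequenceD(3)[OF R]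
  have S0: "0 \<le> S" unfolding S_def by (intro sum_nonneg) auto
  have "l2_inner D w (\<lambda>x. \<Sum>n\<in>F. z n * v n x) = of_real S"
    unfolding l2_inner_lincomb_right[OF v w] S_def
    by (simp add: z_def[symmetric] complex_norm_square[symmetric] mult.commute[of "cnj _"] del: of_real_power)
  then have "S \<le> l2_norm D w * l2_norm D (\<lambda>x. \<Sum>n\<in>F. z n * v n x)"
    using l2_Cauchy_Schwarz[OF w l2_lincomb[of v D z F, OF v]] S0 by simp
  then have "S\<^sup>2 \<le> (l2_norm D w * l2_norm D (\<lambda>x. \<Sum>n\<in>F. z n * v n x))\<^sup>2" using S0 by (intro power_mono)
  also have "\<dots> \<le> (l2_norm D w)\<^sup>2 * (B * S)"
    unfolding power_mult_distrib S_def by (intro mult_left_mono riesz_sequenceD(5)[OF R F]) auto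
  finally have "S * S \<le> (B * (l2_norm D w)\<^sup>2) * S" by (simp add: power2_eq_square mult_ac)
  then have "S \<le> B * (l2_norm D w)\<^sup>2" using S0 B by (cases "S = 0") auto
  then show ?thesis by (simp add: S_def z_def)
qed

lemma riesz_sequence_summable:
  assumes "riesz_sequence D v A B" and "w \<in> l2_space D"
  shows "(\<lambda>n. (cmod (l2_inner D w (v n)))\<^sup>2) summable_on UNIV"
    and "(\<Sum>\<^sub>\<infinity>n. (cmod (l2_inner D w (v n)))\<^sup>2) \<le> B * (l2_norm D w)\<^sup>2"
proof -
  show s: "(\<lambda>n. (cmod (l2_inner D w (v n)))\<^sup>2) summable_on UNIV"
    using riesz_sequence_Bessel[OF assms] by (intro nonneg_bdd_above_summable_on bdd_aboveI) auto
  show "(\<Sum>\<^sub>\<infinity>n. (cmod (l2_inner D w (v n)))\<^sup>2) \<le> B * (l2_norm D w)\<^sup>2"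
    using riesz_sequence_Bessel[OF assms] s by (intro infsum_le_finite_sums) auto
qed

lemma le_if_le_add_epsilon_mult:
  fixes x y K :: real
  assumes "K \<ge> 0" "\<And>\<epsilon>. \<epsilon> > 0 \<Longrightarrow> x \<le> y + \<epsilon> * K"
  shows "x \<le> y"
proof (rule field_le_epsilon)
  fix e :: real assume e: "e > 0"
  have "x \<le> y + e / (K + 1) * K" using e assms by (intro assms(2)) (auto simp: add_nonneg_pos)
  also have "e / (K + 1) * K \<le> e" using e assms(1) by (simp add: divide_le_eq)
  finally show "x \<le> y + e" by simp
qed

text \<open>
  If \<open>w = \<Sum> c v\<close>, then \<open>\<parallel>w\<parallel>\<^sup>2 = \<langle>w, \<Sum> c v\<rangle>\<close> is at most the product of the \<open>\<ell>\<^sup>2\<close> norms of \<open>c\<close> and of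
  the coefficients \<open>\<langle>w, v\<rangle>\<close>, and the former is at most \<open>\<parallel>w\<parallel> / \<surd>A\<close>. The proof does this with a
  finite partial sum and an error \<open>\<epsilon>\<close>.
\<close>

lemma riesz_basis_frame_lower:
  assumes R: "riesz_basis D v A B" and w: "w \<in> l2_space D"
  shows "A * (l2_norm D w)\<^sup>2 \<le> (\<Sum>\<^sub>\<infinity>n. (cmod (l2_inner D w (v n)))\<^sup>2)"
proof -
  have rs: "riesz_sequence D v A B" using R by (simp add: riesz_basis_def)
  note A = riesz_sequenceD(1)[OF rs] and v = riesz_sequenceD(3)[OF rs]
  define z where "z n = l2_inner D w (v n)" for n
  define S where "S = (\<Sum>\<^sub>\<infinity>n. (cmod (z n))\<^sup>2)"
  define W where "W = l2_norm D w"
  define K where "K = sqrt (S / A)"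
  have S: "0 \<le> S" unfolding S_def by (intro infsum_nonneg) auto
  then have K: "0 \<le> K" using A by (simp add: K_def)
  have W: "0 \<le> W" by (simp add: W_def)
  obtain c where c: "\<And>\<epsilon>. \<epsilon> > 0 \<Longrightarrow> \<exists>F0. finite F0 \<and>
      (\<forall>F. finite F \<longrightarrow> F0 \<subseteq> F \<longrightarrow> l2_norm D (\<lambda>x. w x - (\<Sum>n\<in>F. c n * v n x)) < \<epsilon>)"
    using riesz_expansion[OF R w] by blast
  have approx: "W\<^sup>2 \<le> W * K + \<epsilon> * (W + K)" if e: "\<epsilon> > 0" for \<epsilon>
  proof -
    obtain F where F: "finite F" and near: "l2_norm D (\<lambda>x. w x - (\<Sum>n\<in>F. c n * v n x)) < \<epsilon>"
      using c[OF e] by blast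
    define s where "s = (\<lambda>x. \<Sum>n\<in>F. c n * v n x)"
    have s: "s \<in> l2_space D" unfolding s_def by (intro l2_lincomb v)
    have near: "l2_norm D (\<lambda>x. w x - s x) < \<epsilon>" using near by (simp add: s_def)
    have "A * (\<Sum>n\<in>F. (cmod (c n))\<^sup>2) \<le> (l2_norm D s)\<^sup>2"
      unfolding s_def by (rule riesz_sequenceD(4)[OF rs F])
    then have "(\<Sum>n\<in>F. (cmod (c n))\<^sup>2) \<le> (l2_norm D s)\<^sup>2 / A" using A by (simp add: field_simps)
    from real_sqrt_le_mono[OF this] have c1: "sqrt (\<Sum>n\<in>F. (cmod (c n))\<^sup>2) \<le> l2_norm D s / sqrt A"
      by (simp add: real_sqrt_divide)
    have s1: "l2_norm D s \<le> W + \<epsilon>"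
      using l2_norm_triangle_diff[OF w l2_diff[OF w s]] near unfolding W_def by simp
    have z1: "sqrt (\<Sum>n\<in>F. (cmod (z n))\<^sup>2) \<le> sqrt S"
      unfolding S_def z_def using F
      by (intro real_sqrt_le_mono finite_sum_le_infsum riesz_sequence_summable(1)[OF rs w]) auto
    have "cmod (l2_inner D w s) \<le> sqrt (\<Sum>n\<in>F. (cmod (c n))\<^sup>2) * sqrt (\<Sum>n\<in>F. (cmod (z n))\<^sup>2)"
      unfolding s_def l2_inner_lincomb_right[OF v w] z_def[symmetric]
      using cmod_sum_mult_le[of "\<lambda>n. cnj (c n)" z F] by simp
    also have "\<dots> \<le> (l2_norm D s / sqrt A) * sqrt S"
      using c1 z1 A by (intro mult_mono) (auto intro: sum_nonneg)
    also have "\<dots> = l2_norm D s * K" by (simp add: K_def real_sqrt_divide)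
    also have "\<dots> \<le> (W + \<epsilon>) * K" by (intro mult_right_mono s1 K)
    finally have ws: "cmod (l2_inner D w s) \<le> (W + \<epsilon>) * K" .
    have "W\<^sup>2 = cmod (l2_inner D w w)" by (simp add: l2_inner_self W_def norm_power)
    also have "l2_inner D w w = l2_inner D w (\<lambda>x. w x - s x) + l2_inner D w s"
      by (simp add: l2_inner_diff_right w s)
    also have "cmod \<dots> \<le> W * l2_norm D (\<lambda>x. w x - s x) + (W + \<epsilon>) * K"
      using l2_Cauchy_Schwarz[OF w l2_diff[OF w s]] ws unfolding W_def
      by (intro order_trans[OF norm_triangle_ineq] add_mono) auto
    also have "\<dots> \<le> W * \<epsilon> + (W + \<epsilon>) * K"
      using near W e K by (intro add_mono mult_left_mono) auto
    finally show ?thesis by (simp add: algebra_simps)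
  qed
  have "W\<^sup>2 \<le> W * K"
    by (rule le_if_le_add_epsilon_mult[of "W + K", OF _ approx]) (simp_all add: W K)
  then have "W \<le> K" using W K by (cases "W = 0") (simp_all add: power2_eq_square)
  then have "W\<^sup>2 \<le> S / A" using W A S power_mono[of W K 2] by (simp add: K_def)
  then show ?thesis using A by (simp add: S_def z_def W_def field_simps)
qed

lemma riesz_basis_frame_constants:
  assumes R: "riesz_basis D v A B"
  shows "frame_constants D v A B"
proof -
  have rs: "riesz_sequence D v A B" using R by (simp add: riesz_basis_def)
  show ?thesis
    using rs riesz_sequence_summable[OF rs] riesz_basis_frame_lower[OF R]
    unfolding frame_constants_def riesz_sequence_def by blast
qed

lemma riesz_basis_Parseval:
  assumes "riesz_basis D v 1 1" and "w \<in> l2_space D"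
  shows "((\<lambda>n. (cmod (l2_inner D w (v n)))\<^sup>2) has_sum (l2_norm D w)\<^sup>2) UNIV"
proof -
  have rs: "riesz_sequence D v 1 1" using assms(1) by (simp add: riesz_basis_def)
  show ?thesis
    using riesz_sequence_summable[OF rs assms(2)] riesz_basis_frame_lower[OF assms]
    by (simp add: has_sum_iff)
qed

text \<open>
  Initial segments of an enumeration eventually contain any given finite set of indices, so
  \<open>riesz_expansion\<close> gives convergence; the lower Riesz bound, applied to the difference of two
  expansions, gives uniqueness.
\<close>

lemma riesz_basis_unconditional:
  assumes R: "riesz_basis D v A B"
  shows "unconditional_schauder_basis D v"
  unfolding unconditional_schauder_basis_def schauder_basis_def
proof (intro allI impI conjI ballI)
  fix e :: "nat \<Rightarrow> int ^ 'a" and k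
  show "v (e k) \<in> l2_space D" using R by (simp add: riesz_basis_def riesz_sequence_def)
next
  fix e :: "nat \<Rightarrow> int ^ 'a" and f :: "real ^ 'a \<Rightarrow> complex"
  assume e: "bij e" and f: "f \<in> l2_space D"
  have rs: "riesz_sequence D v A B" using R by (simp add: riesz_basis_def)
  note A = riesz_sequenceD(1)[OF rs] and v = riesz_sequenceD(3)[OF rs]
  have e_inv: "inv e (e k) = k" for k using e by (simp add: bij_is_inj)
  have reidx: "(\<Sum>n\<in>e ` {..<N}. h n) = (\<Sum>k<N. h (e k))" for N and h :: "int ^ 'a \<Rightarrow> 'z::comm_monoid_add"
    using e by (subst sum.reindex) (auto simp: bij_def inj_on_def)
  have reidx': "(\<Sum>n\<in>e ` {..<N}. h n) = (\<Sum>k<N. h (e k))" for N and h :: "int ^ 'a \<Rightarrow> real"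
    using e by (subst sum.reindex) (auto simp: bij_def inj_on_def)
  obtain c where c: "\<And>\<epsilon>. \<epsilon> > 0 \<Longrightarrow> \<exists>F0. finite F0 \<and>
      (\<forall>F. finite F \<longrightarrow> F0 \<subseteq> F \<longrightarrow> l2_norm D (\<lambda>x. f x - (\<Sum>n\<in>F. c n * v n x)) < \<epsilon>)"
    using riesz_expansion[OF R f] by blast
  have ex: "(\<lambda>N. l2_norm D (\<lambda>x. f x - (\<Sum>k<N. c (e k) * v (e k) x))) \<longlonglongrightarrow> 0"
  proof (rule LIMSEQ_I)
    fix \<epsilon> :: real assume "\<epsilon> > 0"
    then obtain F0 where F0: "finite F0"
        "\<And>F. finite F \<Longrightarrow> F0 \<subseteq> F \<Longrightarrow> l2_norm D (\<lambda>x. f x - (\<Sum>n\<in>F. c n * v n x)) < \<epsilon>"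
      using c by blast
    obtain M where M: "\<And>n. n \<in> F0 \<Longrightarrow> inv e n < M"
      using finite_nat_set_iff_bounded[of "inv e ` F0"] F0(1) by auto
    show "\<exists>no. \<forall>N\<ge>no. norm (l2_norm D (\<lambda>x. f x - (\<Sum>k<N. c (e k) * v (e k) x)) - 0) < \<epsilon>"
    proof (intro exI[of _ M] allI impI)
      fix N assume N: "M \<le> N"
      have "F0 \<subseteq> e ` {..<N}"
      proof
        fix n assume "n \<in> F0"
        then have "inv e n < N" using M N by fastforce
        moreover have "n = e (inv e n)" using e by (simp add: bij_is_surj surj_f_inv_f)
        ultimately show "n \<in> e ` {..<N}" by blast
      qed
      then show "norm (l2_norm D (\<lambda>x. f x - (\<Sum>k<N. c (e k) * v (e k) x)) - 0) < \<epsilon>"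
        using F0(2)[of "e ` {..<N}"] by (simp add: reidx)
    qed
  qed
  show "\<exists>!c. (\<lambda>N. l2_norm D (\<lambda>x. f x - (\<Sum>k<N. c k * v (e k) x))) \<longlonglongrightarrow> 0"
  proof (rule ex1I[of _ "\<lambda>k. c (e k)"])
    show "(\<lambda>N. l2_norm D (\<lambda>x. f x - (\<Sum>k<N. c (e k) * v (e k) x))) \<longlonglongrightarrow> 0" by (rule ex)
    fix b assume b: "(\<lambda>N. l2_norm D (\<lambda>x. f x - (\<Sum>k<N. b k * v (e k) x))) \<longlonglongrightarrow> 0"
    define h where "h k = b k - c (e k)" for k
    define eta where "eta N = l2_norm D (\<lambda>x. f x - (\<Sum>k<N. c (e k) * v (e k) x))
      + l2_norm D (\<lambda>x. f x - (\<Sum>k<N. b k * v (e k) x))" for N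
    have eta: "(\<lambda>N. (eta N)\<^sup>2) \<longlonglongrightarrow> 0"
      using tendsto_power[OF tendsto_add[OF ex b], of 2] by (simp add: eta_def)
    have bound: "A * (cmod (h j))\<^sup>2 \<le> (eta N)\<^sup>2" if "j < N" for j N
    proof -
      have "A * (cmod (h j))\<^sup>2 \<le> A * (\<Sum>k<N. (cmod (h k))\<^sup>2)"
        using A that member_le_sum[of j "{..<N}" "\<lambda>k. (cmod (h k))\<^sup>2"] by (intro mult_left_mono) auto
      also have "\<dots> \<le> (l2_norm D (\<lambda>x. \<Sum>k<N. h k * v (e k) x))\<^sup>2"
        using riesz_sequenceD(4)[OF rs, of "e ` {..<N}" "\<lambda>n. h (inv e n)"]
        by (simp add: reidx reidx' e_inv)
      also have "(\<lambda>x. \<Sum>k<N. h k * v (e k) x) = (\<lambda>x. (f x - (\<Sum>k<N. c (e k) * v (e k) x)) -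
          (f x - (\<Sum>k<N. b k * v (e k) x)))"
        by (simp add: h_def left_diff_distrib sum_subtractf)
      also have "(l2_norm D \<dots>)\<^sup>2 \<le> (eta N)\<^sup>2"
        unfolding eta_def
        by (intro power_mono l2_norm_triangle_diff l2_diff f l2_norm_nonneg l2_lincomb v)
      finally show ?thesis .
    qed
    have "h j = 0" for j
    proof -
      have "A * (cmod (h j))\<^sup>2 \<le> 0"
        using eta by (rule LIMSEQ_le_const) (use bound[of j] in \<open>auto intro!: exI[of _ "Suc j"]\<close>)
      then show ?thesis using A by (simp add: mult_le_0_iff)
    qed
    then show "b = (\<lambda>k. c (e k))" by (simp add: h_def fun_eq_iff)
  qed
qed

section \<open>Density of box indicators\<close>

lemma l2_norm_AE_eq_0:
  assumes "AE x in lebesgue_on D. f x = g x"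
  shows "l2_norm D (\<lambda>x. f x - g x) = 0"
proof -
  have "AE x in lebesgue_on D. (cmod (f x - g x))\<^sup>2 = 0" using assms by eventually_elim simp
  then show ?thesis by (simp add: l2_norm_def integral_eq_zero_AE)
qed

lemma l2_closure_AE_cong:
  assumes V: "V \<subseteq> l2_space D" and g: "g \<in> l2_closure D V" and f: "f \<in> l2_space D"
    and "AE x in lebesgue_on D. f x = g x"
  shows "f \<in> l2_closure D V"
  using l2_norm_AE_eq_0[OF assms(4)] g by (intro l2_closure_closed[OF V f] bexI[of _ g]) auto

lemma l2_space_bounded:
  assumes D: "D \<in> lmeasurable" and f: "f \<in> borel_measurable (lebesgue_on D)"
    and bd: "\<And>x. x \<in> D \<Longrightarrow> cmod (f x) \<le> B"
  shows "f \<in> l2_space D"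
  unfolding l2_space_def mem_Collect_eq
proof (intro conjI f)
  interpret finite_measure "lebesgue_on D" by (rule finite_measure_lebesgue_on[OF D])
  have "AE x in lebesgue_on D. norm ((cmod (f x))\<^sup>2) \<le> B\<^sup>2"
    by (intro AE_I2) (auto simp: space_restrict_space intro!: power_mono bd)
  then show "integrable (lebesgue_on D) (\<lambda>x. (cmod (f x))\<^sup>2)"
    using f by (intro integrable_const_bound[where B="B\<^sup>2"]) auto
qed

lemma l2_norm_bounded:
  assumes D: "D \<in> lmeasurable" and f: "f \<in> borel_measurable (lebesgue_on D)"
    and bd: "\<And>x. x \<in> D \<Longrightarrow> cmod (f x) \<le> B" and B: "0 \<le> B"
  shows "l2_norm D f \<le> B * sqrt (measure lebesgue D)"
proof -
  interpret finite_measure "lebesgue_on D" by (rule finite_measure_lebesgue_on[OF D])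
  have D': "D \<in> sets lebesgue" using D by (simp add: fmeasurable_def)
  have "(LINT x|lebesgue_on D. (cmod (f x))\<^sup>2) \<le> (LINT x|lebesgue_on D. B\<^sup>2)"
    by (intro integral_mono l2_spaceD(2)[OF l2_space_bounded[OF D f bd]])
      (auto simp: space_restrict_space intro!: power_mono bd)
  also have "\<dots> = B\<^sup>2 * measure lebesgue D"
    using D' by (simp add: measure_restrict_space space_restrict_space)
  finally show ?thesis unfolding l2_norm_def
    using real_sqrt_le_mono B by (fastforce simp: real_sqrt_mult)
qed

lemma l2_closure_dominated:
  assumes V: "V \<subseteq> l2_space D" and h: "h \<in> l2_space D" and f: "f \<in> l2_space D"
    and g: "\<And>i. g i \<in> l2_closure D V"
    and lim: "\<And>x. x \<in> D \<Longrightarrow> (\<lambda>i. g i x) \<longlonglongrightarrow> f x"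
    and dom: "\<And>i x. x \<in> D \<Longrightarrow> cmod (g i x) \<le> cmod (h x)"
  shows "f \<in> l2_closure D V"
proof (rule l2_closure_closed[OF V f])
  have gl2: "g i \<in> l2_space D" for i using g by (rule l2_closure_l2)
  have fm: "f \<in> borel_measurable (lebesgue_on D)" and gm: "g i \<in> borel_measurable (lebesgue_on D)" for i
    using f gl2 by (auto dest: l2_spaceD)
  have fdom: "cmod (f x) \<le> cmod (h x)" if "x \<in> D" for x
    using tendsto_norm[OF lim[OF that]] by (rule LIMSEQ_le_const2) (use dom[OF that] in auto)
  have sp: "x \<in> D" if "x \<in> space (lebesgue_on D)" for x using that by (simp add: space_restrict_space)
  have "(\<lambda>i. LINT x|lebesgue_on D. (cmod (f x - g i x))\<^sup>2) \<longlonglongrightarrow> (LINT x|lebesgue_on D. 0)"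
  proof (rule integral_dominated_convergence)
    show "integrable (lebesgue_on D) (\<lambda>x. 4 * (cmod (h x))\<^sup>2)"
      by (intro integrable_mult_right l2_spaceD(2)[OF h])
    show "AE x in lebesgue_on D. (\<lambda>i. (cmod (f x - g i x))\<^sup>2) \<longlonglongrightarrow> 0"
    proof (rule AE_I2)
      fix x assume "x \<in> space (lebesgue_on D)"
      then show "(\<lambda>i. (cmod (f x - g i x))\<^sup>2) \<longlonglongrightarrow> 0"
        using tendsto_power[OF tendsto_norm[OF tendsto_diff[OF tendsto_const lim[OF sp]]], of x "f x" 2] by simp
    qed
    show "AE x in lebesgue_on D. norm ((cmod (f x - g i x))\<^sup>2) \<le> 4 * (cmod (h x))\<^sup>2" for i
    proof (rule AE_I2)
      fix x assume x: "x \<in> space (lebesgue_on D)"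
      have "cmod (f x - g i x) \<le> 2 * cmod (h x)"
        using norm_triangle_ineq4[of "f x" "g i x"] fdom[OF sp[OF x]] dom[OF sp[OF x], of i] by linarith
      then have "(cmod (f x - g i x))\<^sup>2 \<le> (2 * cmod (h x))\<^sup>2" by (intro power_mono) auto
      then show "norm ((cmod (f x - g i x))\<^sup>2) \<le> 4 * (cmod (h x))\<^sup>2" by (simp add: power_mult_distrib)
    qed
  qed (use fm gm in measurable)
  then have lim0: "(\<lambda>i. l2_norm D (\<lambda>x. f x - g i x)) \<longlonglongrightarrow> 0"
    unfolding l2_norm_def using tendsto_real_sqrt by fastforce
  fix \<epsilon> :: real assume "\<epsilon> > 0"
  from order_tendstoD(2)[OF lim0 this] obtain i where "l2_norm D (\<lambda>x. f x - g i x) < \<epsilon>"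
    by (auto simp: eventually_sequentially)
  with g[of i] show "\<exists>g\<in>l2_closure D V. l2_norm D (\<lambda>x. f x - g x) < \<epsilon>" by blast
qed

lemma indicator_l2:
  assumes D: "D \<in> lmeasurable" and E: "E \<in> sets lebesgue"
  shows "(\<lambda>x. indicator E x) \<in> l2_space D"
proof (rule l2_space_bounded[OF D, where B = 1])
  have "(\<lambda>x. indicator E x :: complex) \<in> borel_measurable lebesgue"
    using E by (intro borel_measurable_indicator)
  then show "(\<lambda>x. indicator E x :: complex) \<in> borel_measurable (lebesgue_on D)"
    by (rule measurable_restrict_space1)
qed (simp split: split_indicator)

lemma one_l2:
  assumes D: "D \<in> lmeasurable"
  shows "(\<lambda>x. 1) \<in> l2_space D"
  by (rule l2_space_bounded[OF D, where B = 1]) auto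

text \<open>
  The sets whose indicators lie in the closed span form a Dynkin system containing the boxes, and
  boxes are an intersection-stable generator of the Borel sets. Lebesgue sets differ from Borel sets
  by null sets, and every \<open>f\<close> is a limit of simple functions dominated by \<open>2 |f|\<close>.
\<close>

lemma dense_if_boxes:
  fixes D :: "'a::euclidean_space set"
  assumes D: "D \<in> lmeasurable" and v: "\<And>n. v n \<in> l2_space D"
    and box: "\<And>a b. (\<lambda>x. indicator (box a b) x) \<in> l2_closure D (lin_span v)"
  shows "l2_space D \<subseteq> l2_closure D (lin_span v)"
proof -
  let ?V = "l2_closure D (lin_span v)"
  have V: "lin_span v \<subseteq> l2_space D" by (auto intro: lin_span_subset_l2 v)
  note closed = l2_closure_dominated[OF V]
  have one: "(\<lambda>x. 1) \<in> ?V"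
  proof (rule closed[OF one_l2[OF D] one_l2[OF D]])
    let ?b = "\<lambda>i. box (- (real i *\<^sub>R One)) (real i *\<^sub>R One) :: 'a set"
    show "(\<lambda>x. indicator (?b i) x) \<in> ?V" for i by (rule box)
    show "(\<lambda>i. indicator (?b i) x :: complex) \<longlonglongrightarrow> 1" for x
    proof (rule tendsto_eventually)
      obtain N :: nat where N: "norm x < real N" using reals_Archimedean2 by blast
      have "x \<in> ?b i" if "N \<le> i" for i
      proof -
        have "\<bar>x \<bullet> b\<bar> < real i" if "b \<in> Basis" for b
          using Basis_le_norm[OF that, of x] N \<open>N \<le> i\<close> by simp
        then show ?thesis by (simp add: mem_box abs_less_iff minus_less_iff)
      qed
      then show "\<forall>\<^sub>F i in sequentially. indicator (?b i) x = (1::complex)"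
        by (auto simp: eventually_sequentially intro!: exI[of _ N])
    qed
  qed (simp split: split_indicator)
  have borel: "(\<lambda>x. indicator E x) \<in> ?V" if "E \<in> sets borel" for E :: "'a set"
  proof -
    let ?G = "range (\<lambda>(a, b). box a b :: 'a set)"
    have "Int_stable ?G"
      by (auto simp: Int_stable_def box_Int_box image_iff)
    moreover have "?G \<subseteq> Pow UNIV" by auto
    moreover have "E \<in> sigma_sets UNIV ?G" using that unfolding borel_eq_box by simp
    ultimately show ?thesis
    proof (induction rule: sigma_sets_induct_disjoint)
      case (basic A)
      then show ?case using box by auto
    next
      case empty
      then show ?case using box[of 0 0] by simp
    next
      case (compl A)
      have "(\<lambda>x. 1 + (- 1) * indicator A x) \<in> ?V"
        by (intro l2_closure_span_add[OF v] l2_closure_span_scale[OF v] one compl)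
      also have "(\<lambda>x. 1 + (- 1) * indicator A x :: complex) = (\<lambda>x. indicator (UNIV - A) x)"
        by (auto split: split_indicator)
      finally show ?case .
    next
      case (union A)
      have A: "A i \<in> sets lebesgue" for i
      proof -
        have "A i \<in> sets (borel :: 'a measure)" using union(2) unfolding borel_eq_box by auto
        then show ?thesis by simp
      qed
      have sum_eq: "(\<Sum>i<n. indicator (A i) x) = (indicator (\<Union>i<n. A i) x :: complex)" for n x
        using union(1) by (subst indicator_UN_disjoint) (auto simp: disjoint_family_on_def)
      show ?case
      proof (rule closed[OF one_l2[OF D] indicator_l2[OF D]])
        show "(\<Union>i. A i) \<in> sets lebesgue" using A by blast
        show "(\<lambda>x. \<Sum>i<n. 1 * indicator (A i) x) \<in> ?V" for n
          by (intro l2_closure_span_lincomb[OF v]) (use union in auto)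
        show "(\<lambda>n. \<Sum>i<n. 1 * indicator (A i) x :: complex) \<longlonglongrightarrow> indicator (\<Union>i. A i) x" for x
          using LIMSEQ_indicator_UN[of A x] by (simp add: sum_eq)
        show "cmod (\<Sum>i<n. 1 * indicator (A i) x) \<le> cmod 1" for n x
          by (simp add: sum_eq split: split_indicator)
      qed
    qed
  qed
  have leb: "(\<lambda>x. indicator E x) \<in> ?V" if E: "E \<in> sets lebesgue" for E :: "'a set"
  proof -
    obtain S N N' where SN: "E = S \<union> N" "N \<subseteq> N'" "N' \<in> null_sets lborel" "S \<in> sets lborel"
      using sets_completionE[OF E] .
    have "AE x in lebesgue. x \<notin> N'" using SN(3) by (intro AE_completion AE_not_in)
    then have "AE x in lebesgue_on D. x \<notin> N'"
      using D by (subst AE_restrict_space_iff) (auto simp: fmeasurable_def)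
    then have "AE x in lebesgue_on D. indicator E x = (indicator S x :: complex)"
      by eventually_elim (use SN(1,2) in \<open>auto split: split_indicator\<close>)
    then show ?thesis
      using SN(4) by (intro l2_closure_AE_cong[OF V borel indicator_l2[OF D E]]) auto
  qed
  show ?thesis
  proof
    fix f :: "'a \<Rightarrow> complex" assume f: "f \<in> l2_space D"
    obtain F where F: "\<And>i. simple_function (lebesgue_on D) (F i)"
        and lim: "\<And>x. x \<in> space (lebesgue_on D) \<Longrightarrow> (\<lambda>i. F i x) \<longlonglongrightarrow> f x"
        and dom: "\<And>i x. x \<in> space (lebesgue_on D) \<Longrightarrow> dist (F i x) 0 \<le> 2 * dist (f x) 0"
      using borel_measurable_implies_sequence_metric[OF l2_spaceD(1)[OF f], of 0] by blast
    have sp: "space (lebesgue_on D) = D" by (simp add: space_restrict_space)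
    show "f \<in> ?V"
    proof (rule closed[OF l2_scale[OF f, of 2] f])
      let ?G = "\<lambda>i x. \<Sum>y\<in>F i ` D. y * indicator (F i -` {y} \<inter> D) x"
      show "?G i \<in> ?V" for i
      proof (rule l2_closure_span_lincomb[OF v])
        fix y assume "y \<in> F i ` D"
        have "F i -` {y} \<inter> D \<in> sets (lebesgue_on D)" using simple_functionD(2)[OF F[of i], of "{y}"] sp by simp
        then have "F i -` {y} \<inter> D \<in> sets lebesgue"
          using D by (subst (asm) sets_restrict_space_iff) (auto simp: fmeasurable_def)
        then show "(\<lambda>x. indicator (F i -` {y} \<inter> D) x) \<in> ?V" by (rule leb)
      qed
      have eq: "?G i x = F i x" if "x \<in> D" for i x
      proof -
        have "?G i x = (\<Sum>y\<in>F i ` D. indicator (F i -` {y} \<inter> D) x *\<^sub>R y)"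
          by (intro sum.cong refl) (simp split: split_indicator)
        also have "\<dots> = F i x"
          by (rule simple_function_indicator_representation_banach[OF F[of i], of x, unfolded sp, OF that, symmetric])
        finally show ?thesis .
      qed
      show "(\<lambda>i. ?G i x) \<longlonglongrightarrow> f x" if "x \<in> D" for x
        using lim[of x] that by (simp add: eq sp)
      show "cmod (?G i x) \<le> cmod (2 * f x)" if "x \<in> D" for i x
        using dom[of x i] that by (simp add: eq sp norm_mult)
    qed
  qed
qed

section \<open>The trigonometric system on an interval of length one\<close>

definition osc :: "real \<Rightarrow> real \<Rightarrow> complex" where
  "osc l t = cis (2 * pi * l * t)"

definition sinc :: "real \<Rightarrow> real" where
  "sinc x = (if x = 0 then 1 else sin (pi * x) / (pi * x))"

abbreviation unit_window :: "real set" where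
  "unit_window \<equiv> {- (1 / 2)..<1 / 2}"

lemma norm_osc [simp]: "cmod (osc l t) = 1"
  by (simp add: osc_def)

lemma osc_mult: "osc l t * osc l' t = osc (l + l') t"
  by (simp add: osc_def cis_mult algebra_simps)

lemma osc_add_right: "osc l (t + u) = osc l t * osc l u"
  by (simp add: osc_def cis_mult algebra_simps)

lemma cnj_osc: "cnj (osc l t) = osc (- l) t"
  by (simp add: osc_def cis_cnj)

lemma osc_0 [simp]: "osc 0 t = 1"
  by (simp add: osc_def)

lemma continuous_osc: "continuous_on S (osc l)"
  unfolding osc_def by (intro continuous_intros)

lemma osc_measurable [measurable]: "osc l \<in> borel_measurable borel"
  by (intro borel_measurable_continuous_onI continuous_osc)

lemma osc_measurable_lebesgue_on: "osc l \<in> borel_measurable (lebesgue_on D)"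
  by (intro measurable_restrict_space1 measurable_completion) simp

lemma unit_window_lmeasurable: "unit_window \<in> lmeasurable" "measure lebesgue unit_window = 1"
  by (auto simp: fmeasurable_def)

lemma osc_l2: "D \<in> lmeasurable \<Longrightarrow> osc l \<in> l2_space D"
  by (rule l2_space_bounded[where B = 1]) (auto simp: osc_measurable_lebesgue_on)

lemma osc_integral_interval:
  assumes "a \<le> b"
  shows "(LINT t|lebesgue_on {a..<b}. osc l t)
       = (if l = 0 then of_real (b - a) else (osc l b - osc l a) / (2 * of_real pi * \<i> * of_real l))"
proof -
  define F where "F t = (if l = 0 then of_real t else osc l t / (2 * of_real pi * \<i> * of_real l))" for t
  have F: "(F has_vector_derivative osc l t) (at t within {a..b})" for t
  proof (cases "l = 0")
    case True
    have "(of_real has_vector_derivative 1) (at t within {a..b})"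
      by (auto intro!: derivative_eq_intros simp: has_vector_derivative_def scaleR_conv_of_real)
    then show ?thesis using True by (simp add: F_def[abs_def])
  next
    case False
    have "((\<lambda>t. exp (2 * of_real pi * \<i> * of_real l * complex_of_real t) / (2 * of_real pi * \<i> * of_real l))
      has_vector_derivative exp (2 * of_real pi * \<i> * of_real l * complex_of_real t)) (at t within {a..b})"
      by (rule has_vector_derivative_real_field) (use False in \<open>auto intro!: derivative_eq_intros\<close>)
    moreover have "osc l t = exp (2 * of_real pi * \<i> * of_real l * complex_of_real t)" for t
      by (simp add: osc_def cis_conv_exp mult_ac)
    ultimately show ?thesis using False by (simp add: F_def[abs_def])
  qed
  have "(LINT t|lebesgue_on {a..<b}. osc l t) = (LINT t|lebesgue. indicator {a..<b} t *\<^sub>R osc l t)"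
    by (subst integral_restrict_space) auto
  also have "\<dots> = (LINT t|lebesgue. indicator {a..b} t *\<^sub>R osc l t)"
  proof (rule integral_cong_AE)
    have "AE t in lebesgue. t \<noteq> b" by (intro AE_completion AE_lborel_singleton)
    then show "AE t in lebesgue. indicator {a..<b} t *\<^sub>R osc l t = indicator {a..b} t *\<^sub>R osc l t"
      by eventually_elim (auto split: split_indicator)
  qed (auto intro!: borel_measurable_scaleR borel_measurable_indicator measurable_completion)
  also have "\<dots> = (LINT t|lborel. indicator {a..b} t *\<^sub>R osc l t)"
    by (intro integral_completion borel_measurable_scaleR borel_measurable_indicator) auto
  also have "\<dots> = F b - F a"
    by (intro integral_FTC_Icc assms F continuous_osc)
  also have "\<dots> = (if l = 0 then of_real (b - a) else (osc l b - osc l a) / (2 * of_real pi * \<i> * of_real l))"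
    by (simp add: F_def diff_divide_distrib)
  finally show ?thesis .
qed

lemma osc_integral: "(LINT t|lebesgue_on unit_window. osc l t) = of_real (sinc l)"
proof (cases "l = 0")
  case False
  have "osc l (1 / 2) - osc l (- (1 / 2)) = 2 * \<i> * of_real (sin (pi * l))"
    by (simp add: osc_def complex_eq_iff mult_ac)
  then have "(LINT t|lebesgue_on unit_window. osc l t)
      = (2 * \<i> * of_real (sin (pi * l))) / (2 * of_real pi * \<i> * of_real l)"
    using False by (simp add: osc_integral_interval)
  then show ?thesis using False by (simp add: sinc_def)
next
  case True
  have "(LINT t|lebesgue_on unit_window. osc l t) = of_real (1 / 2 - - (1 / 2))"
    by (subst osc_integral_interval) (simp, simp add: True)
  then show ?thesis using True by (simp add: sinc_def)
qed

lemma osc_inner: "l2_inner unit_window (osc l) (osc l') = of_real (sinc (l - l'))"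
  using osc_integral[of "l - l'"] by (simp add: l2_inner_def cnj_osc osc_mult)

lemma sinc_int: "sinc (of_int k) = (if k = 0 then 1 else 0)"
  by (simp add: sinc_def mult.commute sin_int_2pin)

lemma osc_orthonormal:
  assumes F: "finite F"
  shows "(l2_norm unit_window (\<lambda>t. \<Sum>n\<in>F. c n * osc (of_int n) t))\<^sup>2 = (\<Sum>n\<in>F. (cmod (c n))\<^sup>2)"
proof -
  let ?s = "\<lambda>t. \<Sum>n\<in>F. c n * osc (of_int n) t"
  have v: "osc (of_int n) \<in> l2_space unit_window" for n :: int by (intro osc_l2 unit_window_lmeasurable)
  have "complex_of_real ((l2_norm unit_window ?s)\<^sup>2)
      = (\<Sum>n\<in>F. c n * (\<Sum>m\<in>F. cnj (c m) * of_real (sinc (of_int (n - m)))))"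
    unfolding l2_inner_self[symmetric] of_int_diff osc_inner[symmetric]
    by (subst l2_inner_lincomb_left[of "\<lambda>n. osc (of_int n)", OF v l2_lincomb[of "\<lambda>n. osc (of_int n)", OF v]])
      (simp only: l2_inner_lincomb_right[of "\<lambda>n. osc (of_int n)", OF v v])
  also have "\<dots> = (\<Sum>n\<in>F. c n * (\<Sum>m\<in>F. if m = n then cnj (c m) else 0))"
    by (intro sum.cong refl arg_cong2[of _ _ _ _ "(*)"]) (simp add: sinc_int del: of_int_diff)
  also have "\<dots> = (\<Sum>n\<in>F. c n * cnj (c n))" using F by simp
  also have "\<dots> = complex_of_real (\<Sum>n\<in>F. (cmod (c n))\<^sup>2)"
    by (simp add: complex_norm_square[symmetric] del: of_real_power)
  finally show ?thesis by (simp only: of_real_eq_iff)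
qed

lemma trig_span_mult:
  assumes "g \<in> lin_span (\<lambda>n::int. osc (of_int n))" "h \<in> lin_span (\<lambda>n::int. osc (of_int n))"
  shows "(\<lambda>t. g t * h t) \<in> lin_span (\<lambda>n::int. osc (of_int n))"
proof -
  let ?L = "lin_span (\<lambda>n::int. osc (of_int n))"
  obtain F c where F: "finite F" "g = (\<lambda>t. \<Sum>n\<in>F. c n * osc (of_int n) t)" using assms(1) by (auto simp: lin_span_def)
  obtain G d where G: "finite G" "h = (\<lambda>t. \<Sum>n\<in>G. d n * osc (of_int n) t)" using assms(2) by (auto simp: lin_span_def)
  have shift: "(\<lambda>t. osc (of_int n) t * h t) \<in> ?L" for n :: int
  proof -
    have "(\<lambda>t. osc (of_int n) t * h t) = (\<lambda>t. \<Sum>m\<in>(+) n ` G. d (m - n) * osc (of_int m) t)"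
      by (subst sum.reindex) (auto simp: G(2) sum_distrib_left osc_mult[symmetric] mult_ac)
    then show ?thesis using G(1) lin_spanI[of "(+) n ` G" "\<lambda>m. d (m - n)"] by simp
  qed
  have "(\<lambda>t. \<Sum>n\<in>S. c n * (osc (of_int n) t * h t)) \<in> ?L" if "finite S" for S
    using that
  proof induction
    case empty
    then show ?case using lin_spanI[of "{}" _ "\<lambda>n::int. osc (of_int n)"] by simp
  next
    case (insert n S)
    then show ?case using lin_span_add[OF lin_span_scale[OF shift] insert(3)] by simp
  qed
  from this[OF F(1)] show ?thesis by (simp add: F(2) sum_distrib_right mult.assoc)
qed

text \<open>
  The real and imaginary parts of \<open>osc 1\<close> are combinations of \<open>osc 1\<close> and \<open>osc (-1)\<close>, so polynomials
  in the plane restrict to trigonometric polynomials on the circle. This makes the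
  Stone-Weierstrass theorem for polynomial functions available for the trigonometric system.
\<close>

lemma trig_span_polynomial:
  assumes "real_polynomial_function p"
  shows "(\<lambda>t. of_real (p (osc 1 t))) \<in> lin_span (\<lambda>n::int. osc (of_int n))"
  using assms
proof induction
  let ?L = "lin_span (\<lambda>n::int. osc (of_int n))"
  case (linear f)
  have f: "f z = Re z * f 1 + Im z * f \<i>" for z
  proof -
    interpret bounded_linear f by fact
    have "f z = f (Re z *\<^sub>R 1 + Im z *\<^sub>R \<i>)" by (intro arg_cong[of _ _ f]) (simp add: complex_eq_iff)
    then show ?thesis by (simp add: add scale)
  qed
  have "(\<lambda>t. (of_real (f 1) / 2 + of_real (f \<i>) / (2 * \<i>)) * osc (of_int 1) t
      + (of_real (f 1) / 2 - of_real (f \<i>) / (2 * \<i>)) * osc (of_int (- 1)) t) \<in> ?L"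
    by (intro lin_span_add lin_span_scale lin_span_member[of "\<lambda>n::int. osc (of_int n)"])
  also have "(\<lambda>t. (of_real (f 1) / 2 + of_real (f \<i>) / (2 * \<i>)) * osc (of_int 1) t
      + (of_real (f 1) / 2 - of_real (f \<i>) / (2 * \<i>)) * osc (of_int (- 1)) t) = (\<lambda>t. of_real (f (osc 1 t)))"
    by (subst f[of "osc 1 _"]) (auto simp: osc_def complex_eq_iff fun_eq_iff field_simps)
  finally show ?case .
next
  case (const c)
  have "(\<lambda>t. of_real c * osc (of_int 0) t) \<in> lin_span (\<lambda>n::int. osc (of_int n))"
    by (intro lin_span_scale lin_span_member[of "\<lambda>n::int. osc (of_int n)"])
  then show ?case by simp
next
  case (add f g)
  then show ?case using lin_span_add by fastforce
next
  case (mult f g)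
  then show ?case using trig_span_mult by fastforce
qed

text \<open>
  An interval in the window is, up to a null set, the preimage under \<open>osc 1\<close> of an open sector of the
  plane. Its indicator is a pointwise limit of continuous functions with values in \<open>[0, 1]\<close>, and on the
  unit circle each of these is a uniform limit of polynomials.
\<close>

lemma trig_dense: "l2_space unit_window \<subseteq> l2_closure unit_window (lin_span (\<lambda>n::int. osc (of_int n)))"
proof (rule dense_if_boxes[OF unit_window_lmeasurable(1)])
  let ?L = "lin_span (\<lambda>n::int. osc (of_int n))"
  show v: "osc (of_int n) \<in> l2_space unit_window" for n :: int by (intro osc_l2 unit_window_lmeasurable)
  have V: "?L \<subseteq> l2_space unit_window"
    using lin_span_subset_l2[of "\<lambda>n::int. osc (of_int n)", OF v] by blast
  have cont: "(\<lambda>t. of_real (\<phi> (osc 1 t))) \<in> l2_closure unit_window ?L"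
    if \<phi>: "continuous_on UNIV \<phi>" for \<phi> :: "complex \<Rightarrow> real"
  proof (rule l2_closure_closed[OF V])
    have meas: "(\<lambda>t. complex_of_real (\<phi> (osc 1 t))) \<in> borel_measurable (lebesgue_on unit_window)"
      using measurable_compose[OF osc_measurable_lebesgue_on borel_measurable_continuous_onI[OF \<phi>]] by simp
    have "compact (\<phi> ` sphere 0 1)"
      using \<phi> by (intro compact_continuous_image) (auto intro: continuous_on_subset)
    then obtain B where B: "\<And>z. z \<in> sphere 0 1 \<Longrightarrow> \<bar>\<phi> z\<bar> \<le> B"
      using compact_imp_bounded by (fastforce simp: bounded_iff)
    show l2: "(\<lambda>t. of_real (\<phi> (osc 1 t))) \<in> l2_space unit_window"
      by (rule l2_space_bounded[OF unit_window_lmeasurable(1) meas, of B]) (use B in simp)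
    fix \<epsilon> :: real assume e: "\<epsilon> > 0"
    obtain p where p: "real_polynomial_function p" "\<And>z. z \<in> sphere 0 1 \<Longrightarrow> \<bar>\<phi> z - p z\<bar> < \<epsilon> / 2"
      using Stone_Weierstrass_real_polynomial_function[of "sphere 0 1" \<phi> "\<epsilon> / 2"] e \<phi>
      by (metis compact_sphere continuous_on_subset half_gt_zero subset_UNIV)
    let ?p = "\<lambda>t. complex_of_real (p (osc 1 t))"
    have pL: "?p \<in> ?L" by (rule trig_span_polynomial[OF p(1)])
    have "l2_norm unit_window (\<lambda>t. of_real (\<phi> (osc 1 t)) - ?p t) \<le> \<epsilon> / 2 * sqrt (measure lebesgue unit_window)"
    proof (rule l2_norm_bounded[OF unit_window_lmeasurable(1)])
      show "(\<lambda>t. of_real (\<phi> (osc 1 t)) - ?p t) \<in> borel_measurable (lebesgue_on unit_window)"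
        by (intro l2_spaceD(1) l2_diff l2 subsetD[OF V pL])
      show "cmod (of_real (\<phi> (osc 1 t)) - ?p t) \<le> \<epsilon> / 2" for t
        using p(2)[of "osc 1 t"] by (simp flip: of_real_diff)
    qed (use e in simp)
    also have "\<dots> < \<epsilon>" using e by (simp add: unit_window_lmeasurable)
    finally show "\<exists>g\<in>l2_closure unit_window ?L. l2_norm unit_window (\<lambda>t. of_real (\<phi> (osc 1 t)) - g t) < \<epsilon>"
      using subsetD[OF l2_closure_superset[OF V] pL] by (intro bexI[of _ ?p])
  qed
  fix a b :: real
  define U where "U = (- \<real>\<^sub>\<le>\<^sub>0) \<inter> Arg -` {2 * pi * a<..<2 * pi * b}"
  have "open U"
    unfolding U_def by (intro continuous_open_preimage continuous_on_Arg) auto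
  then have closedU: "closed (- U)" by (simp add: closed_Compl)
  have "0 \<in> - U" by (simp add: U_def)
  then have neU: "- U \<noteq> {}" by blast
  define \<phi> where "\<phi> j z = min 1 (real j * infdist z (- U))" for j z
  \<comment> \<open>At the left end point \<open>osc 1 t = -1\<close>, where the argument jumps.\<close>
  have in_U: "osc 1 t \<in> U \<longleftrightarrow> t \<in> box a b" if t: "t \<in> unit_window" "t \<noteq> - (1 / 2)" for t
  proof -
    have "- 1 < 2 * t" "2 * t < 1" using t by auto
    then have "pi * (- 1) < pi * (2 * t)" "pi * (2 * t) < pi * 1" using pi_gt_zero by (blast intro: mult_strict_left_mono)+
    then have t_arg: "2 * pi * t \<in> {- pi<..pi}" "2 * pi * t < pi" by auto
    then have arg: "Arg (osc 1 t) = 2 * pi * t" using Arg_cis[of "2 * pi * t"] by (simp add: osc_def)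
    moreover have "Arg (osc 1 t) < pi" using t_arg(2) arg by simp
    then have "osc 1 t \<notin> \<real>\<^sub>\<le>\<^sub>0"
      using Arg_eq_pi[of "osc 1 t"] norm_osc[of 1 t]
      by (auto simp: complex_nonpos_Reals_iff order_le_less complex_eq_iff cmod_def)
    ultimately show ?thesis by (simp add: U_def)
  qed
  have U_meas: "(\<lambda>t. indicator U (osc 1 t)) \<in> l2_space unit_window"
  proof (rule l2_space_bounded[OF unit_window_lmeasurable(1)])
    show "(\<lambda>t. indicator U (osc 1 t) :: complex) \<in> borel_measurable (lebesgue_on unit_window)"
      using \<open>open U\<close> by (intro measurable_compose[OF osc_measurable_lebesgue_on] borel_measurable_indicator) auto
    show "cmod (indicator U (osc 1 t)) \<le> 1" for t by (simp split: split_indicator)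
  qed
  have arc: "(\<lambda>t. indicator U (osc 1 t)) \<in> l2_closure unit_window ?L"
  proof (rule l2_closure_dominated[OF V one_l2[OF unit_window_lmeasurable(1)] U_meas])
    show "(\<lambda>t. of_real (\<phi> j (osc 1 t))) \<in> l2_closure unit_window ?L" for j
      unfolding \<phi>_def by (intro cont continuous_intros)
    show "(\<lambda>j. complex_of_real (\<phi> j (osc 1 t))) \<longlonglongrightarrow> indicator U (osc 1 t)" for t
    proof (cases "osc 1 t \<in> U")
      case True
      then have "infdist (osc 1 t) (- U) > 0"
        using closedU neU by (metis ComplD in_closed_iff_infdist_zero infdist_nonneg less_eq_real_def)
      then obtain N where N: "1 < real N * infdist (osc 1 t) (- U)" using reals_Archimedean3 by blast
      have "\<phi> j (osc 1 t) = 1" if "N \<le> j" for j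
        using order_trans[OF less_imp_le[OF N] mult_right_mono[of "real N" "real j"]] that
        by (simp add: \<phi>_def infdist_nonneg)
      then show ?thesis using True
        by (intro tendsto_eventually) (auto simp: eventually_sequentially intro!: exI[of _ N])
    next
      case False
      then have "\<phi> j (osc 1 t) = 0" for j by (simp add: \<phi>_def)
      then show ?thesis using False by simp
    qed
    show "cmod (of_real (\<phi> j (osc 1 t))) \<le> cmod 1" for j t
    proof -
      have "0 \<le> real j * infdist (osc 1 t) (- U)" by (simp add: infdist_nonneg)
      then have "0 \<le> \<phi> j (osc 1 t)" "\<phi> j (osc 1 t) \<le> 1" by (simp_all add: \<phi>_def)
      then show ?thesis by simp
    qed
  qed
  have "AE t in lebesgue. t \<noteq> - (1 / 2)" using AE_completion[OF AE_lborel_singleton] by blast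
  then have "AE t in lebesgue_on unit_window. t \<noteq> - (1 / 2)" by (subst AE_restrict_space_iff) auto
  moreover have "AE t in lebesgue_on unit_window. t \<in> unit_window" by (rule AE_I2) (simp add: space_restrict_space)
  ultimately have "AE t in lebesgue_on unit_window. indicator (box a b) t = (indicator U (osc 1 t) :: complex)"
    by eventually_elim (use in_U in \<open>simp add: indicator_def\<close>)
  then show "(\<lambda>t. indicator (box a b) t) \<in> l2_closure unit_window ?L"
    by (intro l2_closure_AE_cong[OF V arc indicator_l2]) (auto simp: unit_window_lmeasurable)
qed

lemma trig_riesz_basis: "riesz_basis unit_window (\<lambda>n::int. osc (of_int n)) 1 1"
  unfolding riesz_basis_def riesz_sequence_def
  by (intro conjI allI impI trig_dense osc_l2[OF unit_window_lmeasurable(1)]) (simp_all only: osc_orthonormal)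

section \<open>Kadec's one quarter theorem\<close>

text \<open>
  Stability of orthonormal bases. The Riesz bounds are the triangle inequality. For density,
  approximate \<open>w\<close> by \<open>\<Sum> c e\<close> and then exchange \<open>e\<close> for \<open>v\<close>: the error is at most \<open>q \<parallel>w\<parallel>\<close> up to the quality
  of the first approximation, so any factor between \<open>q\<close> and \<open>1\<close> serves in \<open>dense_by_contraction\<close>.
\<close>

lemma paley_wiener:
  fixes e v :: "'i \<Rightarrow> 'a::euclidean_space \<Rightarrow> complex"
  assumes e: "riesz_basis D e 1 1" and v: "\<And>n. v n \<in> l2_space D" and q: "0 \<le> q" "q < 1"
    and close: "\<And>F c. finite F \<Longrightarrow>
      l2_norm D (\<lambda>x. \<Sum>n\<in>F. c n * (v n x - e n x)) \<le> q * sqrt (\<Sum>n\<in>F. (cmod (c n))\<^sup>2)"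
  shows "riesz_basis D v ((1 - q)\<^sup>2) ((1 + q)\<^sup>2)"
proof -
  have es: "riesz_sequence D e 1 1" using e by (simp add: riesz_basis_def)
  note el2 = riesz_sequenceD(3)[OF es]
  have norm_e: "l2_norm D (\<lambda>x. \<Sum>n\<in>F. c n * e n x) = sqrt (\<Sum>n\<in>F. (cmod (c n))\<^sup>2)" if "finite F" for F c
    using riesz_sequenceD(4,5)[OF es that, of c] by (intro real_sqrt_unique[symmetric]) auto
  have split: "(\<Sum>n\<in>F. c n * v n x) = (\<Sum>n\<in>F. c n * e n x) + (\<Sum>n\<in>F. c n * (v n x - e n x))" for F c x
    by (simp add: right_diff_distrib sum_subtractf)
  have dl2: "(\<lambda>x. \<Sum>n\<in>F. c n * (v n x - e n x)) \<in> l2_space D" for F c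
    by (intro l2_sum l2_scale l2_diff v el2)
  have up: "l2_norm D (\<lambda>x. \<Sum>n\<in>F. c n * v n x) \<le> (1 + q) * sqrt (\<Sum>n\<in>F. (cmod (c n))\<^sup>2)"
    if "finite F" for F c
  proof -
    have "l2_norm D (\<lambda>x. \<Sum>n\<in>F. c n * v n x)
        \<le> l2_norm D (\<lambda>x. \<Sum>n\<in>F. c n * e n x) + l2_norm D (\<lambda>x. \<Sum>n\<in>F. c n * (v n x - e n x))"
      unfolding split by (intro l2_norm_triangle l2_lincomb el2 dl2)
    then show ?thesis using close[OF that, of c] norm_e[OF that, of c] by (simp only: distrib_right)
  qed
  have low: "(1 - q) * sqrt (\<Sum>n\<in>F. (cmod (c n))\<^sup>2) \<le> l2_norm D (\<lambda>x. \<Sum>n\<in>F. c n * v n x)"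
    if "finite F" for F c
  proof -
    have "(\<lambda>x. \<Sum>n\<in>F. c n * e n x) = (\<lambda>x. (\<Sum>n\<in>F. c n * v n x) - (\<Sum>n\<in>F. c n * (v n x - e n x)))"
      by (simp add: split)
    then have "l2_norm D (\<lambda>x. \<Sum>n\<in>F. c n * e n x)
        \<le> l2_norm D (\<lambda>x. \<Sum>n\<in>F. c n * v n x) + l2_norm D (\<lambda>x. \<Sum>n\<in>F. c n * (v n x - e n x))"
      using l2_norm_triangle_diff[OF l2_lincomb[of v D c F, OF v] dl2[of c F]] by (simp only:)
    then show ?thesis using close[OF that, of c] norm_e[OF that, of c] by (simp only: left_diff_distrib)
  qed
  show ?thesis
    unfolding riesz_basis_def riesz_sequence_def
  proof (intro conjI allI impI v)
    fix F :: "'i set" and c :: "'i \<Rightarrow> complex"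
    assume F: "finite F"
    have S: "(sqrt (\<Sum>n\<in>F. (cmod (c n))\<^sup>2))\<^sup>2 = (\<Sum>n\<in>F. (cmod (c n))\<^sup>2)" by (simp add: sum_nonneg)
    have "((1 - q) * sqrt (\<Sum>n\<in>F. (cmod (c n))\<^sup>2))\<^sup>2 \<le> (l2_norm D (\<lambda>x. \<Sum>n\<in>F. c n * v n x))\<^sup>2"
      using q by (intro power_mono low F) (auto intro!: mult_nonneg_nonneg sum_nonneg)
    then show "(1 - q)\<^sup>2 * (\<Sum>n\<in>F. (cmod (c n))\<^sup>2) \<le> (l2_norm D (\<lambda>x. \<Sum>n\<in>F. c n * v n x))\<^sup>2"
      by (simp only: power_mult_distrib S)
    have "(l2_norm D (\<lambda>x. \<Sum>n\<in>F. c n * v n x))\<^sup>2 \<le> ((1 + q) * sqrt (\<Sum>n\<in>F. (cmod (c n))\<^sup>2))\<^sup>2"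
      by (intro power_mono up F) auto
    then show "(l2_norm D (\<lambda>x. \<Sum>n\<in>F. c n * v n x))\<^sup>2 \<le> (1 + q)\<^sup>2 * (\<Sum>n\<in>F. (cmod (c n))\<^sup>2)"
      by (simp only: power_mult_distrib S)
  next
    show "l2_space D \<subseteq> l2_closure D (lin_span v)"
    proof (rule dense_by_contraction[OF v, of "(1 + q) / 2"])
      fix w assume w: "w \<in> l2_space D"
      show "\<exists>s\<in>lin_span v. l2_norm D (\<lambda>x. w x - s x) \<le> (1 + q) / 2 * l2_norm D w"
      proof (cases "l2_norm D w = 0")
        case True
        then show ?thesis
          using lin_spanI[of "{}" "\<lambda>_. 0" v] by (intro bexI[of _ "\<lambda>x. 0"]) auto
      next
        case False
        define W where "W = l2_norm D w"
        define \<epsilon> where "\<epsilon> = (1 - q) / 4"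
        have W: "W > 0" using False l2_norm_nonneg[of D w] unfolding W_def by linarith
        have "\<epsilon> * W > 0" using W q by (simp add: \<epsilon>_def)
        moreover have "w \<in> l2_closure D (lin_span e)" using e w by (auto simp: riesz_basis_def)
        ultimately obtain g where "g \<in> lin_span e" "l2_norm D (\<lambda>x. w x - g x) < \<epsilon> * W" by (metis l2_closureE)
        then obtain F c where F: "finite F" and near: "l2_norm D (\<lambda>x. w x - (\<Sum>n\<in>F. c n * e n x)) < \<epsilon> * W"
          by (auto simp: lin_span_def)
        define p where "p = (\<lambda>x. \<Sum>n\<in>F. c n * e n x)"
        define s where "s = (\<lambda>x. \<Sum>n\<in>F. c n * v n x)"
        have p: "p \<in> l2_space D" unfolding p_def by (intro l2_lincomb el2)
        have s: "s \<in> l2_space D" unfolding s_def by (intro l2_lincomb v)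
        have near: "l2_norm D (\<lambda>x. w x - p x) < \<epsilon> * W" using near by (simp add: p_def)
        have pn: "l2_norm D p \<le> W + \<epsilon> * W"
          using l2_norm_triangle_diff[OF w l2_diff[OF w p]] near by (simp add: W_def)
        have "l2_norm D (\<lambda>x. s x - p x) \<le> q * l2_norm D p"
          using close[OF F, of c] norm_e[OF F, of c]
          by (simp add: s_def p_def right_diff_distrib sum_subtractf)
        also have "\<dots> \<le> q * (W + \<epsilon> * W)" using q by (intro mult_left_mono pn)
        finally have sp: "l2_norm D (\<lambda>x. p x - s x) \<le> q * (W + \<epsilon> * W)"
          by (simp only: l2_norm_minus_commute[of D p s])
        have "l2_norm D (\<lambda>x. w x - s x) \<le> \<epsilon> * W + q * (W + \<epsilon> * W)"
          using l2_norm_triangle_mid[OF w p s] near sp by linarith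
        also have "\<dots> \<le> \<epsilon> * W + (q * W + 1 * (\<epsilon> * W))"
          unfolding distrib_left using q \<open>\<epsilon> * W > 0\<close> by (intro add_mono mult_right_mono order_refl) auto
        also have "\<dots> = (1 + q) / 2 * W" by (simp add: \<epsilon>_def field_simps)
        finally show ?thesis using lin_spanI[OF F, of c v] by (auto simp: s_def W_def)
      qed
    qed (use q in auto)
  qed (use q in auto)
qed

lemma sinc_minus [simp]: "sinc (- x) = sinc x"
  by (simp add: sinc_def)

text \<open>
  Parseval's identity for \<open>osc x\<close> and \<open>osc y\<close>, polarised. For \<open>y = - x\<close> and for \<open>x + y = 1\<close> these are the
  partial fraction expansions of the cotangent and of the tangent.
\<close>

lemma sinc_product_has_sum:
  "((\<lambda>k::int. sinc (x - of_int k) * sinc (y - of_int k)) has_sum sinc (x - y)) UNIV"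
proof -
  have v: "osc l \<in> l2_space unit_window" for l by (intro osc_l2 unit_window_lmeasurable)
  note parseval = riesz_basis_Parseval[OF trig_riesz_basis]
  have nrm: "(l2_norm unit_window (osc l))\<^sup>2 = 1" for l
  proof -
    have "complex_of_real ((l2_norm unit_window (osc l))\<^sup>2) = of_real 1"
      unfolding l2_inner_self[symmetric] osc_inner by (simp add: sinc_def)
    then show ?thesis by (simp only: of_real_eq_iff)
  qed
  have sq: "((\<lambda>k::int. (sinc (l - of_int k))\<^sup>2) has_sum 1) UNIV" for l
    using parseval[OF v[of l]] by (simp add: osc_inner nrm)
  have "(l2_norm unit_window (\<lambda>t. osc x t - osc y t))\<^sup>2 = 2 - 2 * sinc (x - y)"
    by (simp add: l2_norm_diff_square[OF v v] osc_inner nrm)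
  moreover have "(cmod (l2_inner unit_window (\<lambda>t. osc x t - osc y t) (osc (of_int k))))\<^sup>2
      = (sinc (x - of_int k) - sinc (y - of_int k))\<^sup>2" for k :: int
    by (simp add: l2_inner_diff_left[OF v v v] osc_inner flip: of_real_diff)
  ultimately have diff: "((\<lambda>k::int. (sinc (x - of_int k) - sinc (y - of_int k))\<^sup>2) has_sum (2 - 2 * sinc (x - y))) UNIV"
    using parseval[OF l2_diff[OF v v], of x y] by simp
  have "((\<lambda>k::int. ((sinc (x - of_int k))\<^sup>2 + (sinc (y - of_int k))\<^sup>2
      + (- 1) * (sinc (x - of_int k) - sinc (y - of_int k))\<^sup>2) * (1 / 2)) has_sum
      (1 + 1 + (- 1) * (2 - 2 * sinc (x - y))) * (1 / 2)) UNIV"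
    by (intro has_sum_cmult_left has_sum_cmult_right has_sum_add sq diff)
  then show ?thesis by (simp add: power2_diff)
qed

text \<open>
  On the level of Fourier coefficients the sum is dominated by the convolution of \<open>|c|\<close> with \<open>a\<close>, so
  this is Young's inequality \<open>\<parallel>a * |c|\<parallel>\<^sub>2 \<le> \<parallel>a\<parallel>\<^sub>1 \<parallel>c\<parallel>\<^sub>2\<close> combined with Parseval's identity.
\<close>

lemma convolution_dominated:
  fixes a :: "int \<Rightarrow> real"
  assumes F: "finite F" and u: "\<And>n. n \<in> F \<Longrightarrow> u n \<in> l2_space unit_window"
    and a: "(a has_sum S) UNIV" and a0: "\<And>k. 0 \<le> a k"
    and dom: "\<And>n m. n \<in> F \<Longrightarrow> cmod (l2_inner unit_window (u n) (osc (of_int m))) \<le> a (n - m)"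
  shows "l2_norm unit_window (\<lambda>t. \<Sum>n\<in>F. c n * u n t) \<le> S * sqrt (\<Sum>n\<in>F. (cmod (c n))\<^sup>2)"
proof -
  let ?f = "\<lambda>t. \<Sum>n\<in>F. c n * u n t"
  define u' where "u' n = (if n \<in> F then u n else (\<lambda>t. 0))" for n
  have u': "u' n \<in> l2_space unit_window" for n using u by (simp add: u'_def)
  have f_eq: "?f = (\<lambda>t. \<Sum>n\<in>F. c n * u' n t)" by (auto simp: u'_def)
  have f: "?f \<in> l2_space unit_window" unfolding f_eq by (intro l2_lincomb u')
  have v: "osc l \<in> l2_space unit_window" for l by (intro osc_l2 unit_window_lmeasurable)
  have S0: "0 \<le> S" using has_sum_nonneg[OF a] a0 by simp
  have part: "sum a I \<le> S" if "finite I" for I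
    using finite_sum_le_infsum[OF has_sum_imp_summable[OF a] that] infsumI[OF a] a0 by simp
  have inner: "l2_inner unit_window ?f (osc (of_int m)) = (\<Sum>n\<in>F. c n * l2_inner unit_window (u n) (osc (of_int m)))" for m
    unfolding f_eq by (subst l2_inner_lincomb_left[of u', OF u' v]) (auto simp: u'_def)
  have coeff: "(cmod (l2_inner unit_window ?f (osc (of_int m))))\<^sup>2 \<le> S * (\<Sum>n\<in>F. (cmod (c n))\<^sup>2 * a (n - m))" for m
  proof -
    have "cmod (l2_inner unit_window ?f (osc (of_int m))) \<le> (\<Sum>n\<in>F. cmod (c n) * a (n - m))"
      unfolding inner by (intro order_trans[OF norm_sum] sum_mono) (auto simp: norm_mult intro!: mult_left_mono dom)
    then have "(cmod (l2_inner unit_window ?f (osc (of_int m))))\<^sup>2 \<le> (\<Sum>n\<in>F. cmod (c n) * a (n - m))\<^sup>2"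
      by (intro power_mono) auto
    also have "\<dots> = (\<Sum>n\<in>F. (cmod (c n) * sqrt (a (n - m))) * sqrt (a (n - m)))\<^sup>2"
      using a0 by (intro arg_cong[of _ _ "\<lambda>x. x\<^sup>2"] sum.cong) (auto simp: mult.assoc)
    also have "\<dots> \<le> (\<Sum>n\<in>F. (cmod (c n) * sqrt (a (n - m)))\<^sup>2) * (\<Sum>n\<in>F. (sqrt (a (n - m)))\<^sup>2)"
      by (rule Cauchy_Schwarz_ineq_sum)
    also have "\<dots> = (\<Sum>n\<in>F. (cmod (c n))\<^sup>2 * a (n - m)) * sum a ((\<lambda>n. n - m) ` F)"
      using a0 by (subst sum.reindex) (auto simp: power_mult_distrib inj_on_def)
    also have "\<dots> \<le> (\<Sum>n\<in>F. (cmod (c n))\<^sup>2 * a (n - m)) * S"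
      using F a0 by (intro mult_left_mono part sum_nonneg) auto
    finally show ?thesis by (simp add: mult.commute)
  qed
  have "(\<Sum>m\<in>I. (cmod (l2_inner unit_window ?f (osc (of_int m))))\<^sup>2) \<le> S * S * (\<Sum>n\<in>F. (cmod (c n))\<^sup>2)"
    if I: "finite I" for I
  proof -
    have "(\<Sum>m\<in>I. (cmod (l2_inner unit_window ?f (osc (of_int m))))\<^sup>2)
        \<le> (\<Sum>m\<in>I. S * (\<Sum>n\<in>F. (cmod (c n))\<^sup>2 * a (n - m)))" by (intro sum_mono coeff)
    also have "\<dots> = S * (\<Sum>n\<in>F. (cmod (c n))\<^sup>2 * (\<Sum>m\<in>I. a (n - m)))"
      by (simp add: sum_distrib_left[symmetric] sum.swap[of _ F I])
    also have "\<dots> = S * (\<Sum>n\<in>F. (cmod (c n))\<^sup>2 * sum a ((\<lambda>m. n - m) ` I))"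
    proof -
      have "sum a ((\<lambda>m. n - m) ` I) = (\<Sum>m\<in>I. a (n - m))" for n
        by (subst sum.reindex) (auto simp: inj_on_def)
      then show ?thesis by simp
    qed
    also have "\<dots> \<le> S * (\<Sum>n\<in>F. (cmod (c n))\<^sup>2 * S)"
      using I by (intro mult_left_mono sum_mono part S0) auto
    finally show ?thesis unfolding sum_distrib_right[symmetric] by (simp only: mult_ac)
  qed
  then have "(\<Sum>\<^sub>\<infinity>m. (cmod (l2_inner unit_window ?f (osc (of_int m))))\<^sup>2) \<le> S * S * (\<Sum>n\<in>F. (cmod (c n))\<^sup>2)"
    using riesz_basis_Parseval[OF trig_riesz_basis f]
    by (intro infsum_le_finite_sums) (auto dest: has_sum_imp_summable)
  then have "(l2_norm unit_window ?f)\<^sup>2 \<le> S * S * (\<Sum>n\<in>F. (cmod (c n))\<^sup>2)"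
    using infsumI[OF riesz_basis_Parseval[OF trig_riesz_basis f]] by simp
  also have "\<dots> = (S * sqrt (\<Sum>n\<in>F. (cmod (c n))\<^sup>2))\<^sup>2"
    by (simp add: power_mult_distrib sum_nonneg power2_eq_square[of S])
  finally show ?thesis by (rule power2_le_imp_le) (use S0 in \<open>auto intro!: mult_nonneg_nonneg sum_nonneg\<close>)
qed

lemma sin_pi_shift: "sin (pi * (x + of_int k)) = (if even k then 1 else - 1) * sin (pi * x)"
  by (simp add: distrib_left sin_add)

lemma sinc_double: "x \<noteq> 0 \<Longrightarrow> sinc (2 * x) = sin (pi * x) * cos (pi * x) / (pi * x)"
  using sin_double[of "pi * x"] by (simp add: sinc_def mult.left_commute[of pi 2])

lemma sinc_antimono:
  assumes "0 \<le> x" "x \<le> y" "y \<le> 1 / 2"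
  shows "sinc y \<le> sinc x"
proof (cases "x = 0")
  case True
  then show ?thesis using assms sin_x_le_x[of "pi * y"] by (auto simp: sinc_def divide_le_eq)
next
  case False
  have le: "t * cos t \<le> sin t" if "0 \<le> t" "t \<le> pi / 2" for t :: real
  proof -
    have "sin 0 - 0 * cos (0::real) \<le> sin t - t * cos t"
    proof (rule DERIV_nonneg_imp_nondecreasing[OF that(1), where f = "\<lambda>t. sin t - t * cos t"])
      fix s :: real assume s: "0 \<le> s" "s \<le> t"
      have "((\<lambda>t. sin t - t * cos t) has_real_derivative s * sin s) (at s)"
        by (auto intro!: derivative_eq_intros)
      moreover have "0 \<le> s * sin s" using s that by (intro mult_nonneg_nonneg sin_ge_zero) auto
      ultimately show "\<exists>y. ((\<lambda>t. sin t - t * cos t) has_real_derivative y) (at s) \<and> 0 \<le> y" by blast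
    qed
    then show ?thesis by simp
  qed
  have "sin (pi * y) / (pi * y) \<le> sin (pi * x) / (pi * x)"
  proof (rule DERIV_nonpos_imp_nonincreasing[where f = "\<lambda>t. sin t / t"])
    show "pi * x \<le> pi * y" using assms by simp
    fix t assume t: "pi * x \<le> t" "t \<le> pi * y"
    have "0 < pi * x" using False assms by simp
    then have t0: "0 < t" using t(1) by linarith
    have "t \<le> pi * (1 / 2)" using t(2) assms(3) by (meson mult_left_mono order_trans pi_ge_zero)
    then have "t * cos t \<le> sin t" using t0 by (intro le) auto
    moreover have "((\<lambda>t. sin t / t) has_real_derivative (t * cos t - sin t) / t\<^sup>2) (at t)"
      using t0 by (auto intro!: derivative_eq_intros simp: power2_eq_square mult.commute)
    ultimately show "\<exists>y. ((\<lambda>t. sin t / t) has_real_derivative y) (at t) \<and> y \<le> 0"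
      using t0 by (intro exI[of _ "(t * cos t - sin t) / t\<^sup>2"]) (auto simp: divide_le_0_iff)
  qed
  then show ?thesis using False assms by (simp add: sinc_def)
qed

lemma sin_less_cos:
  assumes "0 \<le> x" "x < pi / 4"
  shows "sin x < cos x"
proof -
  have "sin x < sin (pi / 2 - x)" using assms by (intro sin_monotone_2pi) auto
  then show ?thesis by (simp add: cos_sin_eq)
qed

lemma mult_cos_pi_mono:
  assumes "0 \<le> x" "x \<le> y" "y < 1 / 4"
  shows "x * cos (pi * x) \<le> y * cos (pi * y)"
proof (rule DERIV_nonneg_imp_nondecreasing[OF assms(2), where f = "\<lambda>t. t * cos (pi * t)"])
  fix t assume t: "x \<le> t" "t \<le> y"
  have "pi * t \<le> pi * (1 / 4)" using t assms by (intro mult_left_mono) auto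
  then have pt: "pi * t < 1" using pi_less_4 by linarith
  have pt0: "0 \<le> pi * t" using t assms by simp
  have "pi * t < pi * (1 / 4)" using t assms by (intro mult_strict_left_mono) auto
  then have sc: "sin (pi * t) < cos (pi * t)" using pt0 by (intro sin_less_cos) (auto simp: order_trans[of _ 0])
  have "0 \<le> sin (pi * t)" using pt0 pt pi_gt3 by (intro sin_ge_zero) linarith+
  then have "pi * t * sin (pi * t) \<le> 1 * sin (pi * t)" using pt by (intro mult_right_mono) auto
  then have "0 \<le> cos (pi * t) - pi * t * sin (pi * t)" using sc by linarith
  moreover have "((\<lambda>t. t * cos (pi * t)) has_real_derivative cos (pi * t) - pi * t * sin (pi * t)) (at t)"
    by (auto intro!: derivative_eq_intros)
  ultimately show "\<exists>y. ((\<lambda>t. t * cos (pi * t)) has_real_derivative y) (at t) \<and> 0 \<le> y" by blast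
qed

lemma osc_combination_inner:
  "l2_inner unit_window (\<lambda>t. a * osc x t + b * osc y t + c * osc z t) (osc l)
     = a * of_real (sinc (x - l)) + b * of_real (sinc (y - l)) + c * of_real (sinc (z - l))"
proof -
  have v: "osc l \<in> l2_space unit_window" for l by (intro osc_l2 unit_window_lmeasurable)
  show ?thesis
    by (simp add: l2_inner_add_left l2_inner_scale_left l2_add l2_scale v osc_inner del: of_real_diff)
qed

text \<open>
  For \<open>|\<delta>| \<le> L\<close>, this dominates the Fourier coefficients of \<open>cos (2 \<pi> \<delta> t) - 1\<close>, and \<open>sin_majorant\<close>
  below those of \<open>exp (\<pi> \<i> t) sin (2 \<pi> \<delta> t)\<close>. Both are attained for \<open>\<delta> = L\<close>; writing them as products of
  two values of \<open>sinc\<close> lets \<open>sinc_product_has_sum\<close> evaluate their sums.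
\<close>

definition cos_majorant :: "real \<Rightarrow> int \<Rightarrow> real" where
  "cos_majorant L k = (if k = 0 then 1 else 0) - sinc (L - of_int k) * sinc (- L - of_int k) / sinc L"

definition sin_majorant :: "real \<Rightarrow> int \<Rightarrow> real" where
  "sin_majorant L k = sinc (1 / 2 + L + of_int k) * sinc (1 / 2 - L + of_int k) * (pi * L / cos (pi * L))"

lemma int_square_ge_1: "k \<noteq> 0 \<Longrightarrow> 1 \<le> (real_of_int k)\<^sup>2"
  by (metis int_one_le_iff_zero_less of_int_1_le_iff of_int_power zero_less_power2)

lemma cos_majorant_off_0:
  assumes "k \<noteq> 0" and L: "0 < L" "L < 1 / 4"
  shows "cos_majorant L k = L * sin (pi * L) / (pi * ((of_int k)\<^sup>2 - L\<^sup>2))"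
proof -
  have s: "sin (pi * L) > 0" using L by (intro sin_gt_zero) (auto simp: field_simps)
  have "\<bar>L\<bar> < 1" "1 \<le> \<bar>real_of_int k\<bar>" using assms by linarith+
  then have ne: "L - of_int k \<noteq> 0" "- L - of_int k \<noteq> 0" by linarith+
  have "sinc (L - of_int k) * sinc (- L - of_int k)
      = - ((sin (pi * L))\<^sup>2) / ((pi * (L - of_int k)) * (pi * (- L - of_int k)))"
    using ne sin_pi_shift[of L "- k"] sin_pi_shift[of "- L" "- k"]
    by (auto simp: sinc_def power2_eq_square)
  also have "(pi * (L - of_int k)) * (pi * (- L - of_int k)) = pi\<^sup>2 * ((of_int k)\<^sup>2 - L\<^sup>2)"
    by (simp add: power2_eq_square algebra_simps)
  finally show ?thesis using assms s
    by (simp add: cos_majorant_def sinc_def power2_eq_square)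
qed

lemma sinc_average_off_0:
  assumes "k \<noteq> 0" and d: "\<bar>\<delta>\<bar> < 1 / 4"
  shows "(sinc (of_int k + \<delta>) + sinc (of_int k - \<delta>)) / 2
       = - (if even k then 1 else - 1) * (\<delta> * sin (pi * \<delta>) / (pi * ((of_int k)\<^sup>2 - \<delta>\<^sup>2)))"
proof -
  have "\<bar>\<delta>\<bar> < 1" "1 \<le> \<bar>real_of_int k\<bar>" using assms by linarith+
  then have ne: "of_int k + \<delta> \<noteq> 0" "of_int k - \<delta> \<noteq> 0" by linarith+
  have *: "(of_int k)\<^sup>2 - \<delta>\<^sup>2 = (of_int k + \<delta>) * (of_int k - \<delta>)" by (simp add: power2_eq_square algebra_simps)
  show ?thesis
    using ne sin_pi_shift[of \<delta> k] sin_pi_shift[of "- \<delta>" k] unfolding *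
    by (simp add: sinc_def add.commute divide_simps) (auto simp: algebra_simps)
qed

text \<open>
  For \<open>k \<noteq> 0\<close> the left-hand side is \<open>|\<delta>| sin (\<pi> |\<delta>|) / (\<pi> (k\<^sup>2 - \<delta>\<^sup>2))\<close>, which increases with \<open>|\<delta>|\<close> and
  becomes the majorant at \<open>|\<delta>| = L\<close>. For \<open>k = 0\<close> it is \<open>1 - sinc \<delta>\<close>, and \<open>sinc\<close> decreases.
\<close>

lemma cos_symbol_bound:
  assumes L: "0 < L" "L < 1 / 4" and d: "\<bar>\<delta>\<bar> \<le> L"
  shows "\<bar>(sinc (of_int k + \<delta>) + sinc (of_int k - \<delta>)) / 2 - sinc (of_int k)\<bar> \<le> cos_majorant L k"
proof (cases "k = 0")
  case True
  have "sinc L > 0" using L by (auto simp: sinc_def field_simps intro!: divide_pos_pos sin_gt_zero)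
  moreover have "sinc \<bar>\<delta>\<bar> = sinc \<delta>" by (cases "\<delta> \<ge> 0") auto
  moreover have "sinc L \<le> sinc \<bar>\<delta>\<bar>" "sinc \<bar>\<delta>\<bar> \<le> sinc 0"
    using L d by (auto intro!: sinc_antimono)
  ultimately show ?thesis using True sinc_minus[of L] sinc_minus[of \<delta>] 
    by (simp add: cos_majorant_def sinc_def[of 0])
next
  case False
  have k1: "1 \<le> (real_of_int k)\<^sup>2" by (rule int_square_ge_1[OF False])
  have dl: "\<delta>\<^sup>2 \<le> L\<^sup>2" using d L by (metis abs_le_square_iff abs_of_pos)
  have l1: "L\<^sup>2 < 1" using L power_strict_mono[of L 1 2] by simp
  have s: "\<delta> * sin (pi * \<delta>) = \<bar>\<delta>\<bar> * sin (pi * \<bar>\<delta>\<bar>)" by (cases "\<delta> \<ge> 0") auto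
  have s0: "0 \<le> sin (pi * \<bar>\<delta>\<bar>)" using L d by (intro sin_ge_zero) (auto simp: field_simps)
  have "pi * L \<le> pi * (1 / 2)" using L by (intro mult_left_mono) auto
  then have s1: "sin (pi * \<bar>\<delta>\<bar>) \<le> sin (pi * L)"
    using L d by (intro sin_monotone_2pi_le) (auto intro: order_trans[of _ 0])
  have "\<bar>(sinc (of_int k + \<delta>) + sinc (of_int k - \<delta>)) / 2 - sinc (of_int k)\<bar>
      = \<bar>\<delta>\<bar> * sin (pi * \<bar>\<delta>\<bar>) / (pi * ((of_int k)\<^sup>2 - \<delta>\<^sup>2))"
    using k1 dl l1 s0 False sinc_average_off_0[OF False, of \<delta>] L d
    by (simp add: sinc_int s abs_mult)
  also have "\<dots> \<le> L * sin (pi * L) / (pi * ((of_int k)\<^sup>2 - L\<^sup>2))"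
    using k1 dl l1 s0 s1 L d by (intro frac_le mult_mono mult_pos_pos mult_nonneg_nonneg) auto
  finally show ?thesis using cos_majorant_off_0[OF False L] by simp
qed

lemma cos_majorant_nonneg: "0 < L \<Longrightarrow> L < 1 / 4 \<Longrightarrow> 0 \<le> cos_majorant L k"
  using cos_symbol_bound[of L 0 k] by linarith

lemma cos_majorant_has_sum:
  assumes L: "0 < L" "L < 1 / 4"
  shows "(cos_majorant L has_sum (1 - cos (pi * L))) UNIV"
proof -
  have s: "sin (pi * L) > 0" using L by (intro sin_gt_zero) (auto simp: field_simps)
  have one: "((\<lambda>k::int. if k = 0 then 1 else 0 :: real) has_sum 1) UNIV"
    using has_sum_finite_neutralI[of "{0::int}" UNIV "\<lambda>k. if k = 0 then 1 else 0 :: real"] by simp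
  have "((\<lambda>k::int. (if k = 0 then 1 else 0) + (sinc (L - of_int k) * sinc (- L - of_int k)) * (- 1 / sinc L))
      has_sum (1 + sinc (L - - L) * (- 1 / sinc L))) UNIV"
    by (intro has_sum_add one has_sum_cmult_left sinc_product_has_sum)
  moreover have "sinc (L - - L) / sinc L = cos (pi * L)"
    using s L by (simp add: sinc_double) (simp add: sinc_def)
  ultimately show ?thesis by (simp add: cos_majorant_def[abs_def])
qed

lemma half_int_ne: "real_of_int k + 1 / 2 + x \<noteq> 0" "1 / 4 \<le> (real_of_int k + 1 / 2)\<^sup>2" if "\<bar>x\<bar> < 1 / 2"
proof -
  have "1 / 2 \<le> \<bar>real_of_int k + 1 / 2\<bar>"
  proof (cases "k \<ge> 0")
    case False
    then have "real_of_int k \<le> - 1" by linarith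
    then show ?thesis by simp
  qed simp
  then show "real_of_int k + 1 / 2 + x \<noteq> 0" using that by linarith
  show "1 / 4 \<le> (real_of_int k + 1 / 2)\<^sup>2"
    using power_mono[OF \<open>1 / 2 \<le> \<bar>real_of_int k + 1 / 2\<bar>\<close>, of 2] by (simp add: power2_eq_square)
qed

lemma sinc_half:
  assumes "\<bar>x\<bar> < 1 / 2"
  shows "sinc (of_int k + 1 / 2 + x) = (if even k then 1 else - 1) * cos (pi * x) / (pi * (of_int k + 1 / 2 + x))"
proof -
  have "sin (pi * (of_int k + 1 / 2 + x)) = (if even k then 1 else - 1) * sin (pi * (1 / 2 + x))"
    using sin_pi_shift[of "1 / 2 + x" k] by (simp add: add_ac)
  also have "sin (pi * (1 / 2 + x)) = cos (pi * x)" by (simp add: distrib_left sin_add)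
  finally show ?thesis using half_int_ne(1)[OF assms, of k] by (simp add: sinc_def)
qed

lemma sin_majorant_eq:
  assumes L: "0 < L" "L < 1 / 4"
  shows "sin_majorant L k = L * cos (pi * L) / (pi * ((of_int k + 1 / 2)\<^sup>2 - L\<^sup>2))"
proof -
  have c: "cos (pi * L) > 0" using L by (intro cos_gt_zero) (auto simp: field_simps)
  have *: "(of_int k + 1 / 2)\<^sup>2 - L\<^sup>2 = (of_int k + 1 / 2 + L) * (of_int k + 1 / 2 + - L)"
    by (simp add: power2_eq_square algebra_simps)
  have "sinc (1 / 2 + L + of_int k) * sinc (1 / 2 - L + of_int k)
      = sinc (of_int k + 1 / 2 + L) * sinc (of_int k + 1 / 2 + - L)"
    by (simp add: algebra_simps)
  also have "\<dots> = (cos (pi * L))\<^sup>2 / (pi\<^sup>2 * ((of_int k + 1 / 2 + L) * (of_int k + 1 / 2 + - L)))"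
    using L by (subst (1 2) sinc_half) (auto simp: power2_eq_square mult_ac)
  finally show ?thesis using c L unfolding sin_majorant_def * by (simp add: power2_eq_square)
qed

text \<open>
  The left-hand side is \<open>|\<delta>| cos (\<pi> \<delta>) / (\<pi> ((k + 1/2)\<^sup>2 - \<delta>\<^sup>2))\<close>. Its numerator still increases with
  \<open>|\<delta>|\<close> below \<open>1/4\<close>, because there \<open>x tan x < 1\<close> for \<open>x = \<pi> |\<delta>|\<close>.
\<close>

lemma sin_symbol_bound:
  assumes L: "0 < L" "L < 1 / 4" and d: "\<bar>\<delta>\<bar> \<le> L"
  shows "\<bar>(sinc (of_int k + 1 / 2 + \<delta>) - sinc (of_int k + 1 / 2 - \<delta>)) / 2\<bar> \<le> sin_majorant L k"
proof -
  have k1: "1 / 4 \<le> (real_of_int k + 1 / 2)\<^sup>2" by (rule half_int_ne(2)[of 0]) simp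
  have dl: "\<delta>\<^sup>2 \<le> L\<^sup>2" using d L by (metis abs_le_square_iff abs_of_pos)
  have l1: "L\<^sup>2 < 1 / 4" using L power_strict_mono[of L "1 / 4" 2] by (simp add: power2_eq_square)
  have ne: "of_int k + 1 / 2 + \<delta> \<noteq> 0" "of_int k + 1 / 2 + - \<delta> \<noteq> 0"
    by (rule half_int_ne(1), use L d in simp)+
  have c0: "0 \<le> cos (pi * \<bar>\<delta>\<bar>)" using L d by (intro cos_ge_zero) (auto simp: field_simps intro: order_trans[of _ 0])
  have ceq: "cos (pi * \<bar>\<delta>\<bar>) = cos (pi * \<delta>)" by (cases "\<delta> \<ge> 0") auto
  have *: "(of_int k + 1 / 2)\<^sup>2 - \<delta>\<^sup>2 = (of_int k + 1 / 2 + \<delta>) * (of_int k + 1 / 2 + - \<delta>)"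
    by (simp add: power2_eq_square algebra_simps)
  have "sinc (of_int k + 1 / 2 - \<delta>)
      = (if even k then 1 else - 1) * cos (pi * \<delta>) / (pi * (of_int k + 1 / 2 + - \<delta>))"
    using sinc_half[of "- \<delta>" k] L d by simp
  moreover have "sinc (of_int k + 1 / 2 + \<delta>)
      = (if even k then 1 else - 1) * cos (pi * \<delta>) / (pi * (of_int k + 1 / 2 + \<delta>))"
    using sinc_half[of \<delta> k] L d by simp
  moreover have "(e * C / (p * A) - e * C / (p * B)) / 2 = e * ((B - A) / 2 * C / (p * (A * B)))"
    if "A \<noteq> 0" "B \<noteq> 0" "p \<noteq> 0" for e C p A B :: real
    using that by (simp add: field_simps)
  ultimately have "(sinc (of_int k + 1 / 2 + \<delta>) - sinc (of_int k + 1 / 2 - \<delta>)) / 2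
      = (if even k then 1 else - 1) * (((of_int k + 1 / 2 + - \<delta>) - (of_int k + 1 / 2 + \<delta>)) / 2 * cos (pi * \<delta>)
          / (pi * ((of_int k + 1 / 2)\<^sup>2 - \<delta>\<^sup>2)))"
    using ne unfolding * by (simp del: add_uminus_conv_diff)
  then have "\<bar>(sinc (of_int k + 1 / 2 + \<delta>) - sinc (of_int k + 1 / 2 - \<delta>)) / 2\<bar>
      = \<bar>\<delta>\<bar> * cos (pi * \<bar>\<delta>\<bar>) / (pi * ((of_int k + 1 / 2)\<^sup>2 - \<delta>\<^sup>2))"
    using k1 dl l1 c0 by (simp add: abs_mult ceq)
  also have "\<dots> \<le> L * cos (pi * L) / (pi * ((of_int k + 1 / 2)\<^sup>2 - L\<^sup>2))"
    using k1 dl l1 L d mult_cos_pi_mono[of "\<bar>\<delta>\<bar>" L] mult_nonneg_nonneg[OF abs_ge_zero c0, of \<delta>]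
    by (intro frac_le mult_pos_pos) auto
  finally show ?thesis using sin_majorant_eq[OF L] by simp
qed

lemma sin_majorant_has_sum:
  assumes L: "0 < L" "L < 1 / 4"
  shows "(sin_majorant L has_sum sin (pi * L)) UNIV"
proof -
  have c: "cos (pi * L) > 0" using L by (intro cos_gt_zero) (auto simp: field_simps)
  have "((\<lambda>k::int. sinc (1 / 2 + L - of_int k) * sinc (1 / 2 - L - of_int k) * (pi * L / cos (pi * L)))
      has_sum sinc ((1 / 2 + L) - (1 / 2 - L)) * (pi * L / cos (pi * L))) UNIV"
    by (intro has_sum_cmult_left sinc_product_has_sum)
  also have "sinc ((1 / 2 + L) - (1 / 2 - L)) * (pi * L / cos (pi * L)) = sin (pi * L)"
    using c L by (simp add: sinc_double)
  also have "(\<lambda>k::int. sinc (1 / 2 + L - of_int k) * sinc (1 / 2 - L - of_int k) * (pi * L / cos (pi * L)))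
      = (\<lambda>k. sin_majorant L (- k))" by (simp add: sin_majorant_def fun_eq_iff)
  finally show ?thesis 
    using has_sum_reindex[of uminus "UNIV :: int set" "sin_majorant L" "sin (pi * L)"] by (simp add: o_def)
qed

text \<open>
  Each perturbation splits as
  \<open>exp (2 \<pi> \<i> n t) ((cos (2 \<pi> \<delta>\<^sub>n t) - 1) + \<i> sin (2 \<pi> \<delta>\<^sub>n t))\<close>.
  The Fourier coefficients of the first term are dominated by \<open>cos_majorant\<close>, whose sum is
  \<open>1 - cos (\<pi> L)\<close>. The sine has no continuous periodic extension and its coefficients are not
  summable; multiplying the second term by the character \<open>exp (\<pi> \<i> t)\<close> leaves the norm unchanged,
  repairs this, and gives \<open>sin_majorant\<close> with sum \<open>sin (\<pi> L)\<close>. So the perturbation has norm at most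
  \<open>q = 1 - cos (\<pi> L) + sin (\<pi> L)\<close>, and \<open>q < 1\<close> precisely for \<open>L < 1/4\<close>.
\<close>

theorem kadec:
  fixes \<delta> :: "int \<Rightarrow> real"
  assumes L: "L < 1 / 4" and d: "\<And>n. \<bar>\<delta> n\<bar> \<le> L"
  shows "\<exists>A B. riesz_basis unit_window (\<lambda>n. osc (of_int n + \<delta> n)) A B"
proof -
  \<comment> \<open>The sums of the majorants are computed by dividing by \<open>sin (\<pi> L)\<close>, which calls for a positive bound.\<close>
  define L' where "L' = (L + 1 / 4) / 2"
  have L0: "0 \<le> L" using d[of 0] by linarith
  have L': "0 < L'" "L' < 1 / 4" using L L0 by (auto simp: L'_def)
  have d': "\<bar>\<delta> n\<bar> \<le> L'" for n using d[of n] L by (simp add: L'_def)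
  define q where "q = (1 - cos (pi * L')) + sin (pi * L')"
  have sc: "sin (pi * L') < cos (pi * L')" using L' by (intro sin_less_cos) (auto intro: order_trans[of _ 0])
  have s0: "0 \<le> sin (pi * L')" using L' by (intro sin_ge_zero) (auto simp: field_simps)
  have q: "0 \<le> q" "q < 1" using sc s0 cos_le_one[of "pi * L'"] by (auto simp: q_def)
  have v: "osc l \<in> l2_space unit_window" for l by (intro osc_l2 unit_window_lmeasurable)
  have close: "l2_norm unit_window (\<lambda>t. \<Sum>n\<in>F. c n * (osc (of_int n + \<delta> n) t - osc (of_int n) t))
      \<le> q * sqrt (\<Sum>n\<in>F. (cmod (c n))\<^sup>2)" if F: "finite F" for F and c :: "int \<Rightarrow> complex"
  proof -
    define u where "u n = (\<lambda>t. (1 / 2) * osc (of_int n + \<delta> n) t + (1 / 2) * osc (of_int n - \<delta> n) t + (- 1) * osc (of_int n) t)" for n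
    define w where "w n = (\<lambda>t. (1 / 2) * osc (of_int n + \<delta> n + 1 / 2) t - (1 / 2) * osc (of_int n - \<delta> n + 1 / 2) t)" for n
    define w' where "w' n = (\<lambda>t. (1 / 2) * osc (of_int n + \<delta> n) t - (1 / 2) * osc (of_int n - \<delta> n) t)" for n
    have u: "u n \<in> l2_space unit_window" and w: "w n \<in> l2_space unit_window"
      and w': "w' n \<in> l2_space unit_window" for n
      unfolding u_def w_def w'_def by (intro l2_diff l2_add l2_scale v)+
    have un: "l2_norm unit_window (\<lambda>t. \<Sum>n\<in>F. c n * u n t) \<le> (1 - cos (pi * L')) * sqrt (\<Sum>n\<in>F. (cmod (c n))\<^sup>2)"
    proof (rule convolution_dominated[OF F u cos_majorant_has_sum[OF L'] cos_majorant_nonneg[OF L']])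
      fix n m :: int
      have "l2_inner unit_window (u n) (osc (of_int m))
          = of_real ((sinc (of_int (n - m) + \<delta> n) + sinc (of_int (n - m) - \<delta> n)) / 2 - sinc (of_int (n - m)))"
        unfolding u_def osc_combination_inner by (simp add: add_divide_distrib algebra_simps)
      then show "cmod (l2_inner unit_window (u n) (osc (of_int m))) \<le> cos_majorant L' (n - m)"
        using cos_symbol_bound[OF L' d'[of n], of "n - m"] by (simp only: norm_of_real)
    qed
    have wn: "l2_norm unit_window (\<lambda>t. \<Sum>n\<in>F. c n * w n t) \<le> sin (pi * L') * sqrt (\<Sum>n\<in>F. (cmod (c n))\<^sup>2)"
    proof (rule convolution_dominated[OF F w sin_majorant_has_sum[OF L']])
      show "0 \<le> sin_majorant L' k" for k using sin_symbol_bound[OF L', of 0 k] L' by simp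
      fix n m :: int
      have "l2_inner unit_window (w n) (osc (of_int m))
          = of_real ((sinc (of_int (n - m) + 1 / 2 + \<delta> n) - sinc (of_int (n - m) + 1 / 2 - \<delta> n)) / 2)"
        using osc_combination_inner[of "1 / 2" "of_int n + \<delta> n + 1 / 2" "- 1 / 2" "of_int n - \<delta> n + 1 / 2" 0 0 "of_int m"]
        unfolding w_def by (simp add: diff_divide_distrib algebra_simps)
      then show "cmod (l2_inner unit_window (w n) (osc (of_int m))) \<le> sin_majorant L' (n - m)"
        using sin_symbol_bound[OF L' d'[of n], of "n - m"] by (simp only: norm_of_real)
    qed
    have "l2_norm unit_window (\<lambda>t. \<Sum>n\<in>F. c n * w n t) = l2_norm unit_window (\<lambda>t. \<Sum>n\<in>F. c n * w' n t)"
    proof (rule l2_norm_cong)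
      fix t
      have "w n t = osc (1 / 2) t * w' n t" for n
      proof -
        have shift: "osc (x + 1 / 2) t = osc (1 / 2) t * osc x t" for x by (simp add: osc_mult add.commute)
        show ?thesis unfolding w_def w'_def shift by (simp only: right_diff_distrib mult.left_commute)
      qed
      then have "(\<Sum>n\<in>F. c n * w n t) = osc (1 / 2) t * (\<Sum>n\<in>F. c n * w' n t)"
        by (simp add: sum_distrib_left mult_ac)
      then show "cmod (\<Sum>n\<in>F. c n * w n t) = cmod (\<Sum>n\<in>F. c n * w' n t)" by (simp add: norm_mult)
    qed
    then have wn': "l2_norm unit_window (\<lambda>t. \<Sum>n\<in>F. c n * w' n t) \<le> sin (pi * L') * sqrt (\<Sum>n\<in>F. (cmod (c n))\<^sup>2)"
      using wn by simp
    have "c n * (osc (of_int n + \<delta> n) t - osc (of_int n) t) = c n * u n t + c n * w' n t" for n t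
      by (simp add: u_def w'_def flip: distrib_left)
    then have "l2_norm unit_window (\<lambda>t. \<Sum>n\<in>F. c n * (osc (of_int n + \<delta> n) t - osc (of_int n) t))
        \<le> l2_norm unit_window (\<lambda>t. \<Sum>n\<in>F. c n * u n t) + l2_norm unit_window (\<lambda>t. \<Sum>n\<in>F. c n * w' n t)"
      by (simp only: sum.distrib) (intro l2_norm_triangle l2_lincomb u w')
    then show ?thesis using un wn' by (simp add: q_def distrib_right)
  qed
  show ?thesis
    using paley_wiener[OF trig_riesz_basis v q close] by blast
qed

section \<open>Changes of variables\<close>

text \<open>
  The constant \<open>\<kappa>\<close> is the factor in \<open>\<integral>\<^sub>D f (\<Phi> x) dx = \<kappa> \<integral>\<^sub>E f y dy\<close>. Stating this through the image measure
  covers affine maps as well as maps with infinitely many pieces.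
\<close>

definition change_of_variable ::
    "'a::euclidean_space set \<Rightarrow> 'b::euclidean_space set \<Rightarrow> ('a \<Rightarrow> 'b) \<Rightarrow> real \<Rightarrow> bool" where
  "change_of_variable D E \<Phi> \<kappa> \<longleftrightarrow> 0 < \<kappa> \<and>
     \<Phi> \<in> lebesgue_on D \<rightarrow>\<^sub>M lebesgue_on E \<and>
     (\<exists>\<Psi> \<in> lebesgue_on E \<rightarrow>\<^sub>M lebesgue_on D. (\<forall>x\<in>D. \<Psi> (\<Phi> x) = x) \<and> (\<forall>y\<in>E. \<Phi> (\<Psi> y) = y)) \<and>
     distr (lebesgue_on D) (lebesgue_on E) \<Phi> = density (lebesgue_on E) (\<lambda>_. ennreal \<kappa>)"

lemma change_of_variable_maps:
  assumes "change_of_variable D E \<Phi> \<kappa>" "x \<in> D"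
  shows "\<Phi> x \<in> E"
  using assms measurable_space[of \<Phi> "lebesgue_on D" "lebesgue_on E" x]
  by (auto simp: change_of_variable_def space_restrict_space)

lemma change_of_variable_integral:
  fixes f :: "'b::euclidean_space \<Rightarrow> 'c::{banach, second_countable_topology}"
  assumes c: "change_of_variable D E \<Phi> \<kappa>" and f: "f \<in> borel_measurable (lebesgue_on E)"
  shows "integrable (lebesgue_on D) (\<lambda>x. f (\<Phi> x)) \<longleftrightarrow> integrable (lebesgue_on E) f"
    and "(LINT x|lebesgue_on D. f (\<Phi> x)) = \<kappa> *\<^sub>R (LINT y|lebesgue_on E. f y)"
proof -
  have \<Phi>: "\<Phi> \<in> lebesgue_on D \<rightarrow>\<^sub>M lebesgue_on E" and k: "0 < \<kappa>"
    and d: "distr (lebesgue_on D) (lebesgue_on E) \<Phi> = density (lebesgue_on E) (\<lambda>_. ennreal \<kappa>)"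
    using c by (auto simp: change_of_variable_def)
  have "integrable (lebesgue_on D) (\<lambda>x. f (\<Phi> x)) \<longleftrightarrow> integrable (density (lebesgue_on E) (\<lambda>_. ennreal \<kappa>)) f"
    using integrable_distr_eq[OF \<Phi> f] by (simp add: d)
  also have "\<dots> \<longleftrightarrow> integrable (lebesgue_on E) f"
  proof -
    have "integrable (lebesgue_on E) f" if "integrable (lebesgue_on E) (\<lambda>x. \<kappa> *\<^sub>R f x)"
      using integrable_scaleR_right[OF that, of "1 / \<kappa>"] k by simp
    then have "integrable (lebesgue_on E) (\<lambda>x. \<kappa> *\<^sub>R f x) \<longleftrightarrow> integrable (lebesgue_on E) f"
      by (blast intro: integrable_scaleR_right)
    then show ?thesis using k f by (subst integrable_density) auto
  qed
  finally show "integrable (lebesgue_on D) (\<lambda>x. f (\<Phi> x)) \<longleftrightarrow> integrable (lebesgue_on E) f" .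
  have "(LINT x|lebesgue_on D. f (\<Phi> x)) = (LINT y|density (lebesgue_on E) (\<lambda>_. ennreal \<kappa>). f y)"
    using integral_distr[OF \<Phi> f] by (simp add: d)
  also have "\<dots> = \<kappa> *\<^sub>R (LINT y|lebesgue_on E. f y)"
    using k f by (subst integral_density) auto
  finally show "(LINT x|lebesgue_on D. f (\<Phi> x)) = \<kappa> *\<^sub>R (LINT y|lebesgue_on E. f y)" .
qed

lemma change_of_variable_l2:
  assumes c: "change_of_variable D E \<Phi> \<kappa>"
  shows "(\<lambda>x. f (\<Phi> x)) \<in> l2_space D \<longleftrightarrow> f \<in> l2_space E"
proof -
  have \<Phi>: "\<Phi> \<in> lebesgue_on D \<rightarrow>\<^sub>M lebesgue_on E" using c by (simp add: change_of_variable_def)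
  obtain \<Psi> where \<Psi>: "\<Psi> \<in> lebesgue_on E \<rightarrow>\<^sub>M lebesgue_on D" "\<And>y. y \<in> E \<Longrightarrow> \<Phi> (\<Psi> y) = y"
    using c unfolding change_of_variable_def by blast
  have meas: "f \<in> borel_measurable (lebesgue_on E)" if m: "(\<lambda>x. f (\<Phi> x)) \<in> borel_measurable (lebesgue_on D)"
  proof -
    have "(\<lambda>y. f (\<Phi> (\<Psi> y))) \<in> borel_measurable (lebesgue_on E)" by (rule measurable_compose[OF \<Psi>(1) m])
    also have "?this \<longleftrightarrow> ?thesis" by (intro measurable_cong) (simp add: \<Psi>(2) space_restrict_space)
    finally show ?thesis .
  qed
  have int: "integrable (lebesgue_on D) (\<lambda>x. (cmod (f (\<Phi> x)))\<^sup>2) \<longleftrightarrow> integrable (lebesgue_on E) (\<lambda>y. (cmod (f y))\<^sup>2)"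
    if "f \<in> borel_measurable (lebesgue_on E)"
    using that by (intro change_of_variable_integral(1)[OF c]) auto
  show ?thesis
  proof (cases "f \<in> borel_measurable (lebesgue_on E)")
    case True
    then have "(\<lambda>x. f (\<Phi> x)) \<in> borel_measurable (lebesgue_on D)" by (rule measurable_compose[OF \<Phi>])
    then show ?thesis unfolding l2_space_def mem_Collect_eq using True int[OF True] by argo
  next
    case False
    then have "(\<lambda>x. f (\<Phi> x)) \<notin> borel_measurable (lebesgue_on D)" using meas by blast
    then show ?thesis unfolding l2_space_def mem_Collect_eq using False by argo
  qed
qed

lemma change_of_variable_norm:
  assumes c: "change_of_variable D E \<Phi> \<kappa>" and f: "f \<in> l2_space E"
  shows "l2_norm D (\<lambda>x. f (\<Phi> x)) = sqrt \<kappa> * l2_norm E f"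
  using change_of_variable_integral(2)[OF c, of "\<lambda>y. (cmod (f y))\<^sup>2"] l2_spaceD(1)[OF f]
  by (simp add: l2_norm_def real_sqrt_mult)

lemma change_of_variable_inner:
  assumes c: "change_of_variable D E \<Phi> \<kappa>" and f: "f \<in> l2_space E" and g: "g \<in> l2_space E"
  shows "l2_inner D (\<lambda>x. f (\<Phi> x)) (\<lambda>x. g (\<Phi> x)) = of_real \<kappa> * l2_inner E f g"
  using change_of_variable_integral(2)[OF c, of "\<lambda>y. f y * cnj (g y)"] l2_prod_integrable[OF f g]
  by (simp add: l2_inner_def scaleR_conv_of_real)

lemma change_of_variable_onto:
  assumes c: "change_of_variable D E \<Phi> \<kappa>" and w: "w \<in> l2_space D"
  obtains f where "f \<in> l2_space E" "\<And>x. x \<in> D \<Longrightarrow> w x = f (\<Phi> x)"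
proof -
  obtain \<Psi> where \<Psi>: "\<And>x. x \<in> D \<Longrightarrow> \<Psi> (\<Phi> x) = x"
    using c unfolding change_of_variable_def by blast
  have "(\<lambda>x. w (\<Psi> (\<Phi> x))) \<in> l2_space D"
    using w l2_space_cong[of D w "\<lambda>x. w (\<Psi> (\<Phi> x))"] by (simp add: \<Psi>)
  then have "(\<lambda>y. w (\<Psi> y)) \<in> l2_space E" using change_of_variable_l2[OF c, of "\<lambda>y. w (\<Psi> y)"] by simp
  then show ?thesis using that[of "\<lambda>y. w (\<Psi> y)"] \<Psi> by simp
qed

lemma change_of_variable_inverse:
  assumes c: "change_of_variable D E \<Phi> 1"
  obtains \<Psi> where "change_of_variable E D \<Psi> 1" "\<And>y. y \<in> E \<Longrightarrow> \<Phi> (\<Psi> y) = y"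
proof -
  have \<Phi>: "\<Phi> \<in> lebesgue_on D \<rightarrow>\<^sub>M lebesgue_on E" and d: "distr (lebesgue_on D) (lebesgue_on E) \<Phi> = lebesgue_on E"
    using c by (simp_all add: change_of_variable_def density_1)
  obtain \<Psi> where \<Psi>: "\<Psi> \<in> lebesgue_on E \<rightarrow>\<^sub>M lebesgue_on D" "\<And>x. x \<in> D \<Longrightarrow> \<Psi> (\<Phi> x) = x"
      "\<And>y. y \<in> E \<Longrightarrow> \<Phi> (\<Psi> y) = y"
    using c unfolding change_of_variable_def by blast
  have "distr (lebesgue_on E) (lebesgue_on D) \<Psi> = distr (distr (lebesgue_on D) (lebesgue_on E) \<Phi>) (lebesgue_on D) \<Psi>"
    by (simp only: d)
  also have "\<dots> = distr (lebesgue_on D) (lebesgue_on D) (\<Psi> \<circ> \<Phi>)"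
    by (rule distr_distr[OF \<Psi>(1) \<Phi>])
  also have "\<dots> = distr (lebesgue_on D) (lebesgue_on D) (\<lambda>x. x)"
    by (intro distr_cong) (simp_all add: \<Psi>(2))
  also have "\<dots> = lebesgue_on D" by (rule distr_id2) simp
  finally have "distr (lebesgue_on E) (lebesgue_on D) \<Psi> = density (lebesgue_on D) (\<lambda>_. ennreal 1)"
    by (simp add: density_1)
  moreover have "\<exists>\<Theta>\<in>lebesgue_on D \<rightarrow>\<^sub>M lebesgue_on E. (\<forall>y\<in>E. \<Theta> (\<Psi> y) = y) \<and> (\<forall>x\<in>D. \<Psi> (\<Theta> x) = x)"
    using \<Phi> \<Psi>(2,3) by blast
  ultimately have "change_of_variable E D \<Psi> 1"
    unfolding change_of_variable_def using \<Psi>(1) by simp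
  then show ?thesis using that \<Psi>(3) by blast
qed

text \<open>
  The map \<open>f \<mapsto> u (f \<circ> \<Phi>)\<close> is \<open>\<surd>\<kappa>\<close> times a unitary operator from \<open>L\<^sup>2(E)\<close> onto \<open>L\<^sup>2(D)\<close>, and constant
  phases \<open>p n\<close> can be absorbed into the coefficients. The factor \<open>u\<close> serves to translate all frequencies,
  the phases arise from translating the set.
\<close>

lemma riesz_basis_transfer:
  assumes c: "change_of_variable D E \<Phi> \<kappa>" and R: "riesz_basis E v A B"
    and u: "u \<in> borel_measurable (lebesgue_on D)" "\<And>x. cmod (u x) = 1"
    and p: "\<And>n. cmod (p n) = 1"
    and w: "\<And>n x. x \<in> D \<Longrightarrow> w n x = p n * (u x * v n (\<Phi> x))"
  shows "riesz_basis D w (\<kappa> * A) (\<kappa> * B)"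
proof -
  have rs: "riesz_sequence E v A B" using R by (simp add: riesz_basis_def)
  note v = riesz_sequenceD(3)[OF rs]
  have k: "0 < \<kappa>" using c by (simp add: change_of_variable_def)
  have mult_u: "(\<lambda>x. h x * f x) \<in> l2_space D"
    if "f \<in> l2_space D" "h \<in> borel_measurable (lebesgue_on D)" "\<And>x. cmod (h x) = 1" for f h
    using that by (auto simp: l2_space_def norm_mult)
  have vc: "(\<lambda>x. v n (\<Phi> x)) \<in> l2_space D" for n using v by (simp add: change_of_variable_l2[OF c])
  have wl2: "w n \<in> l2_space D" for n
    using l2_scale[OF mult_u[OF vc u], of "p n" n] l2_space_cong[of D "w n", OF w] by simp
  have sum_eq: "(\<Sum>n\<in>F. d n * w n x) = u x * (\<Sum>n\<in>F. (d n * p n) * v n (\<Phi> x))" if "x \<in> D" for F d x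
    by (simp add: w[OF that] sum_distrib_left mult_ac)
  have norm_eq: "(l2_norm D (\<lambda>x. \<Sum>n\<in>F. d n * w n x))\<^sup>2 = \<kappa> * (l2_norm E (\<lambda>y. \<Sum>n\<in>F. (d n * p n) * v n y))\<^sup>2"
    for F d
  proof -
    have "l2_norm D (\<lambda>x. \<Sum>n\<in>F. d n * w n x) = l2_norm D (\<lambda>x. \<Sum>n\<in>F. (d n * p n) * v n (\<Phi> x))"
      by (intro l2_norm_cong) (simp add: sum_eq norm_mult u(2))
    also have "\<dots> = sqrt \<kappa> * l2_norm E (\<lambda>y. \<Sum>n\<in>F. (d n * p n) * v n y)"
      by (rule change_of_variable_norm[OF c l2_lincomb[OF v]])
    finally show ?thesis using k by (simp add: power_mult_distrib)
  qed
  show ?thesis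
    unfolding riesz_basis_def riesz_sequence_def
  proof (intro conjI allI impI wl2)
    fix F :: "'c set" and d :: "'c \<Rightarrow> complex" assume F: "finite F"
    have S: "(\<Sum>n\<in>F. (cmod (d n * p n))\<^sup>2) = (\<Sum>n\<in>F. (cmod (d n))\<^sup>2)" by (simp add: norm_mult p)
    show "\<kappa> * A * (\<Sum>n\<in>F. (cmod (d n))\<^sup>2) \<le> (l2_norm D (\<lambda>x. \<Sum>n\<in>F. d n * w n x))\<^sup>2"
      using mult_left_mono[OF riesz_sequenceD(4)[OF rs F, of "\<lambda>n. d n * p n"], of \<kappa>] k
      unfolding norm_eq S mult.assoc by linarith
    show "(l2_norm D (\<lambda>x. \<Sum>n\<in>F. d n * w n x))\<^sup>2 \<le> \<kappa> * B * (\<Sum>n\<in>F. (cmod (d n))\<^sup>2)"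
      using mult_left_mono[OF riesz_sequenceD(5)[OF rs F, of "\<lambda>n. d n * p n"], of \<kappa>] k
      unfolding norm_eq S mult.assoc by linarith
  next
    show "l2_space D \<subseteq> l2_closure D (lin_span w)"
    proof
      fix f assume f: "f \<in> l2_space D"
      have cu: "(\<lambda>x. cnj (u x)) \<in> borel_measurable (lebesgue_on D)"
        using measurable_compose[OF u(1), of cnj borel] by (simp add: borel_measurable_continuous_onI continuous_intros)
      have "(\<lambda>x. cnj (u x) * f x) \<in> l2_space D" using f cu u(2) by (intro mult_u) auto
      from change_of_variable_onto[OF c this] obtain g
        where g: "g \<in> l2_space E" "\<And>x. x \<in> D \<Longrightarrow> cnj (u x) * f x = g (\<Phi> x)"
        by blast
      have uu: "u x * cnj (u x) = 1" for x using u(2)[of x] by (simp add: complex_norm_square[symmetric])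
      have fg: "f x = u x * g (\<Phi> x)" if "x \<in> D" for x
        unfolding g(2)[OF that, symmetric] mult.assoc[symmetric] uu by simp
      have gc: "g \<in> l2_closure E (lin_span v)" using R g(1) by (auto simp: riesz_basis_def)
      show "f \<in> l2_closure D (lin_span w)"
        unfolding l2_closure_def mem_Collect_eq
      proof (intro conjI f allI impI)
        fix \<epsilon> :: real assume "\<epsilon> > 0"
        then have "\<epsilon> / sqrt \<kappa> > 0" using k by simp
        then obtain h where h: "h \<in> lin_span v" "l2_norm E (\<lambda>y. g y - h y) < \<epsilon> / sqrt \<kappa>"
          using gc by (metis l2_closureE)
        obtain F d where F: "finite F" and h_eq: "h = (\<lambda>y. \<Sum>n\<in>F. d n * v n y)"
          using h(1) by (auto simp: lin_span_def)
        define s where "s = (\<lambda>x. \<Sum>n\<in>F. (d n / p n) * w n x)"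
        have p0: "p n \<noteq> 0" for n using p[of n] by auto
        have s_eq: "s x = u x * h (\<Phi> x)" if "x \<in> D" for x
          unfolding s_def sum_eq[OF that] h_eq by (simp add: p0)
        have "l2_norm D (\<lambda>x. f x - s x) = l2_norm D (\<lambda>x. g (\<Phi> x) - h (\<Phi> x))"
          by (intro l2_norm_cong) (simp add: fg s_eq u(2) norm_mult flip: right_diff_distrib)
        also have "\<dots> = sqrt \<kappa> * l2_norm E (\<lambda>y. g y - h y)"
          using g(1) lin_span_subset_l2[OF v h(1)]
          by (intro change_of_variable_norm[OF c, of "\<lambda>y. g y - h y"] l2_diff)
        also have "\<dots> < \<epsilon>" using h(2) k by (simp add: field_simps)
        finally show "\<exists>s\<in>lin_span w. l2_norm D (\<lambda>x. f x - s x) < \<epsilon>"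
          using lin_spanI[OF F, of "\<lambda>n. d n / p n" w] by (intro bexI[of _ s]) (auto simp: s_def)
      qed
    qed
  qed (use k riesz_sequenceD(1,2)[OF rs] in auto)
qed

lemma frame_constants_transfer:
  assumes c: "change_of_variable D E \<Phi> 1" and w: "\<And>n x. x \<in> D \<Longrightarrow> w n x = v n (\<Phi> x)"
  shows "frame_constants E v A B \<longleftrightarrow> frame_constants D w A B"
proof (cases "\<forall>n. v n \<in> l2_space E")
  case False
  have "w n \<in> l2_space D \<longleftrightarrow> v n \<in> l2_space E" for n
    using change_of_variable_l2[OF c, of "v n"] l2_space_cong[of D "w n", OF w] by simp
  with False have "\<exists>n. v n \<notin> l2_space E" "\<exists>n. w n \<notin> l2_space D" by auto
  then show ?thesis unfolding frame_constants_def by blast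
next
  case True
  then have v: "v n \<in> l2_space E" for n by simp
  have wl2: "w n \<in> l2_space D" for n
    using v[of n] change_of_variable_l2[OF c, of "v n"] l2_space_cong[of D "w n", OF w] by simp
  have norm_eq: "l2_norm D (\<lambda>x. \<Sum>n\<in>F. d n * w n x) = l2_norm E (\<lambda>y. \<Sum>n\<in>F. d n * v n y)" for F d
    using change_of_variable_norm[OF c l2_lincomb[of v E d F, OF v]]
      l2_norm_cong[of D "\<lambda>x. \<Sum>n\<in>F. d n * w n x" "\<lambda>x. \<Sum>n\<in>F. d n * v n (\<Phi> x)"] by (simp add: w)
  have corr: "(\<forall>f\<in>l2_space D. P (\<lambda>n. l2_inner D f (w n)) (l2_norm D f)) \<longleftrightarrow>
      (\<forall>g\<in>l2_space E. P (\<lambda>n. l2_inner E g (v n)) (l2_norm E g))" (is "?L \<longleftrightarrow> ?R") for P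
  proof
    have inner: "l2_inner D f (w n) = l2_inner E g (v n)" "l2_norm D f = l2_norm E g"
      if "g \<in> l2_space E" "\<And>x. x \<in> D \<Longrightarrow> f x = g (\<Phi> x)" for f g n
      using change_of_variable_inner[OF c that(1) v] change_of_variable_norm[OF c that(1)]
        l2_inner_cong[of D f "\<lambda>x. g (\<Phi> x)" "w n" "\<lambda>x. v n (\<Phi> x)"] l2_norm_cong[of D f "\<lambda>x. g (\<Phi> x)"]
      by (simp_all add: that(2) w)
    show ?R if L: ?L
    proof
      fix g assume g: "g \<in> l2_space E"
      then have "(\<lambda>x. g (\<Phi> x)) \<in> l2_space D" by (simp add: change_of_variable_l2[OF c])
      with L have "P (\<lambda>n. l2_inner D (\<lambda>x. g (\<Phi> x)) (w n)) (l2_norm D (\<lambda>x. g (\<Phi> x)))" by blast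
      then show "P (\<lambda>n. l2_inner E g (v n)) (l2_norm E g)" by (simp add: inner[OF g])
    qed
    show ?L if R: ?R
    proof
      fix f assume "f \<in> l2_space D"
      from change_of_variable_onto[OF c this] obtain g
        where g: "g \<in> l2_space E" "\<And>x. x \<in> D \<Longrightarrow> f x = g (\<Phi> x)"
        by blast
      with R have "P (\<lambda>n. l2_inner E g (v n)) (l2_norm E g)" by blast
      then show "P (\<lambda>n. l2_inner D f (w n)) (l2_norm D f)" by (simp add: inner[OF g])
    qed
  qed
  show ?thesis
    unfolding frame_constants_def norm_eq
    using corr[of "\<lambda>z s. (\<lambda>n. (cmod (z n))\<^sup>2) summable_on UNIV \<and> A * s\<^sup>2 \<le> (\<Sum>\<^sub>\<infinity>n. (cmod (z n))\<^sup>2) \<and>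
        (\<Sum>\<^sub>\<infinity>n. (cmod (z n))\<^sup>2) \<le> B * s\<^sup>2"] v wl2 by simp
qed

lemma change_of_variable_affine:
  fixes c t a b :: real
  assumes c: "0 < c"
  shows "change_of_variable {a..<b} {t + c * a..<t + c * b} (\<lambda>x. t + c * x) (1 / c)"
proof -
  let ?D = "{a..<b}" and ?E = "{t + c * a..<t + c * b}" and ?T = "\<lambda>x. t + c * x"
  have T: "(\<lambda>x. s + d * x) \<in> lebesgue \<rightarrow>\<^sub>M lebesgue" if "d \<noteq> 0" for s d :: real
    using lebesgue_affine_measurable[of "\<lambda>x::real. d" s] that by simp
  have iff: "?T x \<in> ?E \<longleftrightarrow> x \<in> ?D" for x using c by auto
  have m1: "?T \<in> lebesgue_on ?D \<rightarrow>\<^sub>M lebesgue_on ?E"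
    using T[of c t] c iff by (intro measurable_restrict_space2 measurable_restrict_space1) (auto simp: space_restrict_space)
  have m2: "(\<lambda>y. - t / c + (1 / c) * y) \<in> lebesgue_on ?E \<rightarrow>\<^sub>M lebesgue_on ?D"
    using T[of "1 / c" "- t / c"] c
    by (intro measurable_restrict_space2 measurable_restrict_space1) (auto simp: space_restrict_space field_simps)
  have em: "emeasure lebesgue (?T -` A) = ennreal (1 / c) * emeasure lebesgue A" if A: "A \<in> sets lebesgue" for A
  proof -
    have TA: "?T -` A \<in> sets lebesgue" using measurable_sets[OF T[of c t] A] c by simp
    have "emeasure lebesgue A = emeasure (density (distr lebesgue lebesgue ?T) (\<lambda>_. ennreal \<bar>c\<bar>)) A"
      using c by (subst lebesgue_real_affine[of c t]) auto
    also have "\<dots> = ennreal c * emeasure lebesgue (?T -` A)"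
      using A c T[of c t] by (subst emeasure_density) (auto simp: nn_integral_cmult emeasure_distr)
    finally show ?thesis using c
      by (simp add: mult.assoc[symmetric] ennreal_mult[symmetric])
  qed
  show ?thesis
    unfolding change_of_variable_def
  proof (intro conjI m1 bexI[OF _ m2] ballI)
    show "distr (lebesgue_on ?D) (lebesgue_on ?E) ?T = density (lebesgue_on ?E) (\<lambda>_. ennreal (1 / c))"
    proof (rule measure_eqI)
      fix A assume "A \<in> sets (distr (lebesgue_on ?D) (lebesgue_on ?E) ?T)"
      then have A': "A \<in> sets (lebesgue_on ?E)" by simp
      then have A: "A \<in> sets lebesgue" "A \<subseteq> ?E" by (auto simp: sets_restrict_space_iff)
      have eq: "?T -` A \<inter> ?D = ?T -` A" using A(2) iff by blast
      have "emeasure (distr (lebesgue_on ?D) (lebesgue_on ?E) ?T) A = emeasure (lebesgue_on ?D) (?T -` A \<inter> ?D)"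
        using m1 A' by (simp add: emeasure_distr space_restrict_space)
      also have "\<dots> = emeasure lebesgue (?T -` A)"
        unfolding eq by (subst emeasure_restrict_space) (use eq in auto)
      also have "\<dots> = ennreal (1 / c) * emeasure lebesgue A" by (rule em[OF A(1)])
      also have "emeasure lebesgue A = emeasure (lebesgue_on ?E) A"
        using A by (subst emeasure_restrict_space) auto
      also have "ennreal (1 / c) * \<dots> = emeasure (density (lebesgue_on ?E) (\<lambda>_. ennreal (1 / c))) A"
        using A' by (subst emeasure_density) (auto simp: nn_integral_cmult)
      finally show "emeasure (distr (lebesgue_on ?D) (lebesgue_on ?E) ?T) A
          = emeasure (density (lebesgue_on ?E) (\<lambda>_. ennreal (1 / c))) A" .
    qed simp
  qed (use c in \<open>auto simp: field_simps\<close>)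
qed

section \<open>Complementary frequencies on complementary sets\<close>

context
  fixes I W :: "'a::euclidean_space set"
  assumes I: "I \<in> sets lebesgue" and W: "W \<in> sets lebesgue" and sub: "I \<subseteq> W"
begin

lemma integrable_zero_extension:
  fixes f :: "'a \<Rightarrow> real"
  shows "integrable (lebesgue_on W) (\<lambda>x. if x \<in> I then f x else 0) \<longleftrightarrow> integrable (lebesgue_on I) f"
proof -
  have "(if x \<in> W then (if x \<in> I then f x else 0) else 0) = (if x \<in> I then f x else 0)" for x
    using sub by auto
  then show ?thesis
    using Lebesgue_Measure.integrable_restrict_UNIV[OF I, of f] Lebesgue_Measure.integrable_restrict_UNIV[OF W, of "\<lambda>x. if x \<in> I then f x else 0"] by simp
qed

lemma l2_zero_extension:
  assumes f: "f \<in> l2_space I"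
  shows "(\<lambda>x. if x \<in> I then f x else 0) \<in> l2_space W"
proof -
  have "(\<lambda>x. if x \<in> I then f x else 0) \<in> borel_measurable (lebesgue_on W)"
    using borel_measurable_if_lebesgue_on[OF I W sub, of f] l2_spaceD(1)[OF f] by blast
  moreover have "integrable (lebesgue_on W) (\<lambda>x. (cmod (if x \<in> I then f x else 0))\<^sup>2)"
  proof -
    have "(\<lambda>x. (cmod (if x \<in> I then f x else 0))\<^sup>2) = (\<lambda>x. if x \<in> I then (cmod (f x))\<^sup>2 else 0)" by auto
    then show ?thesis using integrable_zero_extension[of "\<lambda>x. (cmod (f x))\<^sup>2"] l2_spaceD(2)[OF f] by simp
  qed
  ultimately show ?thesis by (simp add: l2_space_def)
qed

lemma l2_inner_zero_extension: "l2_inner W (\<lambda>x. if x \<in> I then f x else 0) g = l2_inner I f g"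
proof -
  have "(\<lambda>x. (if x \<in> I then f x else 0) * cnj (g x)) = (\<lambda>x. if x \<in> I then f x * cnj (g x) else 0)" by auto
  then show ?thesis using Lebesgue_Measure.integral_restrict[OF sub I W, of "\<lambda>x. f x * cnj (g x)"] by (simp add: l2_inner_def)
qed

lemma l2_norm_zero_extension: "l2_norm W (\<lambda>x. if x \<in> I then f x else 0) = l2_norm I f"
proof -
  have "(\<lambda>x. (cmod (if x \<in> I then f x else 0))\<^sup>2) = (\<lambda>x. if x \<in> I then (cmod (f x))\<^sup>2 else 0)" by auto
  then show ?thesis using Lebesgue_Measure.integral_restrict[OF sub I W, of "\<lambda>x. (cmod (f x))\<^sup>2"] by (simp add: l2_norm_def)
qed

lemma l2_restrict:
  assumes f: "f \<in> l2_space W"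
  shows "f \<in> l2_space I"
proof -
  have "(\<lambda>x. if x \<in> I then f x else 0) \<in> borel_measurable (lebesgue_on W)"
    using I W sub l2_spaceD(1)[OF f]
    by (intro measurable_If_set borel_measurable_const) (auto simp: sets_restrict_space_iff Int_absorb2)
  then have m: "f \<in> borel_measurable (lebesgue_on I)"
    using borel_measurable_if_lebesgue_on[OF I W sub, of f] by blast
  have "(\<lambda>x. if x \<in> I then (cmod (f x))\<^sup>2 else 0) \<in> borel_measurable (lebesgue_on W)"
    using borel_measurable_if_lebesgue_on[OF I W sub, of "\<lambda>x. (cmod (f x))\<^sup>2"] m by auto
  then have "integrable (lebesgue_on W) (\<lambda>x. if x \<in> I then (cmod (f x))\<^sup>2 else 0)"
    by (rule Bochner_Integration.integrable_bound[OF l2_spaceD(2)[OF f]]) auto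
  with m show ?thesis by (simp add: l2_space_def integrable_zero_extension)
qed

end

lemma l2_norm_split:
  assumes I: "I \<in> sets lebesgue" and J: "J \<in> sets lebesgue" and IJ: "I \<inter> J = {}" and f: "f \<in> l2_space (I \<union> J)"
  shows "(l2_norm (I \<union> J) f)\<^sup>2 = (l2_norm I f)\<^sup>2 + (l2_norm J f)\<^sup>2"
proof -
  let ?h = "\<lambda>x. (cmod (f x))\<^sup>2"
  have W: "I \<union> J \<in> sets lebesgue" using I J by simp
  have fI: "f \<in> l2_space I" using l2_restrict[OF I W _ f] by simp
  have fJ: "f \<in> l2_space J" using l2_restrict[OF J W _ f] by simp
  have "(LINT x|lebesgue_on (I \<union> J). ?h x)
      = (LINT x|lebesgue_on (I \<union> J). (if x \<in> I then ?h x else 0) + (if x \<in> J then ?h x else 0))"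
    using IJ by (intro Bochner_Integration.integral_cong) auto
  also have "\<dots> = (LINT x|lebesgue_on (I \<union> J). (if x \<in> I then ?h x else 0))
      + (LINT x|lebesgue_on (I \<union> J). (if x \<in> J then ?h x else 0))"
    using integrable_zero_extension[OF I W, of ?h] integrable_zero_extension[OF J W, of ?h] l2_spaceD(2)[OF fI] l2_spaceD(2)[OF fJ]
    by (intro Bochner_Integration.integral_add) auto
  also have "\<dots> = (LINT x|lebesgue_on I. ?h x) + (LINT x|lebesgue_on J. ?h x)"
    using I J W by (subst (1 2) Lebesgue_Measure.integral_restrict) auto
  finally show ?thesis by (simp add: l2_norm_square)
qed

lemma orthonormal_remainder:
  assumes rs: "riesz_basis W e 1 1" and w: "w \<in> l2_space W" and F: "finite F"
  shows "(l2_norm W (\<lambda>x. w x - (\<Sum>n\<in>F. l2_inner W w (e n) * e n x)))\<^sup>2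
      = (l2_norm W w)\<^sup>2 - (\<Sum>n\<in>F. (cmod (l2_inner W w (e n)))\<^sup>2)"
proof -
  have rs': "riesz_sequence W e 1 1" using rs by (simp add: riesz_basis_def)
  note e = riesz_sequenceD(3)[OF rs']
  define a where "a n = l2_inner W w (e n)" for n
  have "l2_inner W w (\<lambda>x. \<Sum>n\<in>F. a n * e n x) = of_real (\<Sum>n\<in>F. (cmod (a n))\<^sup>2)"
    unfolding l2_inner_lincomb_right[OF e w]
    by (simp add: a_def[symmetric] complex_norm_square[symmetric] mult.commute[of "cnj _"] del: of_real_power)
  moreover have "(l2_norm W (\<lambda>x. \<Sum>n\<in>F. a n * e n x))\<^sup>2 = (\<Sum>n\<in>F. (cmod (a n))\<^sup>2)"
    using riesz_sequenceD(4,5)[OF rs' F, of a] by simp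
  ultimately show ?thesis
    using l2_norm_diff_square[OF w l2_lincomb[of e W a F, OF e]] by (simp add: a_def)
qed

lemma riesz_basis_orthogonal:
  assumes rs: "riesz_basis W e 1 1" and nm: "n \<noteq> m"
  shows "l2_inner W (e n) (e m) = 0"
proof -
  have rs': "riesz_sequence W e 1 1" using rs by (simp add: riesz_basis_def)
  note e = riesz_sequenceD(3)[OF rs']
  define p where "p = l2_inner W (e n) (e m)"
  have one: "(l2_norm W (e i))\<^sup>2 = 1" for i
    using riesz_sequenceD(4,5)[OF rs', of "{i}" "\<lambda>_. 1"] by simp
  have "(l2_norm W (\<lambda>x. e n x - p * e m x))\<^sup>2 = 1 + (cmod p)\<^sup>2"
    using riesz_sequenceD(4,5)[OF rs', of "{n, m}" "\<lambda>i. if i = n then 1 else - p"] nm by simp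
  moreover have "(l2_norm W (\<lambda>x. e n x - p * e m x))\<^sup>2 = 1 - 2 * (cmod p)\<^sup>2 + (cmod p)\<^sup>2"
    by (simp add: l2_norm_diff_square e l2_scale l2_inner_scale_right p_def[symmetric] l2_norm_scale
        power_mult_distrib one complex_norm_square[symmetric] mult.commute[of "cnj p"] del: of_real_power)
  ultimately show ?thesis by (simp add: p_def)
qed

text \<open>
  The duality between frames and Riesz sequences in an orthonormal basis.
  
  A combination \<open>f\<close> of the \<open>e (r i)\<close> is orthogonal on the whole set to all \<open>e (k j)\<close>, so its restrictions to
  \<open>I\<close> and \<open>J\<close> have opposite coefficients there. The frame inequality on \<open>J\<close> therefore bounds \<open>f\<close> on \<open>J\<close> by
  \<open>f\<close> on \<open>I\<close>, which is the lower Riesz bound on \<open>I\<close>.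
  
  A function \<open>w\<close> supported in \<open>I\<close> has an expansion that vanishes on \<open>J\<close>, so on \<open>J\<close> its \<open>k\<close>-part is no larger
  than its \<open>r\<close>-part. By the lower Riesz bound on \<open>J\<close> the \<open>r\<close>-coefficients then carry a fixed share of
  \<open>\<parallel>w\<parallel>\<^sup>2\<close>, so subtracting the \<open>r\<close>-part reduces the norm of \<open>w\<close> on \<open>I\<close> by a fixed factor. This gives density.
\<close>

theorem riesz_basis_complement:
  fixes e :: "'n \<Rightarrow> 'a::euclidean_space \<Rightarrow> complex" and r :: "'i \<Rightarrow> 'n" and k :: "'j \<Rightarrow> 'n"
  assumes I: "I \<in> sets lebesgue" and J: "J \<in> sets lebesgue" and IJ: "I \<inter> J = {}"
    and onb: "riesz_basis (I \<union> J) e 1 1"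
    and r: "inj r" and k: "inj k" and rk: "range r \<inter> range k = {}" "range r \<union> range k = UNIV"
    and RJ: "riesz_basis J (\<lambda>j. e (k j)) A B"
  shows "\<exists>A' B'. riesz_basis I (\<lambda>i. e (r i)) A' B'"
proof -
  let ?W = "I \<union> J"
  have W: "?W \<in> sets lebesgue" using I J by simp
  note IW = I W Un_upper1 and JW = J W Un_upper2
  have os: "riesz_sequence ?W e 1 1" using onb by (simp add: riesz_basis_def)
  have js: "riesz_sequence J (\<lambda>j. e (k j)) A B" using RJ by (simp add: riesz_basis_def)
  note A = riesz_sequenceD(1)[OF js]
  note eW = riesz_sequenceD(3)[OF os]
  have eI: "e n \<in> l2_space I" and eJ: "e n \<in> l2_space J" for n
    using eW l2_restrict[OF IW] l2_restrict[OF JW] by auto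
  have split: "(l2_norm ?W f)\<^sup>2 = (l2_norm I f)\<^sup>2 + (l2_norm J f)\<^sup>2" if "f \<in> l2_space ?W" for f
    by (rule l2_norm_split[OF I J IJ that])
  have leI: "l2_norm I f \<le> l2_norm ?W f" and leJ: "l2_norm J f \<le> l2_norm ?W f" if "f \<in> l2_space ?W" for f
    by (rule power2_le_imp_le, use split[OF that] in simp, simp)+
  have norm_sub: "(l2_norm ?W (\<lambda>x. \<Sum>i\<in>F. c i * e (s i) x))\<^sup>2 = (\<Sum>i\<in>F. (cmod (c i))\<^sup>2)"
    if "finite F" "inj s" for F and c :: "'b \<Rightarrow> complex" and s :: "'b \<Rightarrow> 'n"
  proof -
    have *: "(\<Sum>n\<in>s ` F. h n) = (\<Sum>i\<in>F. h (s i))" for h :: "'n \<Rightarrow> complex"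
      using that by (subst sum.reindex) (auto simp: inj_on_def inj_def)
    have **: "(\<Sum>n\<in>s ` F. h n) = (\<Sum>i\<in>F. h (s i))" for h :: "'n \<Rightarrow> real"
      using that by (subst sum.reindex) (auto simp: inj_on_def inj_def)
    have i: "inv s (s i) = i" for i using that(2) by simp
    have "finite (s ` F)" using that(1) by simp
    from riesz_sequenceD(4,5)[OF os this, of "\<lambda>n. c (inv s n)"]
    show ?thesis unfolding * ** i by simp
  qed
  have lower: "A / (1 + A) * (\<Sum>i\<in>F. (cmod (c i))\<^sup>2) \<le> (l2_norm I (\<lambda>x. \<Sum>i\<in>F. c i * e (r i) x))\<^sup>2"
    if F: "finite F" for F and c :: "'i \<Rightarrow> complex"
  proof -
    define f where "f = (\<lambda>x. \<Sum>i\<in>F. c i * e (r i) x)"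
    have fW: "f \<in> l2_space ?W" unfolding f_def by (intro l2_lincomb eW)
    have fI: "f \<in> l2_space I" and fJ: "f \<in> l2_space J"
      using fW l2_restrict[OF IW] l2_restrict[OF JW] by auto
    let ?fI = "\<lambda>x. if x \<in> I then f x else 0"
    let ?fJ = "\<lambda>x. if x \<in> J then f x else 0"
    have fIW: "?fI \<in> l2_space ?W" and fJW: "?fJ \<in> l2_space ?W"
      using l2_zero_extension[OF IW fI] l2_zero_extension[OF JW fJ] by auto
    \<comment> \<open>On the whole set \<open>f\<close> is orthogonal to every \<open>e (k j)\<close>, so its two halves have opposite coefficients.\<close>
    have opp: "l2_inner J f (e (k j)) = - l2_inner I f (e (k j))" for j
    proof -
      have "l2_inner ?W f (e (k j)) = (\<Sum>i\<in>F. c i * l2_inner ?W (e (r i)) (e (k j)))"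
        unfolding f_def by (rule l2_inner_lincomb_left) (rule eW)+
      also have "\<dots> = 0" using rk(1) by (intro sum.neutral ballI) (auto intro!: riesz_basis_orthogonal[OF onb])
      finally have "0 = l2_inner ?W f (e (k j))" by simp
      also have "\<dots> = l2_inner ?W (\<lambda>x. ?fI x + ?fJ x) (e (k j))"
        using IJ by (intro l2_inner_cong) auto
      also have "\<dots> = l2_inner I f (e (k j)) + l2_inner J f (e (k j))"
        by (subst l2_inner_add_left[OF fIW fJW eW])
          (simp only: l2_inner_zero_extension[OF IW] l2_inner_zero_extension[OF JW])
      finally show ?thesis by (simp add: eq_neg_iff_add_eq_0 add.commute)
    qed
    have "A * (l2_norm J f)\<^sup>2 \<le> (\<Sum>\<^sub>\<infinity>j. (cmod (l2_inner J f (e (k j))))\<^sup>2)"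
      by (rule riesz_basis_frame_lower[OF RJ fJ])
    also have "\<dots> \<le> (l2_norm I f)\<^sup>2"
    proof (rule infsum_le_finite_sums[OF riesz_sequence_summable(1)[OF js fJ]])
      fix G :: "'j set" assume G: "finite G"
      have "(\<Sum>j\<in>G. (cmod (l2_inner J f (e (k j))))\<^sup>2) = (\<Sum>n\<in>k ` G. (cmod (l2_inner ?W ?fI (e n)))\<^sup>2)"
        using k by (subst sum.reindex) (auto simp: opp l2_inner_zero_extension[OF IW] inj_on_def inj_def)
      also have "\<dots> \<le> 1 * (l2_norm ?W ?fI)\<^sup>2"
        by (rule riesz_sequence_Bessel[OF os fIW]) (use G in simp)
      finally show "(\<Sum>j\<in>G. (cmod (l2_inner J f (e (k j))))\<^sup>2) \<le> (l2_norm I f)\<^sup>2"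
        by (simp add: l2_norm_zero_extension[OF IW])
    qed
    finally have "A * ((l2_norm I f)\<^sup>2 + (l2_norm J f)\<^sup>2) \<le> (1 + A) * (l2_norm I f)\<^sup>2"
      by (simp add: algebra_simps)
    then have "A * (\<Sum>i\<in>F. (cmod (c i))\<^sup>2) \<le> (1 + A) * (l2_norm I f)\<^sup>2"
      using split[OF fW] norm_sub[OF F r, of c] by (simp add: f_def)
    then show ?thesis using A unfolding f_def by (simp add: field_simps)
  qed
  have upper: "(l2_norm I (\<lambda>x. \<Sum>i\<in>F. c i * e (r i) x))\<^sup>2 \<le> 1 * (\<Sum>i\<in>F. (cmod (c i))\<^sup>2)"
    if F: "finite F" for F and c :: "'i \<Rightarrow> complex"
    using power_mono[OF leI[OF l2_lincomb[of "\<lambda>i. e (r i)" ?W c F, OF eW]] l2_norm_nonneg, of 2] norm_sub[OF F r, of c] by simp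
  have dense: "l2_space I \<subseteq> l2_closure I (lin_span (\<lambda>i. e (r i)))"
  proof -
    \<comment> \<open>Any positive \<open>\<eta>\<close> satisfying \<open>key\<close> would do.\<close>
    define \<eta> where "\<eta> = sqrt (A / (2 * A + 5))"
    have eta2: "\<eta>\<^sup>2 = A / (2 * A + 5)" using A by (simp add: \<eta>_def)
    have eta0: "0 < \<eta>" using A by (simp add: \<eta>_def)
    have eta1: "\<eta>\<^sup>2 < 1" using A by (simp add: eta2)
    have key: "\<eta>\<^sup>2 + (4 * \<eta>\<^sup>2) / A < 1 - \<eta>\<^sup>2"
    proof -
      have pos: "0 < 2 * A + 5" using A by simp
      have "\<eta>\<^sup>2 + (4 * \<eta>\<^sup>2) / A = (A + 4) / (2 * A + 5)" using A by (simp add: eta2 add_divide_distrib)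
      also have "\<dots> < (A + 5) / (2 * A + 5)" using pos by (intro divide_strict_right_mono) auto
      also have "\<dots> = 1 - \<eta>\<^sup>2" using pos by (simp add: eta2 field_simps)
      finally show ?thesis .
    qed
    show ?thesis
    proof (rule dense_by_contraction[of "\<lambda>i. e (r i)", OF eI, of "sqrt (1 - \<eta>\<^sup>2)"])
      fix w assume w: "w \<in> l2_space I"
      show "\<exists>s\<in>lin_span (\<lambda>i. e (r i)). l2_norm I (\<lambda>x. w x - s x) \<le> sqrt (1 - \<eta>\<^sup>2) * l2_norm I w"
      proof (cases "l2_norm I w = 0")
        case True
        then show ?thesis
          using lin_spanI[of "{}" "\<lambda>_. 0" "\<lambda>i. e (r i)"] by (intro bexI[of _ "\<lambda>x. 0"]) auto
      next
        case False
        define N where "N = l2_norm I w"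
        have N: "N > 0" using False l2_norm_nonneg[of I w] unfolding N_def by linarith
        let ?w = "\<lambda>x. if x \<in> I then w x else 0"
        have wW: "?w \<in> l2_space ?W" by (rule l2_zero_extension[OF IW w])
        have wN: "l2_norm ?W ?w = N" by (simp add: l2_norm_zero_extension[OF IW] N_def)
        define a where "a n = l2_inner ?W ?w (e n)" for n
        have aI: "a n = l2_inner I w (e n)" for n by (simp add: a_def l2_inner_zero_extension[OF IW])
        have "((\<lambda>n. (cmod (a n))\<^sup>2) has_sum N\<^sup>2) UNIV"
          using riesz_basis_Parseval[OF onb wW] by (simp add: a_def wN)
        then have "(sum (\<lambda>n. (cmod (a n))\<^sup>2) \<longlongrightarrow> N\<^sup>2) (finite_subsets_at_top UNIV)" by (simp add: has_sum_def)
        moreover have "N\<^sup>2 - \<eta>\<^sup>2 * N\<^sup>2 < N\<^sup>2" using N eta0 by simp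
        ultimately have "\<forall>\<^sub>F S in finite_subsets_at_top UNIV. N\<^sup>2 - \<eta>\<^sup>2 * N\<^sup>2 < (\<Sum>n\<in>S. (cmod (a n))\<^sup>2)"
          by (rule order_tendstoD(1))
        then obtain S where S: "finite S" "N\<^sup>2 - \<eta>\<^sup>2 * N\<^sup>2 < (\<Sum>n\<in>S. (cmod (a n))\<^sup>2)"
          by (auto simp: eventually_finite_subsets_at_top)
        define F where "F = r -` S"
        define G where "G = k -` S"
        have fin: "finite F" "finite G" unfolding F_def G_def using S(1) r k by (auto intro: finite_vimageI)
        have S_eq: "S = r ` F \<union> k ` G" using rk(2) by (auto simp: F_def G_def)
        have sumS: "(\<Sum>n\<in>S. h n) = (\<Sum>i\<in>F. h (r i)) + (\<Sum>j\<in>G. h (k j))" for h :: "'n \<Rightarrow> complex"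
          unfolding S_eq using fin rk(1) r k
          by (subst sum.union_disjoint) (auto simp: sum.reindex inj_on_def inj_def)
        have sumS': "(\<Sum>n\<in>S. h n) = (\<Sum>i\<in>F. h (r i)) + (\<Sum>j\<in>G. h (k j))" for h :: "'n \<Rightarrow> real"
          unfolding S_eq using fin rk(1) r k
          by (subst sum.union_disjoint) (auto simp: sum.reindex inj_on_def inj_def)
        define X where "X = (\<Sum>i\<in>F. (cmod (a (r i)))\<^sup>2)"
        define Y where "Y = (\<Sum>j\<in>G. (cmod (a (k j)))\<^sup>2)"
        have X0: "0 \<le> X" and Y0: "0 \<le> Y" by (auto simp: X_def Y_def intro: sum_nonneg)
        have XY: "(1 - \<eta>\<^sup>2) * N\<^sup>2 < X + Y" using S(2) sumS'[of "\<lambda>n. (cmod (a n))\<^sup>2"] by (simp add: X_def Y_def left_diff_distrib)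
        define s where "s = (\<lambda>x. \<Sum>i\<in>F. a (r i) * e (r i) x)"
        define t where "t = (\<lambda>x. \<Sum>j\<in>G. a (k j) * e (k j) x)"
        have s: "s \<in> l2_space ?W" and t: "t \<in> l2_space ?W" unfolding s_def t_def by (intro l2_lincomb eW)+
        have sJ: "s \<in> l2_space J" and tJ: "t \<in> l2_space J" using s t l2_restrict[OF JW] by auto
        have st: "(\<Sum>n\<in>S. a n * e n x) = s x + t x" for x by (simp add: s_def t_def sumS)
        \<comment> \<open>The expansion of \<open>w\<close> nearly vanishes on \<open>J\<close>, so there its two parts nearly cancel.\<close>
        have "(l2_norm ?W (\<lambda>x. ?w x - (s x + t x)))\<^sup>2 = N\<^sup>2 - (\<Sum>n\<in>S. (cmod (a n))\<^sup>2)"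
          using orthonormal_remainder[OF onb wW S(1)] by (simp only: a_def[symmetric] st wN)
        also have "\<dots> \<le> (\<eta> * N)\<^sup>2" using S(2) by (simp add: power_mult_distrib)
        finally have "l2_norm ?W (\<lambda>x. ?w x - (s x + t x)) \<le> \<eta> * N"
          by (rule power2_le_imp_le) (use eta0 N in simp)
        then have "l2_norm J (\<lambda>x. ?w x - (s x + t x)) \<le> \<eta> * N"
          using leJ[OF l2_diff[OF wW l2_add[OF s t]]] by linarith
        moreover have "l2_norm J (\<lambda>x. ?w x - (s x + t x)) = l2_norm J (\<lambda>x. s x + t x)"
        proof (rule l2_norm_cong)
          fix x assume "x \<in> J"
          then have "x \<notin> I" using IJ by auto
          then show "cmod (?w x - (s x + t x)) = cmod (s x + t x)" by (simp add: norm_minus_commute add.commute)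
        qed
        ultimately have stJ: "l2_norm J (\<lambda>x. s x + t x) \<le> \<eta> * N" by simp
        have "(l2_norm J s)\<^sup>2 \<le> X"
          using power_mono[OF leJ[OF s] l2_norm_nonneg, of 2] norm_sub[OF fin(1) r, of "\<lambda>i. a (r i)"]
          by (simp add: s_def X_def)
        then have sX: "l2_norm J s \<le> sqrt X" by (rule real_le_rsqrt)
        have "(\<lambda>x. (s x + t x) - s x) = t" by (simp add: fun_eq_iff)
        then have tn: "l2_norm J t \<le> \<eta> * N + sqrt X"
          using l2_norm_triangle_diff[OF l2_add[OF sJ tJ] sJ] stJ sX by simp
        have AY: "A * Y \<le> (l2_norm J t)\<^sup>2"
          using riesz_sequenceD(4)[OF js fin(2), of "\<lambda>j. a (k j)"] by (simp add: Y_def t_def)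
        have X_large: "(\<eta> * N)\<^sup>2 \<le> X"
        proof (rule ccontr)
          assume "\<not> ?thesis"
          then have X1: "X < (\<eta> * N)\<^sup>2" by simp
          then have "sqrt X \<le> \<eta> * N" using eta0 N by (intro real_le_lsqrt) auto
          then have "l2_norm J t \<le> 2 * (\<eta> * N)" using tn by simp
          then have "(l2_norm J t)\<^sup>2 \<le> (2 * (\<eta> * N))\<^sup>2" by (intro power_mono) auto
          then have "A * Y \<le> 4 * \<eta>\<^sup>2 * N\<^sup>2" using AY by (simp add: power_mult_distrib)
          then have "Y \<le> (4 * \<eta>\<^sup>2) / A * N\<^sup>2" using A by (simp add: field_simps)
          then have "(1 - \<eta>\<^sup>2) * N\<^sup>2 < \<eta>\<^sup>2 * N\<^sup>2 + (4 * \<eta>\<^sup>2) / A * N\<^sup>2"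
            using XY X1 by (simp add: power_mult_distrib)
          also have "\<dots> = (\<eta>\<^sup>2 + (4 * \<eta>\<^sup>2) / A) * N\<^sup>2" by (simp add: distrib_right)
          also have "\<dots> \<le> (1 - \<eta>\<^sup>2) * N\<^sup>2" using key by (intro mult_right_mono) auto
          finally show False by simp
        qed
        have sI: "s \<in> l2_space I" using s l2_restrict[OF IW] by auto
        have "l2_inner I w s = of_real X"
          unfolding s_def X_def
          by (subst l2_inner_lincomb_right[of "\<lambda>i. e (r i)", OF eI w])
            (simp add: aI[symmetric] complex_norm_square[symmetric] mult.commute[of "cnj _"] del: of_real_power)
        moreover have "(l2_norm I s)\<^sup>2 \<le> X" using upper[OF fin(1), of "\<lambda>i. a (r i)"] by (simp add: s_def X_def)
        ultimately have "(l2_norm I (\<lambda>x. w x - s x))\<^sup>2 \<le> N\<^sup>2 - X"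
          using l2_norm_diff_square[OF w sI] by (simp add: N_def)
        also have "\<dots> \<le> (sqrt (1 - \<eta>\<^sup>2) * N)\<^sup>2" using X_large eta1 by (simp add: power_mult_distrib left_diff_distrib)
        finally have "l2_norm I (\<lambda>x. w x - s x) \<le> sqrt (1 - \<eta>\<^sup>2) * N"
          by (rule power2_le_imp_le) (use eta1 N in simp)
        then show ?thesis using lin_spanI[OF fin(1), of "\<lambda>i. a (r i)" "\<lambda>i. e (r i)"] by (auto simp: s_def N_def)
      qed
    qed (use eta0 eta1 in auto)
  qed
  have "riesz_basis I (\<lambda>i. e (r i)) (A / (1 + A)) 1"
    unfolding riesz_basis_def riesz_sequence_def
    using lower upper dense A eI by (intro conjI allI impI) auto
  then show ?thesis by blast
qed

section \<open>Rounded frequencies in dimension one\<close>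

lemma osc_scale: "osc l (c * x) = osc (c * l) x"
  by (simp add: osc_def mult_ac)

text \<open>
  With \<open>\<alpha> = 1 / \<beta>\<close>, membership of \<open>m\<close> in the range of the rounded multiples of \<open>\<beta>\<close> becomes the presence of
  an integer in an interval of length \<open>\<alpha>\<close>; the next lemma does the same for the complementary sequence.
\<close>

lemma round_preimage:
  fixes \<alpha> \<beta> :: real
  assumes b: "0 < \<beta>" and a: "\<alpha> * \<beta> = 1"
  shows "round (\<beta> * of_int n) = m \<longleftrightarrow> \<alpha> * (of_int m - 1 / 2) \<le> of_int n \<and> of_int n < \<alpha> * (of_int m + 1 / 2)"
proof -
  have a0: "0 < \<alpha>" using a b by (metis zero_less_mult_pos2 zero_less_one)
  have n: "of_int n = \<alpha> * (\<beta> * of_int n)" using a by (simp add: mult.assoc[symmetric])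
  have "round (\<beta> * of_int n) = m \<longleftrightarrow> of_int m - 1 / 2 \<le> \<beta> * of_int n \<and> \<beta> * of_int n < of_int m + 1 / 2"
    unfolding round_def floor_eq_iff by auto
  also have "\<dots> \<longleftrightarrow> \<alpha> * (of_int m - 1 / 2) \<le> of_int n \<and> of_int n < \<alpha> * (of_int m + 1 / 2)"
    using a0 by (subst (3 4) n) (simp only: mult_le_cancel_left_pos mult_less_cancel_left_pos)
  finally show ?thesis .
qed

lemma shifted_ceiling_preimage:
  fixes \<alpha> \<gamma> :: real
  assumes g: "0 < \<gamma>" and ag: "(1 - \<alpha>) * \<gamma> = 1"
  shows "\<lceil>\<gamma> * (of_int n - 1 / 2) - 1 / 2\<rceil> = m \<longleftrightarrow>
    \<alpha> * (of_int m + 1 / 2) - 1 \<le> of_int (m - n) \<and> of_int (m - n) < \<alpha> * (of_int m - 1 / 2)"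
proof -
  have a0: "0 < 1 - \<alpha>" using ag g by (metis zero_less_mult_pos2 zero_less_one)
  have n: "of_int n - 1 / 2 = (1 - \<alpha>) * (\<gamma> * (of_int n - 1 / 2))" using ag by (simp add: mult.assoc[symmetric])
  have "\<lceil>\<gamma> * (of_int n - 1 / 2) - 1 / 2\<rceil> = m \<longleftrightarrow>
      of_int m - 1 / 2 < \<gamma> * (of_int n - 1 / 2) \<and> \<gamma> * (of_int n - 1 / 2) \<le> of_int m + 1 / 2"
    unfolding ceiling_eq_iff by auto
  also have "\<dots> \<longleftrightarrow> (1 - \<alpha>) * (of_int m - 1 / 2) < of_int n - 1 / 2 \<and> of_int n - 1 / 2 \<le> (1 - \<alpha>) * (of_int m + 1 / 2)"
    using a0 by (subst (3 4) n) (simp only: mult_le_cancel_left_pos mult_less_cancel_left_pos)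
  also have "\<dots> \<longleftrightarrow> \<alpha> * (of_int m + 1 / 2) - 1 \<le> of_int (m - n) \<and> of_int (m - n) < \<alpha> * (of_int m - 1 / 2)"
    unfolding left_diff_distrib[of 1 \<alpha>] mult_1_left of_int_diff by (safe; linarith)
  finally show ?thesis .
qed

text \<open>
  A Beatty theorem for rounding. Put \<open>\<alpha> = 1 / \<beta>\<close>. The interval \<open>[\<alpha> (m + 1/2) - 1, \<alpha> (m + 1/2))\<close> contains
  exactly one integer \<open>z\<close>, and the point \<open>\<alpha> (m - 1/2)\<close> divides it. If \<open>z\<close> lies on the right, then \<open>m = r z\<close>;
  if it lies on the left, then \<open>m = k (m - z)\<close>.
\<close>

theorem beatty_partition:
  fixes \<beta> \<gamma> :: real
  assumes b: "1 < \<beta>" and g: "1 < \<gamma>" and bg: "1 / \<beta> + 1 / \<gamma> = 1"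
  defines "r \<equiv> \<lambda>n::int. round (\<beta> * of_int n)" and "k \<equiv> \<lambda>n::int. \<lceil>\<gamma> * (of_int n - 1 / 2) - 1 / 2\<rceil>"
  shows "inj r" "inj k" "range r \<inter> range k = {}" "range r \<union> range k = UNIV"
proof -
  define \<alpha> where "\<alpha> = 1 / \<beta>"
  have a: "0 < \<alpha>" "\<alpha> < 1" using b by (auto simp: \<alpha>_def)
  have ab: "\<alpha> * \<beta> = 1" using b by (simp add: \<alpha>_def)
  have "1 - \<alpha> = 1 / \<gamma>" using bg by (simp add: \<alpha>_def)
  then have ag: "(1 - \<alpha>) * \<gamma> = 1" using g by simp
  have r_iff: "r n = m \<longleftrightarrow> \<alpha> * (of_int m - 1 / 2) \<le> of_int n \<and> of_int n < \<alpha> * (of_int m + 1 / 2)" for n m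
    unfolding r_def by (rule round_preimage) (use b ab in auto)
  have k_iff: "k n = m \<longleftrightarrow>
      \<alpha> * (of_int m + 1 / 2) - 1 \<le> of_int (m - n) \<and> of_int (m - n) < \<alpha> * (of_int m - 1 / 2)" for n m
    unfolding k_def by (rule shifted_ceiling_preimage) (use g ag in auto)
  have step: "\<alpha> * (of_int m + 1 / 2) = \<alpha> * (of_int m - 1 / 2) + \<alpha>" for m :: int
    by (simp add: algebra_simps)
  show "inj r"
  proof (rule injI)
    fix n n' assume eq: "r n = r n'"
    have "\<alpha> * (of_int (r n) - 1 / 2) \<le> of_int n" "of_int n < \<alpha> * (of_int (r n) + 1 / 2)"
        "\<alpha> * (of_int (r n) - 1 / 2) \<le> of_int n'" "of_int n' < \<alpha> * (of_int (r n) + 1 / 2)"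
      using r_iff[of n "r n"] r_iff[of n' "r n"] eq by auto
    then have "\<bar>real_of_int n - of_int n'\<bar> < 1" using step[of "r n"] a(2) by linarith
    then show "n = n'" by linarith
  qed
  show "inj k"
  proof (rule injI)
    fix n n' assume eq: "k n = k n'"
    let ?m = "k n"
    have "\<alpha> * (of_int ?m + 1 / 2) - 1 \<le> of_int (?m - n)" "of_int (?m - n) < \<alpha> * (of_int ?m - 1 / 2)"
        "\<alpha> * (of_int ?m + 1 / 2) - 1 \<le> of_int (?m - n')" "of_int (?m - n') < \<alpha> * (of_int ?m - 1 / 2)"
      using k_iff[of n ?m] k_iff[of n' ?m] eq by auto
    then have "\<bar>real_of_int (?m - n) - of_int (?m - n')\<bar> < 1" using step[of ?m] a by linarith
    then show "n = n'" by linarith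
  qed
  show "range r \<inter> range k = {}"
  proof -
    have False if "r n = m" "k n' = m" for n n' m
    proof -
      have "\<alpha> * (of_int m - 1 / 2) \<le> of_int n" "of_int n < \<alpha> * (of_int m + 1 / 2)"
        "\<alpha> * (of_int m + 1 / 2) - 1 \<le> of_int (m - n')" "of_int (m - n') < \<alpha> * (of_int m - 1 / 2)"
        using that r_iff k_iff by blast+
      then have "real_of_int (m - n') < of_int n" "of_int n < real_of_int (m - n' + 1)" by linarith+
      then show False unfolding of_int_less_iff by linarith
    qed
    then show ?thesis by fastforce
  qed
  have "m \<in> range r \<union> range k" for m
  proof -
    define z where "z = \<lceil>\<alpha> * (of_int m + 1 / 2)\<rceil> - 1"
    have z: "\<alpha> * (of_int m + 1 / 2) - 1 \<le> of_int z" "of_int z < \<alpha> * (of_int m + 1 / 2)"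
      unfolding z_def by linarith+
    show ?thesis
    proof (cases "\<alpha> * (of_int m - 1 / 2) \<le> of_int z")
      case True
      then have "r z = m" using z r_iff by blast
      then show ?thesis by (metis UnI1 rangeI)
    next
      case False
      then have "k (m - z) = m" using z k_iff[of "m - z" m] by simp
      then show ?thesis by (metis UnI2 rangeI)
    qed
  qed
  then show "range r \<union> range k = UNIV" by blast
qed

lemma kadec_interval:
  fixes s h \<theta> :: real and \<delta> :: "int \<Rightarrow> real"
  assumes l: "0 < h" and L: "L < 1 / 4" "\<And>n. \<bar>\<delta> n\<bar> \<le> L"
  shows "\<exists>A B. riesz_basis {s..<s + h} (\<lambda>n. osc ((of_int n + \<delta> n + \<theta>) / h)) A B"
proof -
  obtain A B where R: "riesz_basis unit_window (\<lambda>n. osc (of_int n + \<delta> n)) A B"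
    using kadec[of L \<delta>] L by blast
  define t where "t = - (1 / 2) - s / h"
  have c: "change_of_variable {s..<s + h} unit_window (\<lambda>x. t + (1 / h) * x) (1 / (1 / h))"
    using change_of_variable_affine[of "1 / h" s "s + h" t] l by (simp add: t_def add_divide_distrib)
  have "riesz_basis {s..<s + h} (\<lambda>n. osc ((of_int n + \<delta> n + \<theta>) / h)) (1 / (1 / h) * A) (1 / (1 / h) * B)"
  proof (rule riesz_basis_transfer[OF c R, of "\<lambda>x. osc \<theta> (t + (1 / h) * x)" "\<lambda>n. osc (of_int n + \<delta> n + \<theta>) (- t)"])
    show "(\<lambda>x. osc \<theta> (t + (1 / h) * x)) \<in> borel_measurable (lebesgue_on {s..<s + h})"
      by (intro measurable_restrict_space1 measurable_completion) simp
    fix n x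
    let ?l = "of_int n + \<delta> n + \<theta>" and ?y = "t + (1 / h) * x"
    have "osc (?l / h) x = osc ?l (- t + ?y)"
      by (simp add: osc_scale osc_def)
    also have "\<dots> = osc ?l (- t) * osc ?l ?y" by (rule osc_add_right)
    also have "osc ?l ?y = osc \<theta> ?y * osc (of_int n + \<delta> n) ?y"
      unfolding osc_mult by (simp only: add.commute)
    finally show "osc ((of_int n + \<delta> n + \<theta>) / h) x = osc (of_int n + \<delta> n + \<theta>) (- t)
        * (osc \<theta> (t + (1 / h) * x) * osc (of_int n + \<delta> n) (t + (1 / h) * x))" .
  qed simp_all
  then show ?thesis by blast
qed

lemma trig_unit_interval: "riesz_basis {0..<1} (\<lambda>n::int. osc (of_int n)) 1 1"
proof -
  have c: "change_of_variable {0..<1} unit_window (\<lambda>x. - (1 / 2) + 1 * x) (1 / 1)"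
    using change_of_variable_affine[of 1 0 1 "- (1 / 2)"] by simp
  have "riesz_basis {0..<1} (\<lambda>n::int. osc (of_int n)) (1 / 1 * 1) (1 / 1 * 1)"
  proof (rule riesz_basis_transfer[OF c trig_riesz_basis, of "\<lambda>x. 1" "\<lambda>n. osc (of_int n) (1 / 2)"])
    show "osc (of_int n) x = osc (of_int n) (1 / 2) * (1 * osc (of_int n) (- (1 / 2) + 1 * x))" for n :: int and x
      unfolding mult_1 osc_add_right[symmetric] by simp
  qed simp_all
  then show ?thesis by simp
qed

text \<open>
  The frequencies are \<open>n + \<delta> n\<close> with \<open>|\<delta> n| \<le> 1 / (2 \<beta>)\<close>, and \<open>\<delta> = 0\<close> for \<open>\<beta> \<in> {1, 2}\<close>, so Kadec's theorem applies
  for these \<open>\<beta>\<close> and for all \<open>\<beta> > 2\<close>. For \<open>1 < \<beta> < 2\<close> the bound exceeds \<open>1/4\<close>. Then rescale to the integer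
  frequencies \<open>r n = round (\<beta> n)\<close> on \<open>[0, 1/\<beta>)\<close>. The complementary integers are the multiples of
  \<open>\<gamma> = \<beta> / (\<beta> - 1)\<close>, shifted and rounded; on the complementary interval of length \<open>1 / \<gamma>\<close> they deviate from
  an orthonormal system by at most \<open>1 / (2 \<gamma>) < 1/4\<close>, and \<open>riesz_basis_complement\<close> returns to \<open>r\<close>.
\<close>

theorem rounded_frequencies_basis:
  assumes b: "1 \<le> \<beta>"
  shows "\<exists>A B. riesz_basis {0..<1} (\<lambda>n. osc (of_int (round (\<beta> * of_int n)) / \<beta>)) A B"
proof -
  define \<delta> where "\<delta> n = of_int (round (\<beta> * of_int n)) / \<beta> - of_int n" for n :: int
  have d: "\<bar>\<delta> n\<bar> \<le> 1 / (2 * \<beta>)" for n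
  proof -
    have "\<delta> n = (of_int (round (\<beta> * of_int n)) - \<beta> * of_int n) / \<beta>" using b by (simp add: \<delta>_def field_simps)
    then have "\<bar>\<delta> n\<bar> = \<bar>of_int (round (\<beta> * of_int n)) - \<beta> * of_int n\<bar> / \<beta>" using b by simp
    also have "\<dots> \<le> (1 / 2) / \<beta>" using b by (intro divide_right_mono of_int_round_abs_le) auto
    finally show ?thesis by simp
  qed
  have direct: ?thesis if "L < 1 / 4" "\<And>n. \<bar>\<delta> n\<bar> \<le> L" for L
  proof -
    have "\<exists>A B. riesz_basis {0..<0 + 1} (\<lambda>n. osc ((of_int n + \<delta> n + 0) / 1)) A B"
      by (rule kadec_interval[OF _ that]) simp
    then show ?thesis by (simp add: \<delta>_def)
  qed
  consider "\<beta> = 1 \<or> \<beta> = 2" | "\<beta> > 2" | "1 < \<beta>" "\<beta> < 2" using b by linarith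
  then show ?thesis
  proof cases
    case 1
    have "\<delta> n = 0" for n
    proof -
      have "\<beta> * of_int n = of_int (\<lfloor>\<beta>\<rfloor> * n)" using 1 by auto
      then have "of_int (round (\<beta> * of_int n)) = \<beta> * of_int n" by (metis round_of_int)
      then show ?thesis using b by (simp add: \<delta>_def)
    qed
    then show ?thesis by (intro direct[of 0]) auto
  next
    case 2
    then have "1 / (2 * \<beta>) < 1 / 4" by (simp add: field_simps)
    then show ?thesis by (rule direct) (rule d)
  next
    case 3
    define \<gamma> where "\<gamma> = \<beta> / (\<beta> - 1)"
    have g: "2 < \<gamma>" using 3 by (simp add: \<gamma>_def field_simps)
    have bg: "1 / \<beta> + 1 / \<gamma> = 1" using 3 by (simp add: \<gamma>_def field_simps)
    define r where "r n = round (\<beta> * of_int n)" for n :: int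
    define k where "k n = \<lceil>\<gamma> * (of_int n - 1 / 2) - 1 / 2\<rceil>" for n :: int
    have part: "inj r" "inj k" "range r \<inter> range k = {}" "range r \<union> range k = UNIV"
      unfolding r_def k_def using beatty_partition[of \<beta> \<gamma>] 3 g bg by auto
    let ?I = "{0..<1 / \<beta>}" and ?J = "{1 / \<beta>..<1 / \<beta> + 1 / \<gamma>}"
    define \<epsilon> where "\<epsilon> n = of_int (k n) / \<gamma> - of_int n + 1 / 2" for n
    have e: "\<bar>\<epsilon> n\<bar> \<le> 1 / (2 * \<gamma>)" for n
    proof -
      have "\<epsilon> n = (of_int (k n) - \<gamma> * (of_int n - 1 / 2)) / \<gamma>" using g by (simp add: \<epsilon>_def field_simps)
      then have "\<bar>\<epsilon> n\<bar> = \<bar>of_int (k n) - \<gamma> * (of_int n - 1 / 2)\<bar> / \<gamma>" using g by simp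
      also have "\<dots> \<le> (1 / 2) / \<gamma>" using g unfolding k_def by (intro divide_right_mono) linarith+
      finally show ?thesis by simp
    qed
    have "1 / (2 * \<gamma>) < 1 / 4" using g by (simp add: field_simps)
    then have "\<exists>A B. riesz_basis ?J (\<lambda>n. osc ((of_int n + \<epsilon> n + - (1 / 2)) / (1 / \<gamma>))) A B"
      by (rule kadec_interval[rotated]) (use e g in auto)
    then obtain A B where "riesz_basis ?J (\<lambda>n. osc ((of_int n + \<epsilon> n + - (1 / 2)) / (1 / \<gamma>))) A B"
      by blast
    then have RJ: "riesz_basis ?J (\<lambda>n. osc (of_int (k n))) A B" using g by (simp add: \<epsilon>_def)
    have IJ: "?I \<union> ?J = {0..<1}" "?I \<inter> ?J = {}"
    proof -
      have "0 < 1 / \<beta>" "1 / \<beta> < 1" using 3 by simp_all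
      moreover have "{0..<c} \<union> {c..<1} = {0..<1}" "{0..<c} \<inter> {c..<1} = {}" if "0 < c" "c < 1" for c :: real
        using that by auto
      ultimately show "?I \<union> ?J = {0..<1}" "?I \<inter> ?J = {}" unfolding bg by blast+
    qed
    have "\<exists>A B. riesz_basis ?I (\<lambda>n. osc (of_int (r n))) A B"
      using riesz_basis_complement[of ?I ?J "\<lambda>n. osc (of_int n)" r k, OF _ _ IJ(2) _ part RJ]
        trig_unit_interval IJ(1) by auto
    then obtain A' B' where RI: "riesz_basis ?I (\<lambda>n. osc (of_int (r n))) A' B'" by blast
    have c: "change_of_variable {0..<1} ?I (\<lambda>x. 0 + (1 / \<beta>) * x) (1 / (1 / \<beta>))"
      using change_of_variable_affine[of "1 / \<beta>" 0 1 0] b by simp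
    have "riesz_basis {0..<1} (\<lambda>n. osc (of_int (r n) / \<beta>)) (1 / (1 / \<beta>) * A') (1 / (1 / \<beta>) * B')"
      by (rule riesz_basis_transfer[OF c RI, of "\<lambda>x. 1" "\<lambda>n. 1"]) (auto simp: osc_scale osc_def)
    then show ?thesis unfolding r_def by blast
  qed
qed

section \<open>Tensor products of Riesz bases\<close>

lemma lborel_integral_prod_coordinates:
  fixes g :: "'d::finite \<Rightarrow> real \<Rightarrow> complex"
  assumes g: "\<And>k. integrable lborel (g k)"
  shows "(LINT x|lborel. (\<Prod>k\<in>UNIV. g k ((x :: real ^ 'd) $ k))) = (\<Prod>k\<in>UNIV. (LINT t|lborel. g k t))"
proof -
  interpret product_sigma_finite "\<lambda>_::real ^ 'd. lborel :: real measure" by standard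
  let ?e = "\<lambda>k. axis k 1 :: real ^ 'd"
  have basis: "(Basis :: (real ^ 'd) set) = range ?e" by (auto simp: Basis_vec_def)
  have inj: "inj ?e" by (auto simp: inj_def axis_eq_axis)
  have gm [measurable]: "g k \<in> borel_measurable borel" for k
    using borel_measurable_integrable[OF g[of k]] by simp
  have coord: "(\<Sum>b\<in>Basis. f b *\<^sub>R b) $ k = f (?e k)" for f :: "real ^ 'd \<Rightarrow> real" and k
  proof -
    have "(\<Sum>b\<in>Basis. f b *\<^sub>R b) $ k = (\<Sum>j\<in>UNIV. f (?e j) * (?e j $ k))"
      unfolding basis by (subst sum.reindex[OF inj]) simp
    also have "\<dots> = (\<Sum>j\<in>UNIV. if j = k then f (?e j) else 0)"
      by (intro sum.cong) (auto simp: axis_def)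
    finally show ?thesis by simp
  qed
  have "(LINT x|lborel. (\<Prod>k\<in>UNIV. g k ((x :: real ^ 'd) $ k)))
      = (LINT f|(\<Pi>\<^sub>M b\<in>Basis. lborel). (\<Prod>k\<in>UNIV. g k ((\<Sum>b\<in>Basis. f b *\<^sub>R b :: real ^ 'd) $ k)))"
    by (subst lborel_eq, subst integral_distr) simp_all
  also have "\<dots> = (LINT f|(\<Pi>\<^sub>M b\<in>Basis. lborel). (\<Prod>b\<in>Basis. g (inv ?e b) (f b)))"
    unfolding coord unfolding basis by (subst prod.reindex[OF inj]) (simp add: inv_f_f[OF inj])
  also have "\<dots> = (\<Prod>b\<in>(Basis :: (real ^ 'd) set). (LINT t|lborel. g (inv ?e b) t))"
    by (rule product_integral_prod) (auto intro: g)
  also have "\<dots> = (\<Prod>k\<in>UNIV. (LINT t|lborel. g k t))"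
    unfolding basis by (subst prod.reindex[OF inj]) (simp add: inv_f_f[OF inj])
  finally show ?thesis .
qed

definition bounded_borel :: "(real \<Rightarrow> complex) \<Rightarrow> bool" where
  "bounded_borel h \<longleftrightarrow> h \<in> borel_measurable borel \<and> (\<exists>C. \<forall>t. cmod (h t) \<le> C)"

lemma half_open_cube_borel: "(half_open_cube :: (real ^ 'd::finite) set) \<in> sets borel"
proof -
  have "half_open_cube = (\<Inter>k. (\<lambda>x :: real ^ 'd. x $ k) -` {0..<1})" by (auto simp: half_open_cube_def)
  moreover have "(\<lambda>x :: real ^ 'd. x $ k) -` {0..<1} \<in> sets borel" for k
    by (rule measurable_sets_borel[of _ borel]) (auto intro: borel_measurable_continuous_onI continuous_intros)
  ultimately show ?thesis by (metis (no_types, lifting) UNIV_not_empty finite sets.finite_INT)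
qed

lemma half_open_cube_lmeasurable: "(half_open_cube :: (real ^ 'd::finite) set) \<in> lmeasurable"
proof (rule bounded_set_imp_lmeasurable)
  have "half_open_cube \<subseteq> cbox 0 (\<chi> k. 1 :: real ^ 'd)"
    by (simp add: subset_iff half_open_cube_def mem_box_cart less_imp_le)
  then show "bounded (half_open_cube :: (real ^ 'd) set)" by (rule bounded_subset[OF bounded_cbox])
  show "(half_open_cube :: (real ^ 'd) set) \<in> sets lebesgue"
    by (rule sets_completionI_sets) (simp add: half_open_cube_borel)
qed

lemma bounded_borel_measurable_on: "bounded_borel h \<Longrightarrow> h \<in> borel_measurable (lebesgue_on D)"
  by (intro measurable_restrict_space1 measurable_completion) (simp add: bounded_borel_def)

lemma unit_interval_lmeasurable: "{0..<1::real} \<in> lmeasurable"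
  by (simp add: fmeasurable_def)

lemma bounded_borel_l2:
  assumes "bounded_borel h"
  shows "h \<in> l2_space {0..<1}"
proof -
  obtain C where C: "\<And>t. cmod (h t) \<le> C" using assms by (auto simp: bounded_borel_def)
  show ?thesis
    by (rule l2_space_bounded[OF unit_interval_lmeasurable bounded_borel_measurable_on[OF assms] C])
qed

lemma bounded_borel_const_mult:
  assumes "bounded_borel h"
  shows "bounded_borel (\<lambda>t. c * h t)"
proof -
  obtain C where C: "\<And>t. cmod (h t) \<le> C" using assms by (auto simp: bounded_borel_def)
  have "cmod (c * h t) \<le> cmod c * C" for t using C by (simp add: norm_mult mult_left_mono)
  then show ?thesis using assms by (auto simp: bounded_borel_def)
qed

lemma bounded_borel_add:
  assumes "bounded_borel g" "bounded_borel h"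
  shows "bounded_borel (\<lambda>t. g t + h t)"
proof -
  obtain C C' where "\<forall>t. cmod (g t) \<le> C" "\<forall>t. cmod (h t) \<le> C'" using assms by (auto simp: bounded_borel_def)
  then have "cmod (g t + h t) \<le> C + C'" for t using norm_triangle_mono by blast
  then show ?thesis using assms by (auto simp: bounded_borel_def)
qed

lemma bounded_borel_diff:
  assumes "bounded_borel g" "bounded_borel h"
  shows "bounded_borel (\<lambda>t. g t - h t)"
  using bounded_borel_add[OF assms(1) bounded_borel_const_mult[OF assms(2), of "-1"]] by simp

lemma bounded_borel_lincomb:
  assumes "\<And>n. bounded_borel (v n)"
  shows "bounded_borel (\<lambda>t. \<Sum>n\<in>F. c n * v n t)"
proof (induction F rule: infinite_finite_induct)
  case (insert n F)
  then show ?case using bounded_borel_add[OF bounded_borel_const_mult[OF assms]] by simp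
qed (auto simp: bounded_borel_def)

lemma prod_coordinates_l2:
  fixes h :: "'d::finite \<Rightarrow> real \<Rightarrow> complex"
  assumes h: "\<And>k. bounded_borel (h k)"
  shows "(\<lambda>x :: real ^ 'd. \<Prod>k\<in>UNIV. h k (x $ k)) \<in> l2_space half_open_cube"
proof -
  obtain C where C: "\<And>k t. cmod (h k t) \<le> C k" using h unfolding bounded_borel_def by metis
  have hm: "h k \<in> borel_measurable borel" for k using h by (simp add: bounded_borel_def)
  have nth: "(\<lambda>x :: real ^ 'd. x $ k) \<in> borel_measurable borel" for k
    by (intro borel_measurable_continuous_onI continuous_intros)
  have "(\<lambda>x :: real ^ 'd. \<Prod>k\<in>UNIV. h k (x $ k)) \<in> borel_measurable borel"
    by (intro borel_measurable_prod measurable_compose[OF nth hm])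
  then have "(\<lambda>x :: real ^ 'd. \<Prod>k\<in>UNIV. h k (x $ k)) \<in> borel_measurable (lebesgue_on half_open_cube)"
    by (intro measurable_restrict_space1 measurable_completion) simp
  then show ?thesis
    by (rule l2_space_bounded[OF half_open_cube_lmeasurable, where B = "\<Prod>k\<in>UNIV. C k"])
      (auto simp: prod_norm[symmetric] intro!: prod_mono C)
qed

lemma prod_coordinates_inner:
  fixes f g :: "'d::finite \<Rightarrow> real \<Rightarrow> complex"
  assumes f: "\<And>k. bounded_borel (f k)" and g: "\<And>k. bounded_borel (g k)"
  shows "l2_inner half_open_cube (\<lambda>x :: real ^ 'd. \<Prod>k\<in>UNIV. f k (x $ k)) (\<lambda>x. \<Prod>k\<in>UNIV. g k (x $ k))
       = (\<Prod>k\<in>UNIV. l2_inner {0..<1} (f k) (g k))"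
proof -
  define p where "p k t = indicator {0..<1} t *\<^sub>R (f k t * cnj (g k t))" for k t
  have fm [measurable]: "f k \<in> borel_measurable borel" and gm [measurable]: "g k \<in> borel_measurable borel" for k
    using f g by (auto simp: bounded_borel_def)
  have cnjm [measurable]: "cnj \<in> borel_measurable borel"
    by (intro borel_measurable_continuous_onI continuous_intros)
  have cg [measurable]: "(\<lambda>t. cnj (g k t)) \<in> borel_measurable borel" for k
    by (rule measurable_compose[OF gm cnjm])
  have pm [measurable]: "p k \<in> borel_measurable borel" for k unfolding p_def by measurable
  have nth [measurable]: "(\<lambda>x :: real ^ 'd. x $ k) \<in> borel_measurable borel" for k
    by (intro borel_measurable_continuous_onI continuous_intros)
  have int: "integrable lborel (p k)" for k
  proof -
    have "integrable (lebesgue_on {0..<1}) (\<lambda>t. f k t * cnj (g k t))"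
      by (intro l2_prod_integrable bounded_borel_l2 f g)
    then have "integrable lebesgue (p k)" unfolding p_def by (subst (asm) integrable_restrict_space) auto
    then show ?thesis by (subst (asm) integrable_completion) auto
  qed
  have one: "l2_inner {0..<1} (f k) (g k) = (LINT t|lborel. p k t)" for k
  proof -
    have "l2_inner {0..<1} (f k) (g k) = (LINT t|lebesgue. p k t)"
      unfolding l2_inner_def p_def by (subst integral_restrict_space) auto
    then show ?thesis by (subst (asm) integral_completion) auto
  qed
  have ind: "(\<Prod>k\<in>UNIV. p k (x $ k)) = indicator half_open_cube x *\<^sub>R
      ((\<Prod>k\<in>UNIV. f k (x $ k)) * cnj (\<Prod>k\<in>UNIV. g k (x $ k)))" for x :: "real ^ 'd"
  proof (cases "x \<in> half_open_cube")
    case True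
    then show ?thesis by (simp add: p_def half_open_cube_def prod.distrib)
  next
    case False
    then obtain k where "x $ k \<notin> {0..<1}" by (auto simp: half_open_cube_def)
    then have "p k (x $ k) = 0" by (simp add: p_def)
    then have "(\<Prod>k\<in>UNIV. p k (x $ k)) = 0" by (intro prod_zero) auto
    then show ?thesis using False by simp
  qed
  have "l2_inner half_open_cube (\<lambda>x :: real ^ 'd. \<Prod>k\<in>UNIV. f k (x $ k)) (\<lambda>x. \<Prod>k\<in>UNIV. g k (x $ k))
      = (LINT x|lebesgue. (\<Prod>k\<in>UNIV. p k ((x :: real ^ 'd) $ k)))"
    unfolding l2_inner_def ind using half_open_cube_borel by (subst integral_restrict_space) auto
  also have "\<dots> = (LINT x|lborel. (\<Prod>k\<in>UNIV. p k ((x :: real ^ 'd) $ k)))"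
    by (rule integral_completion) measurable
  also have "\<dots> = (\<Prod>k\<in>UNIV. LINT t|lborel. p k t)" by (rule lborel_integral_prod_coordinates[OF int])
  finally show ?thesis by (simp add: one)
qed

lemma prod_coordinates_norm:
  fixes h :: "'d::finite \<Rightarrow> real \<Rightarrow> complex"
  assumes h: "\<And>k. bounded_borel (h k)"
  shows "l2_norm half_open_cube (\<lambda>x :: real ^ 'd. \<Prod>k\<in>UNIV. h k (x $ k)) = (\<Prod>k\<in>UNIV. l2_norm {0..<1} (h k))"
proof -
  have "complex_of_real ((l2_norm half_open_cube (\<lambda>x :: real ^ 'd. \<Prod>k\<in>UNIV. h k (x $ k)))\<^sup>2)
      = of_real ((\<Prod>k\<in>UNIV. l2_norm {0..<1} (h k))\<^sup>2)"
    using prod_coordinates_inner[of h h, OF h h] unfolding l2_inner_self by (simp add: prod_power_distrib)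
  then have "(l2_norm half_open_cube (\<lambda>x :: real ^ 'd. \<Prod>k\<in>UNIV. h k (x $ k)))\<^sup>2
      = (\<Prod>k\<in>UNIV. l2_norm {0..<1} (h k))\<^sup>2" by (simp only: of_real_eq_iff)
  then show ?thesis by (simp add: prod_nonneg)
qed

definition kernel_form :: "('i \<Rightarrow> 'i \<Rightarrow> complex) \<Rightarrow> 'i set \<Rightarrow> ('i \<Rightarrow> complex) \<Rightarrow> complex" where
  "kernel_form H F c = (\<Sum>x\<in>F. \<Sum>y\<in>F. c x * cnj (c y) * H x y)"

text \<open>
  For a Gram kernel these are the Riesz sequence inequalities. Unlike systems of functions, kernels
  can be multiplied one coordinate at a time while the remaining coordinates carry an identity kernel.
\<close>

definition kernel_bounds :: "('i \<Rightarrow> 'i \<Rightarrow> complex) \<Rightarrow> real \<Rightarrow> real \<Rightarrow> bool" where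
  "kernel_bounds H a b \<longleftrightarrow> 0 < a \<and> 0 < b \<and> (\<forall>F c. finite F \<longrightarrow>
     a * (\<Sum>x\<in>F. (cmod (c x))\<^sup>2) \<le> Re (kernel_form H F c) \<and>
     Re (kernel_form H F c) \<le> b * (\<Sum>x\<in>F. (cmod (c x))\<^sup>2))"

lemma kernel_boundsD:
  assumes "kernel_bounds H a b" "finite F"
  shows "a * (\<Sum>x\<in>F. (cmod (c x))\<^sup>2) \<le> Re (kernel_form H F c)"
    and "Re (kernel_form H F c) \<le> b * (\<Sum>x\<in>F. (cmod (c x))\<^sup>2)"
  using assms unfolding kernel_bounds_def by simp_all

lemma gram_kernel_form:
  assumes "\<And>n. v n \<in> l2_space D"
  shows "kernel_form (\<lambda>n m. l2_inner D (v n) (v m)) F c = of_real ((l2_norm D (\<lambda>x. \<Sum>n\<in>F. c n * v n x))\<^sup>2)"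
  unfolding l2_inner_self[symmetric] kernel_form_def
  by (subst l2_inner_lincomb_left[of v, OF assms l2_lincomb[of v, OF assms]])
    (simp add: l2_inner_lincomb_right[of v, OF assms assms] sum_distrib_left mult.assoc)

lemma kernel_bounds_pullback:
  fixes \<iota> :: "'i \<Rightarrow> 'p"
  assumes H: "kernel_bounds H a b" and \<iota>: "inj \<iota>"
  shows "kernel_bounds (\<lambda>x y. H (\<iota> x) (\<iota> y)) a b"
  unfolding kernel_bounds_def
proof (intro conjI allI impI)
  show "0 < a" "0 < b" using H by (auto simp: kernel_bounds_def)
  fix F :: "'i set" and c :: "'i \<Rightarrow> complex"
  assume F: "finite F"
  have inj: "inj_on \<iota> F" using \<iota> by (auto simp: inj_on_def inj_def)
  let ?c = "\<lambda>p. c (inv \<iota> p)"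
  have form: "kernel_form H (\<iota> ` F) ?c = kernel_form (\<lambda>x y. H (\<iota> x) (\<iota> y)) F c"
    unfolding kernel_form_def by (simp add: sum.reindex[OF inj] inv_f_f[OF \<iota>])
  have norm: "(\<Sum>p\<in>\<iota> ` F. (cmod (?c p))\<^sup>2) = (\<Sum>x\<in>F. (cmod (c x))\<^sup>2)"
    by (simp add: sum.reindex[OF inj] inv_f_f[OF \<iota>])
  have "finite (\<iota> ` F)" using F by simp
  from kernel_boundsD[OF H this, of ?c]
  show "a * (\<Sum>x\<in>F. (cmod (c x))\<^sup>2) \<le> Re (kernel_form (\<lambda>x y. H (\<iota> x) (\<iota> y)) F c)"
      "Re (kernel_form (\<lambda>x y. H (\<iota> x) (\<iota> y)) F c) \<le> b * (\<Sum>x\<in>F. (cmod (c x))\<^sup>2)"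
    by (simp_all only: form norm)
qed

text \<open>
  Sum over the second index first: this turns the form into the integral over \<open>t\<close> of the form of \<open>H\<close>
  at the coefficients \<open>d x t = \<Sum>\<^sub>y c (x, y) v y t\<close>. Bound the integrand by \<open>H\<close> at every \<open>t\<close>; what
  remains are the norms of the \<open>d x\<close>, to which the bounds for \<open>v\<close> apply.
\<close>

lemma kernel_bounds_tensor:
  fixes v :: "'j \<Rightarrow> 'a::euclidean_space \<Rightarrow> complex" and H :: "'i \<Rightarrow> 'i \<Rightarrow> complex"
  assumes H: "kernel_bounds H a b" and v: "riesz_sequence D v A B"
  shows "kernel_bounds (\<lambda>p q. H (fst p) (fst q) * l2_inner D (v (snd p)) (v (snd q))) (a * A) (b * B)"
  unfolding kernel_bounds_def
proof (intro conjI allI impI)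
  note A = riesz_sequenceD(1)[OF v] and B = riesz_sequenceD(2)[OF v] and vl2 = riesz_sequenceD(3)[OF v]
  have ab: "0 < a" "0 < b" using H by (auto simp: kernel_bounds_def)
  show "0 < a * A" "0 < b * B" using ab A B by auto
  fix F :: "('i \<times> 'j) set" and c :: "'i \<times> 'j \<Rightarrow> complex"
  assume F: "finite F"
  let ?T = "\<lambda>p q. H (fst p) (fst q) * l2_inner D (v (snd p)) (v (snd q))"
  define X where "X = fst ` F"
  define Y where "Y = snd ` F"
  define c' where "c' x y = (if (x, y) \<in> F then c (x, y) else 0)" for x y
  define d where "d x = (\<lambda>t. \<Sum>y\<in>Y. c' x y * v y t)" for x
  have X: "finite X" and Y: "finite Y" using F by (auto simp: X_def Y_def)
  \<comment> \<open>Extending \<open>c\<close> by zero replaces \<open>F\<close> by a product set.\<close>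
  have sub: "F \<subseteq> X \<times> Y" by (force simp: X_def Y_def)
  have dl2: "d x \<in> l2_space D" for x unfolding d_def by (intro l2_lincomb vl2)
  have sums: "(\<Sum>p\<in>F. h p (c p)) = (\<Sum>x\<in>X. \<Sum>y\<in>Y. h (x, y) (c' x y))" if "\<And>p. h p 0 = 0"
    for h :: "'i \<times> 'j \<Rightarrow> complex \<Rightarrow> complex"
  proof -
    have "(\<Sum>p\<in>F. h p (c p)) = (\<Sum>p\<in>X \<times> Y. h p (c' (fst p) (snd p)))"
      using X Y sub that by (intro sum.mono_neutral_cong_left) (auto simp: c'_def)
    then show ?thesis by (simp add: sum.cartesian_product case_prod_unfold)
  qed
  have "complex_of_real (\<Sum>p\<in>F. (cmod (c p))\<^sup>2) = (\<Sum>p\<in>F. of_real ((cmod (c p))\<^sup>2))" by simp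
  also have "\<dots> = (\<Sum>x\<in>X. \<Sum>y\<in>Y. of_real ((cmod (c' x y))\<^sup>2))" by (rule sums) simp
  finally have norms: "(\<Sum>p\<in>F. (cmod (c p))\<^sup>2) = (\<Sum>x\<in>X. \<Sum>y\<in>Y. (cmod (c' x y))\<^sup>2)"
    by (simp only: of_real_sum[symmetric] of_real_eq_iff)
  have "kernel_form ?T F c = (\<Sum>p\<in>F. c p * (\<Sum>q\<in>F. cnj (c q) * ?T p q))"
    by (simp add: kernel_form_def sum_distrib_left mult.assoc)
  also have "\<dots> = (\<Sum>x\<in>X. \<Sum>y\<in>Y. c' x y * (\<Sum>q\<in>F. cnj (c q) * ?T (x, y) q))"
    by (rule sums) simp
  also have "\<dots> = (\<Sum>x\<in>X. \<Sum>y\<in>Y. c' x y * (\<Sum>x'\<in>X. \<Sum>y'\<in>Y. cnj (c' x' y') * ?T (x, y) (x', y')))"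
    by (intro sum.cong refl arg_cong2[of _ _ _ _ "(*)"] sums) simp
  also have "\<dots> = (\<Sum>x\<in>X. \<Sum>x'\<in>X. H x x' * (\<Sum>y\<in>Y. c' x y * (\<Sum>y'\<in>Y. cnj (c' x' y') * l2_inner D (v y) (v y'))))"
    by (simp add: sum_distrib_left sum.swap[of _ X Y] mult_ac)
  also have "\<dots> = (\<Sum>x\<in>X. \<Sum>x'\<in>X. H x x' * l2_inner D (d x) (d x'))"
    unfolding d_def
    by (simp add: l2_inner_lincomb_left[of v, OF vl2 l2_lincomb[of v, OF vl2]] l2_inner_lincomb_right[of v, OF vl2 vl2])
  also have "\<dots> = (LINT t|lebesgue_on D. kernel_form H X (\<lambda>x. d x t))"
    unfolding kernel_form_def l2_inner_def using l2_prod_integrable[OF dl2 dl2]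
    by (simp add: mult.commute[of _ "H _ _"])
  finally have form: "kernel_form ?T F c = (LINT t|lebesgue_on D. kernel_form H X (\<lambda>x. d x t))" .
  have int_form: "integrable (lebesgue_on D) (\<lambda>t. kernel_form H X (\<lambda>x. d x t))"
    unfolding kernel_form_def using l2_prod_integrable[OF dl2 dl2]
    by (intro Bochner_Integration.integrable_sum integrable_mult_left)
  have int_norm: "integrable (lebesgue_on D) (\<lambda>t. e * (\<Sum>x\<in>X. (cmod (d x t))\<^sup>2))" for e
    using l2_spaceD(2)[OF dl2] by (intro integrable_mult_right Bochner_Integration.integrable_sum)
  have int_eq: "(LINT t|lebesgue_on D. e * (\<Sum>x\<in>X. (cmod (d x t))\<^sup>2)) = e * (\<Sum>x\<in>X. (l2_norm D (d x))\<^sup>2)" for e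
    using l2_spaceD(2)[OF dl2] by (simp add: l2_norm_square)
  have Re_form: "Re (kernel_form ?T F c) = (LINT t|lebesgue_on D. Re (kernel_form H X (\<lambda>x. d x t)))"
    unfolding form using int_form by (simp add: integral_Re)
  have pw: "a * (\<Sum>x\<in>X. (cmod (d x t))\<^sup>2) \<le> Re (kernel_form H X (\<lambda>x. d x t))"
      "Re (kernel_form H X (\<lambda>x. d x t)) \<le> b * (\<Sum>x\<in>X. (cmod (d x t))\<^sup>2)" for t
    by (rule kernel_boundsD[OF H X])+
  have "a * A * (\<Sum>p\<in>F. (cmod (c p))\<^sup>2) = a * (\<Sum>x\<in>X. A * (\<Sum>y\<in>Y. (cmod (c' x y))\<^sup>2))"
    by (simp add: norms sum_distrib_left mult.assoc)
  also have "\<dots> \<le> a * (\<Sum>x\<in>X. (l2_norm D (d x))\<^sup>2)"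
    unfolding d_def using ab by (intro mult_left_mono sum_mono riesz_sequenceD(4)[OF v Y]) auto
  also have "\<dots> \<le> Re (kernel_form ?T F c)"
    unfolding int_eq[symmetric] Re_form by (intro integral_mono int_norm integrable_Re int_form pw)
  finally show "a * A * (\<Sum>p\<in>F. (cmod (c p))\<^sup>2) \<le> Re (kernel_form ?T F c)" .
  have "Re (kernel_form ?T F c) \<le> b * (\<Sum>x\<in>X. (l2_norm D (d x))\<^sup>2)"
    unfolding int_eq[symmetric] Re_form by (intro integral_mono int_norm integrable_Re int_form pw)
  also have "\<dots> \<le> b * (\<Sum>x\<in>X. B * (\<Sum>y\<in>Y. (cmod (c' x y))\<^sup>2))"
    unfolding d_def using ab by (intro mult_left_mono sum_mono riesz_sequenceD(5)[OF v Y]) auto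
  also have "\<dots> = b * B * (\<Sum>p\<in>F. (cmod (c p))\<^sup>2)"
    by (simp add: norms sum_distrib_left mult.assoc)
  finally show "Re (kernel_form ?T F c) \<le> b * B * (\<Sum>p\<in>F. (cmod (c p))\<^sup>2)" .
qed

text \<open>
  The product of the kernels \<open>G k\<close> in the coordinates of \<open>K\<close>, and the identity kernel in all others.
\<close>

definition partial_tensor ::
    "('d \<Rightarrow> int \<Rightarrow> int \<Rightarrow> complex) \<Rightarrow> 'd set \<Rightarrow> int ^ 'd \<Rightarrow> int ^ 'd \<Rightarrow> complex" where
  "partial_tensor G K n m = (\<Prod>k\<in>K. G k (n $ k) (m $ k)) * (if \<forall>k. k \<notin> K \<longrightarrow> n $ k = m $ k then 1 else 0)"

lemma partial_tensor_bounds: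
  fixes v :: "'d::finite \<Rightarrow> int \<Rightarrow> 'a::euclidean_space \<Rightarrow> complex"
  assumes v: "\<And>k. riesz_sequence D (v k) (A k) (B k)"
  defines "G \<equiv> \<lambda>k i j. l2_inner D (v k i) (v k j)"
  shows "kernel_bounds (partial_tensor G K) (\<Prod>k\<in>K. A k) (\<Prod>k\<in>K. B k)"
proof (induction K rule: finite_induct[OF finite])
  case 1
  have "kernel_form (partial_tensor G {}) F c = of_real (\<Sum>n\<in>F. (cmod (c n))\<^sup>2)" if F: "finite F" for F c
  proof -
    have "kernel_form (partial_tensor G {}) F c = (\<Sum>n\<in>F. \<Sum>m\<in>F. if m = n then c n * cnj (c n) else 0)"
      unfolding kernel_form_def by (intro sum.cong refl) (auto simp: partial_tensor_def vec_eq_iff[symmetric])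
    also have "\<dots> = (\<Sum>n\<in>F. c n * cnj (c n))" using F by simp
    finally show ?thesis by (simp add: complex_norm_square[symmetric] del: of_real_power)
  qed
  then show ?case by (simp add: kernel_bounds_def)
next
  case (2 k K)
  \<comment> \<open>Split off coordinate \<open>k\<close>; setting it to \<open>0\<close> makes the identity kernel in that coordinate trivial.\<close>
  define \<iota> where "\<iota> n = ((\<chi> j. if j = k then 0 else n $ j) :: int ^ 'd, n $ k)" for n :: "int ^ 'd"
  have inj: "inj \<iota>"
  proof (rule injI)
    fix n m assume "\<iota> n = \<iota> m"
    then have "n $ j = m $ j" for j
      by (cases "j = k") (auto simp: \<iota>_def vec_eq_iff dest: spec[of _ j])
    then show "n = m" by (simp add: vec_eq_iff)
  qed
  have step: "partial_tensor G K (fst (\<iota> n)) (fst (\<iota> m)) * l2_inner D (v k (snd (\<iota> n))) (v k (snd (\<iota> m)))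
      = partial_tensor G (insert k K) n m" for n m
  proof -
    have "(\<Prod>j\<in>K. G j (fst (\<iota> n) $ j) (fst (\<iota> m) $ j)) = (\<Prod>j\<in>K. G j (n $ j) (m $ j))"
      using 2(2) by (intro prod.cong) (auto simp: \<iota>_def)
    moreover have "(\<forall>j. j \<notin> K \<longrightarrow> fst (\<iota> n) $ j = fst (\<iota> m) $ j) \<longleftrightarrow> (\<forall>j. j \<notin> insert k K \<longrightarrow> n $ j = m $ j)"
      by (auto simp: \<iota>_def)
    ultimately show ?thesis using 2(1,2) by (simp add: partial_tensor_def \<iota>_def G_def mult.commute)
  qed
  have "kernel_bounds (partial_tensor G (insert k K)) ((\<Prod>j\<in>K. A j) * A k) ((\<Prod>j\<in>K. B j) * B k)"
    using kernel_bounds_pullback[OF kernel_bounds_tensor[OF 2(3) v[of k]] inj] by (simp only: step)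
  then show ?case using 2(1,2) by (simp add: mult.commute)
qed

definition tensor_system :: "('d::finite \<Rightarrow> int \<Rightarrow> real \<Rightarrow> complex) \<Rightarrow> int ^ 'd \<Rightarrow> real ^ 'd \<Rightarrow> complex" where
  "tensor_system v n x = (\<Prod>k\<in>UNIV. v k (n $ k) (x $ k))"

lemma tensor_system_riesz_sequence:
  fixes v :: "'d::finite \<Rightarrow> int \<Rightarrow> real \<Rightarrow> complex"
  assumes v: "\<And>k. riesz_sequence {0..<1} (v k) (A k) (B k)" and bb: "\<And>k n. bounded_borel (v k n)"
  shows "riesz_sequence half_open_cube (tensor_system v) (\<Prod>k\<in>UNIV. A k) (\<Prod>k\<in>UNIV. B k)"
proof -
  let ?H = "partial_tensor (\<lambda>k i j. l2_inner {0..<1} (v k i) (v k j)) UNIV"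
  have tl2: "tensor_system v n \<in> l2_space half_open_cube" for n
    unfolding tensor_system_def using prod_coordinates_l2[of "\<lambda>k. v k (n $ k)"] bb by blast
  have gram: "l2_inner half_open_cube (tensor_system v n) (tensor_system v m) = ?H n m" for n m
    unfolding tensor_system_def
    using prod_coordinates_inner[of "\<lambda>k. v k (n $ k)" "\<lambda>k. v k (m $ k)"] bb by (simp add: partial_tensor_def)
  have form: "kernel_form ?H F c = of_real ((l2_norm half_open_cube (\<lambda>x. \<Sum>n\<in>F. c n * tensor_system v n x))\<^sup>2)" for F c
    using gram_kernel_form[of "tensor_system v" half_open_cube F c, OF tl2] by (simp add: gram)
  have kb: "kernel_bounds ?H (\<Prod>k\<in>UNIV. A k) (\<Prod>k\<in>UNIV. B k)" by (rule partial_tensor_bounds[OF v])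
  show ?thesis
    unfolding riesz_sequence_def
  proof (intro conjI allI impI tl2)
    show "0 < (\<Prod>k\<in>UNIV. A k)" "0 < (\<Prod>k\<in>UNIV. B k)" using kb by (simp_all add: kernel_bounds_def)
    fix F :: "(int ^ 'd) set" and c :: "int ^ 'd \<Rightarrow> complex" assume F: "finite F"
    show "(\<Prod>k\<in>UNIV. A k) * (\<Sum>n\<in>F. (cmod (c n))\<^sup>2) \<le> (l2_norm half_open_cube (\<lambda>x. \<Sum>n\<in>F. c n * tensor_system v n x))\<^sup>2"
      "(l2_norm half_open_cube (\<lambda>x. \<Sum>n\<in>F. c n * tensor_system v n x))\<^sup>2 \<le> (\<Prod>k\<in>UNIV. B k) * (\<Sum>n\<in>F. (cmod (c n))\<^sup>2)"
      using kernel_boundsD[OF kb F, of c] unfolding form by simp_all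
  qed
qed

text \<open>
  The indicator of a box is a product of indicators of intervals. A product depends linearly and
  continuously on each of its factors, so the factors can be exchanged one after the other for
  combinations of the \<open>v k\<close>; the induction is over the set \<open>K\<close> of coordinates still to be exchanged.
\<close>

lemma tensor_system_dense:
  fixes v :: "'d::finite \<Rightarrow> int \<Rightarrow> real \<Rightarrow> complex"
  assumes v: "\<And>k. l2_space {0..<1} \<subseteq> l2_closure {0..<1} (lin_span (v k))" and bb: "\<And>k n. bounded_borel (v k n)"
  shows "l2_space half_open_cube \<subseteq> l2_closure half_open_cube (lin_span (tensor_system v))"
proof (rule dense_if_boxes[OF half_open_cube_lmeasurable])
  let ?V = "lin_span (tensor_system v)"
  let ?P = "\<lambda>h (x :: real ^ 'd). \<Prod>k\<in>UNIV. h k (x $ k) :: complex"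
  show tl2: "tensor_system v n \<in> l2_space half_open_cube" for n
    unfolding tensor_system_def using prod_coordinates_l2[of "\<lambda>k. v k (n $ k)"] bb by blast
  have V: "?V \<subseteq> l2_space half_open_cube"
    using lin_span_subset_l2[of "tensor_system v", OF tl2] by blast
  have main: "?P h \<in> l2_closure half_open_cube ?V"
    if "\<And>k. bounded_borel (h k)" "\<And>k. k \<notin> K \<Longrightarrow> \<exists>n. h k = v k n" for K h
    using that
  proof (induction K arbitrary: h rule: finite_induct[OF finite])
    case 1
    then have "\<forall>k. \<exists>n. h k = v k n" by blast
    then obtain n where "\<And>k. h k = v k (n k)" by metis
    then have "?P h = tensor_system v (\<chi> k. n k)" by (simp add: tensor_system_def fun_eq_iff)
    then show ?case using subsetD[OF l2_closure_superset[OF V] lin_span_member] by metis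
  next
    case (2 k K)
    have upd: "?P (h(k := f)) x = f (x $ k) * (\<Prod>j\<in>UNIV - {k}. h j (x $ j))" for f x
    proof -
      have "?P (h(k := f)) x = f (x $ k) * (\<Prod>j\<in>UNIV - {k}. (h(k := f)) j (x $ j))"
        by (subst prod.remove[of UNIV k]) auto
      also have "(\<Prod>j\<in>UNIV - {k}. (h(k := f)) j (x $ j)) = (\<Prod>j\<in>UNIV - {k}. h j (x $ j))"
        by (intro prod.cong) auto
      finally show ?thesis .
    qed
    define M where "M = (\<Prod>j\<in>UNIV - {k}. l2_norm {0..<1} (h j))"
    have M0: "0 \<le> M" unfolding M_def by (intro prod_nonneg) auto
    have nrm: "l2_norm half_open_cube (?P (h(k := f))) = l2_norm {0..<1} f * M" if f: "bounded_borel f" for f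
    proof -
      have "l2_norm half_open_cube (?P (h(k := f))) = (\<Prod>j\<in>UNIV. l2_norm {0..<1} ((h(k := f)) j))"
        using 2(4) f by (intro prod_coordinates_norm) auto
      also have "\<dots> = l2_norm {0..<1} f * (\<Prod>j\<in>UNIV - {k}. l2_norm {0..<1} ((h(k := f)) j))"
        by (subst prod.remove[of UNIV k]) auto
      also have "(\<Prod>j\<in>UNIV - {k}. l2_norm {0..<1} ((h(k := f)) j)) = M"
        unfolding M_def by (intro prod.cong) auto
      finally show ?thesis .
    qed
    show ?case
    proof (rule l2_closure_closed[OF V])
      show "?P h \<in> l2_space half_open_cube" by (rule prod_coordinates_l2[OF 2(4)])
      fix \<epsilon> :: real assume e: "\<epsilon> > 0"
      then have "\<epsilon> / (M + 1) > 0" using M0 by (intro divide_pos_pos) auto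
      moreover have "h k \<in> l2_closure {0..<1} (lin_span (v k))" using v bounded_borel_l2[OF 2(4)] by blast
      ultimately obtain g where g: "g \<in> lin_span (v k)" "l2_norm {0..<1} (\<lambda>t. h k t - g t) < \<epsilon> / (M + 1)"
        by (metis l2_closureE)
      then obtain F c where F: "finite F" and g_eq: "g = (\<lambda>t. \<Sum>n\<in>F. c n * v k n t)" by (auto simp: lin_span_def)
      have bg: "bounded_borel g" unfolding g_eq by (intro bounded_borel_lincomb bb)
      have "?P (h(k := g)) = (\<lambda>x. \<Sum>n\<in>F. c n * ?P (h(k := v k n)) x)"
        unfolding upd by (simp add: g_eq sum_distrib_right mult.assoc)
      also have "\<dots> \<in> l2_closure half_open_cube ?V"
      proof (rule l2_closure_span_lincomb[OF tl2])
        fix n assume "n \<in> F"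
        show "?P (h(k := v k n)) \<in> l2_closure half_open_cube ?V"
          using 2(4,5) bb by (intro 2(3)) auto
      qed
      finally have mem: "?P (h(k := g)) \<in> l2_closure half_open_cube ?V" .
      have "(\<lambda>x. ?P h x - ?P (h(k := g)) x) = ?P (h(k := (\<lambda>t. h k t - g t)))"
        using upd[of "h k"] by (simp only: fun_upd_triv upd left_diff_distrib)
      then have "l2_norm half_open_cube (\<lambda>x. ?P h x - ?P (h(k := g)) x) = l2_norm {0..<1} (\<lambda>t. h k t - g t) * M"
        using nrm[OF bounded_borel_diff[OF 2(4)[of k] bg]] by simp
      also have "\<dots> \<le> \<epsilon> / (M + 1) * M" using g(2) M0 by (intro mult_right_mono) auto
      also have "\<dots> < \<epsilon>" using e M0 by (simp add: field_simps)
      finally show "\<exists>g\<in>l2_closure half_open_cube ?V. l2_norm half_open_cube (\<lambda>x. ?P h x - g x) < \<epsilon>"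
        using mem by (rule rev_bexI[rotated])
    qed
  qed
  fix a b :: "real ^ 'd"
  have "(\<lambda>x. indicator (box a b) x) = ?P (\<lambda>k. indicator {a $ k<..<b $ k})"
  proof
    fix x :: "real ^ 'd"
    show "indicator (box a b) x = ?P (\<lambda>k. indicator {a $ k<..<b $ k}) x"
    proof (cases "x \<in> box a b")
      case True
      then show ?thesis by (simp add: mem_box_cart)
    next
      case False
      then obtain k where "x $ k \<notin> {a $ k<..<b $ k}" by (auto simp: mem_box_cart)
      then have "indicator {a $ k<..<b $ k} (x $ k) = (0 :: complex)" by simp
      then have "?P (\<lambda>k. indicator {a $ k<..<b $ k}) x = 0"
        by (intro prod_zero finite bexI[of _ k] UNIV_I)
      then show ?thesis using False by simp
    qed
  qed
  moreover have "?P (\<lambda>k. indicator {a $ k<..<b $ k}) \<in> l2_closure half_open_cube ?V"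
    by (rule main[where K = UNIV])
      (auto simp: bounded_borel_def split: split_indicator intro!: exI[of _ 1] borel_measurable_indicator)
  ultimately show "(\<lambda>x. indicator (box a b) x) \<in> l2_closure half_open_cube ?V" by simp
qed

theorem tensor_system_riesz_basis:
  fixes v :: "'d::finite \<Rightarrow> int \<Rightarrow> real \<Rightarrow> complex"
  assumes v: "\<And>k. riesz_basis {0..<1} (v k) (A k) (B k)" and bb: "\<And>k n. bounded_borel (v k n)"
  shows "riesz_basis half_open_cube (tensor_system v) (\<Prod>k\<in>UNIV. A k) (\<Prod>k\<in>UNIV. B k)"
  using tensor_system_riesz_sequence[of v A B, OF _ bb] tensor_system_dense[of v, OF _ bb] v
  by (simp add: riesz_basis_def)

section \<open>Splitting the cube\<close>

lemma emeasure_lebesgue_translation: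
  "emeasure lebesgue ((\<lambda>x. s + x) ` S) = emeasure lebesgue (S :: 'a::euclidean_space set)"
  using emeasure_lebesgue_affine[of 1 s S] by (simp add: add.commute)

context
  fixes J :: "'j set" and R :: "'j \<Rightarrow> 'a::euclidean_space set" and s :: "'j \<Rightarrow> 'a" and f :: "'a \<Rightarrow> 'a"
  assumes J: "countable J" and R: "\<And>j. j \<in> J \<Longrightarrow> R j \<in> sets lebesgue"
    and f: "\<And>j x. j \<in> J \<Longrightarrow> x \<in> R j \<Longrightarrow> f x = s j + x"
begin

lemma piecewise_translation_vimage:
  "f -` A \<inter> (\<Union>j\<in>J. R j) = (\<Union>j\<in>J. (\<lambda>x. - s j + x) ` (A \<inter> (\<lambda>x. s j + x) ` R j))"
proof
  show "f -` A \<inter> (\<Union>j\<in>J. R j) \<subseteq> (\<Union>j\<in>J. (\<lambda>x. - s j + x) ` (A \<inter> (\<lambda>x. s j + x) ` R j))"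
  proof
    fix x assume "x \<in> f -` A \<inter> (\<Union>j\<in>J. R j)"
    then obtain j where j: "j \<in> J" "x \<in> R j" "s j + x \<in> A" using f by auto
    then have "x = - s j + (s j + x)" "s j + x \<in> A \<inter> (\<lambda>x. s j + x) ` R j" by auto
    with j(1) show "x \<in> (\<Union>j\<in>J. (\<lambda>x. - s j + x) ` (A \<inter> (\<lambda>x. s j + x) ` R j))" by blast
  qed
qed (use f in auto)

lemma piecewise_translation_sets:
  assumes "A \<in> sets lebesgue" "j \<in> J"
  shows "A \<inter> (\<lambda>x. s j + x) ` R j \<in> sets lebesgue"
    and "(\<lambda>x. - s j + x) ` (A \<inter> (\<lambda>x. s j + x) ` R j) \<in> sets lebesgue"
proof -
  show "A \<inter> (\<lambda>x. s j + x) ` R j \<in> sets lebesgue"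
    by (intro sets.Int lebesgue_sets_translation R assms)
  then show "(\<lambda>x. - s j + x) ` (A \<inter> (\<lambda>x. s j + x) ` R j) \<in> sets lebesgue"
    by (rule lebesgue_sets_translation)
qed

lemma piecewise_translation_measurable:
  "f \<in> lebesgue_on (\<Union>j\<in>J. R j) \<rightarrow>\<^sub>M lebesgue_on (\<Union>j\<in>J. (\<lambda>x. s j + x) ` R j)"
proof (rule measurableI)
  show "f x \<in> space (lebesgue_on (\<Union>j\<in>J. (\<lambda>x. s j + x) ` R j))" if "x \<in> space (lebesgue_on (\<Union>j\<in>J. R j))" for x
    using that f by auto
  fix A assume "A \<in> sets (lebesgue_on (\<Union>j\<in>J. (\<lambda>x. s j + x) ` R j))"
  moreover have "(\<Union>j\<in>J. (\<lambda>x. s j + x) ` R j) \<in> sets lebesgue"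
    by (intro sets.countable_UN'[OF J] image_subsetI lebesgue_sets_translation R)
  ultimately have A: "A \<in> sets lebesgue" by (auto simp: sets_restrict_space_iff)
  have "f -` A \<inter> (\<Union>j\<in>J. R j) \<in> sets lebesgue"
    unfolding piecewise_translation_vimage
    by (intro sets.countable_UN'[OF J] image_subsetI piecewise_translation_sets(2)[OF A])
  moreover have "(\<Union>j\<in>J. R j) \<in> sets lebesgue" using J R by (intro sets.countable_UN') auto
  ultimately show "f -` A \<inter> space (lebesgue_on (\<Union>j\<in>J. R j)) \<in> sets (lebesgue_on (\<Union>j\<in>J. R j))"
    by (simp add: sets_restrict_space_iff)
qed

end

text \<open>
  Lebesgue measure is translation invariant, and the measures of countably many disjoint pieces add
  up. Disjointness of the translated pieces makes the map invertible.
\<close>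

lemma piecewise_translation_change_of_variable:
  fixes R :: "'j \<Rightarrow> 'a::euclidean_space set"
  assumes J: "countable J" and R: "\<And>j. j \<in> J \<Longrightarrow> R j \<in> sets lebesgue"
    and disjR: "disjoint_family_on R J" and disjS: "disjoint_family_on (\<lambda>j. (\<lambda>x. s j + x) ` R j) J"
  obtains f where "change_of_variable (\<Union>j\<in>J. R j) (\<Union>j\<in>J. (\<lambda>x. s j + x) ` R j) f 1"
    and "\<And>j x. j \<in> J \<Longrightarrow> x \<in> R j \<Longrightarrow> f x = s j + x"
proof -
  define S where "S j = (\<lambda>x. s j + x) ` R j" for j
  let ?D = "\<Union>j\<in>J. R j" and ?E = "\<Union>j\<in>J. S j"
  define f where "f x = s (SOME j. j \<in> J \<and> x \<in> R j) + x" for x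
  define g where "g y = - s (SOME j. j \<in> J \<and> y \<in> S j) + y" for y
  have f: "f x = s j + x" if "j \<in> J" "x \<in> R j" for j x
  proof -
    have "(SOME j. j \<in> J \<and> x \<in> R j) = j"
      using that disjR by (intro some_equality) (auto simp: disjoint_family_on_def)
    then show ?thesis by (simp add: f_def)
  qed
  have g: "g y = - s j + y" if "j \<in> J" "y \<in> S j" for j y
  proof -
    have "(SOME j. j \<in> J \<and> y \<in> S j) = j"
      using that disjS by (intro some_equality) (auto simp: disjoint_family_on_def S_def)
    then show ?thesis by (simp add: g_def)
  qed
  have S: "S j \<in> sets lebesgue" if "j \<in> J" for j
    unfolding S_def by (intro lebesgue_sets_translation R that)
  have unshift: "(\<lambda>y. - s j + y) ` S j = R j" for j by (simp add: S_def image_image)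
  have E: "?E \<in> sets lebesgue" and D: "?D \<in> sets lebesgue"
    using J R S by (auto intro!: sets.countable_UN')
  have fm: "f \<in> lebesgue_on ?D \<rightarrow>\<^sub>M lebesgue_on ?E"
    using piecewise_translation_measurable[of J R f s, OF J R f] by (simp add: S_def)
  have gm: "g \<in> lebesgue_on ?E \<rightarrow>\<^sub>M lebesgue_on ?D"
    using piecewise_translation_measurable[of J S g "\<lambda>j. - s j", OF J S g] by (simp only: unshift)
  have dist: "distr (lebesgue_on ?D) (lebesgue_on ?E) f = density (lebesgue_on ?E) (\<lambda>_. ennreal 1)"
  proof (rule measure_eqI)
    fix A assume "A \<in> sets (distr (lebesgue_on ?D) (lebesgue_on ?E) f)"
    then have A': "A \<in> sets (lebesgue_on ?E)" by simp
    then have A: "A \<in> sets lebesgue" "A \<subseteq> ?E" using E by (auto simp: sets_restrict_space_iff)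
    note ps = piecewise_translation_sets[of J R f s, OF J R f A(1), folded S_def]
    have sub: "(\<lambda>y. - s j + y) ` (A \<inter> S j) \<subseteq> R j" for j using unshift[of j] by blast
    have "emeasure (distr (lebesgue_on ?D) (lebesgue_on ?E) f) A = emeasure (lebesgue_on ?D) (f -` A \<inter> ?D)"
      using fm A' by (simp add: emeasure_distr)
    also have "\<dots> = emeasure lebesgue (f -` A \<inter> ?D)"
      using D by (subst emeasure_restrict_space) auto
    also have "f -` A \<inter> ?D = (\<Union>j\<in>J. (\<lambda>y. - s j + y) ` (A \<inter> S j))"
      unfolding S_def by (rule piecewise_translation_vimage[of J R f s, OF J R f])
    also have "emeasure lebesgue \<dots> = (\<integral>\<^sup>+j. emeasure lebesgue ((\<lambda>y. - s j + y) ` (A \<inter> S j)) \<partial>count_space J)"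
    proof (intro emeasure_UN_countable J ps(2))
      show "disjoint_family_on (\<lambda>j. (\<lambda>y. - s j + y) ` (A \<inter> S j)) J"
        unfolding disjoint_family_on_def
      proof (intro ballI impI)
        fix i j assume "i \<in> J" "j \<in> J" "i \<noteq> j"
        then have "R i \<inter> R j = {}" using disjR by (simp add: disjoint_family_on_def)
        then show "(\<lambda>y. - s i + y) ` (A \<inter> S i) \<inter> (\<lambda>y. - s j + y) ` (A \<inter> S j) = {}"
          using Int_mono[OF sub[of i] sub[of j]] by blast
      qed
    qed
    also have "\<dots> = (\<integral>\<^sup>+j. emeasure lebesgue (A \<inter> S j) \<partial>count_space J)"
      by (simp only: emeasure_lebesgue_translation)
    also have "\<dots> = emeasure lebesgue (\<Union>j\<in>J. A \<inter> S j)"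
      using disjS by (intro emeasure_UN_countable[symmetric] J ps(1)) (auto simp: disjoint_family_on_def S_def)
    also have "(\<Union>j\<in>J. A \<inter> S j) = A" using A(2) by blast
    also have "emeasure lebesgue A = emeasure (lebesgue_on ?E) A"
      using A E by (subst emeasure_restrict_space) auto
    also have "\<dots> = emeasure (density (lebesgue_on ?E) (\<lambda>_. ennreal 1)) A"
      using A' by (subst emeasure_density) auto
    finally show "emeasure (distr (lebesgue_on ?D) (lebesgue_on ?E) f) A
        = emeasure (density (lebesgue_on ?E) (\<lambda>_. ennreal 1)) A" .
  qed simp
  have gf: "g (f x) = x" if x: "x \<in> ?D" for x
  proof -
    obtain j where j: "j \<in> J" "x \<in> R j" using x by blast
    then show ?thesis using f[OF j] g[of j "s j + x"] by (simp add: S_def)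
  qed
  have fg: "f (g y) = y" if y: "y \<in> ?E" for y
  proof -
    obtain j where j: "j \<in> J" "y \<in> S j" using y by blast
    then have "- s j + y \<in> R j" using unshift[of j] by blast
    then show ?thesis using g[OF j] f[OF j(1)] by simp
  qed
  have "change_of_variable ?D ?E f 1"
    unfolding change_of_variable_def by (intro conjI bexI[OF _ gm] ballI gf fg fm dist zero_less_one)
  then show ?thesis using that f unfolding S_def by blast
qed

lemma shift_sequence_mono:
  assumes "shift_sequence m b" "i \<le> j" "enat j < m"
  shows "b i \<le> b j"
  using assms(2,3)
proof (induction j rule: dec_induct)
  case (step j)
  then have "enat j < m" by (meson enat_ord_simps(2) lessI order_less_trans)
  moreover have "b j < b (Suc j)" using assms(1) step by (simp add: shift_sequence_def)
  ultimately show ?case using step by simp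
qed simp

definition piece_index_set :: "('d \<Rightarrow> enat) \<Rightarrow> (nat ^ 'd) set" where
  "piece_index_set m = {j. \<forall>k. enat (j $ k) < m k}"

lemma box_piece_Union:
  assumes "\<And>k. unit_subdivision (m k) (a k)"
  shows "(\<Union>j\<in>piece_index_set m. box_piece a j) = (half_open_cube :: (real ^ 'd::finite) set)"
proof (rule set_eqI)
  fix x :: "real ^ 'd"
  have "x $ k \<in> {0..<1} \<longleftrightarrow> (\<exists>i. enat i < m k \<and> x $ k \<in> {a k i..<a k (Suc i)})" for k
    unfolding unit_subdivision_Union[OF assms[of k], symmetric] by blast
  then have "x \<in> half_open_cube \<longleftrightarrow> (\<forall>k. \<exists>i. enat i < m k \<and> x $ k \<in> {a k i..<a k (Suc i)})"
    by (simp only: half_open_cube_def mem_Collect_eq)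
  also have "\<dots> \<longleftrightarrow> (\<exists>i. \<forall>k. enat (i k) < m k \<and> x $ k \<in> {a k (i k)..<a k (Suc (i k))})"
    by (rule choice_iff)
  also have "\<dots> \<longleftrightarrow> (\<exists>j\<in>piece_index_set m. x \<in> box_piece a j)"
  proof
    assume "\<exists>i. \<forall>k. enat (i k) < m k \<and> x $ k \<in> {a k (i k)..<a k (Suc (i k))}"
    then obtain i where i: "\<And>k. enat (i k) < m k \<and> x $ k \<in> {a k (i k)..<a k (Suc (i k))}" by blast
    then show "\<exists>j\<in>piece_index_set m. x \<in> box_piece a j"
      by (intro bexI[of _ "\<chi> k. i k"]) (auto simp: piece_index_set_def box_piece_def)
  qed (force simp: piece_index_set_def box_piece_def)
  finally show "x \<in> (\<Union>j\<in>piece_index_set m. box_piece a j) \<longleftrightarrow> x \<in> half_open_cube" by blast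
qed

lemma box_piece_disjoint:
  assumes "\<And>k. unit_subdivision (m k) (a k)"
  shows "disjoint_family_on (box_piece a) (piece_index_set m)"
  unfolding disjoint_family_on_def
proof (intro ballI impI)
  fix i j assume ij: "i \<in> piece_index_set m" "j \<in> piece_index_set m" "i \<noteq> j"
  then obtain k where k: "i $ k \<noteq> j $ k" by (auto simp: vec_eq_iff)
  have "{a k (i $ k)..<a k (Suc (i $ k))} \<inter> {a k (j $ k)..<a k (Suc (j $ k))} = {}"
    using unit_subdivision_disjoint[OF assms[of k]] ij k
    by (auto simp: disjoint_family_on_def piece_index_set_def simp del: atLeastLessThan_iff)
  then show "box_piece a i \<inter> box_piece a j = {}" unfolding box_piece_def by blast
qed

text \<open>
  In a coordinate where two indices differ, the shifts increase with the index, so translating can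
  only widen the gap between the two intervals.
\<close>

lemma shifted_box_piece_disjoint:
  assumes a: "\<And>k. unit_subdivision (m k) (a k)" and b: "\<And>k. shift_sequence (m k) (b k)"
  shows "disjoint_family_on (\<lambda>j. (\<lambda>x. shift_vec b j + x) ` box_piece a j) (piece_index_set m)"
  unfolding disjoint_family_on_def
proof (intro ballI impI)
  have sep: "b k i + x \<noteq> b k j + y"
    if "i < j" "enat j < m k" "x < a k (Suc i)" "a k j \<le> y" for k i j x y
  proof -
    have "a k (Suc i) \<le> a k j"
      using unit_subdivision_mono[OF a, of "Suc i" j k] that by (cases "Suc i = j") (auto intro: less_imp_le)
    moreover have "b k i \<le> b k j" using shift_sequence_mono[OF b] that by (simp add: less_imp_le)
    ultimately show ?thesis using that by linarith
  qed
  fix i j assume ij: "i \<in> piece_index_set m" "j \<in> piece_index_set m" "i \<noteq> j"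
  then obtain k where k: "i $ k \<noteq> j $ k" by (auto simp: vec_eq_iff)
  have "shift_vec b i + x \<noteq> shift_vec b j + y" if "x \<in> box_piece a i" "y \<in> box_piece a j" for x y
  proof -
    have "b k (i $ k) + x $ k \<noteq> b k (j $ k) + y $ k"
      using sep[of "i $ k" "j $ k" k "x $ k" "y $ k"] sep[of "j $ k" "i $ k" k "y $ k" "x $ k"] that ij k
      by (cases "i $ k < j $ k") (auto simp: piece_index_set_def box_piece_def)
    then show ?thesis by (auto simp: vec_eq_iff shift_vec_def)
  qed
  then show "(\<lambda>x. shift_vec b i + x) ` box_piece a i \<inter> (\<lambda>x. shift_vec b j + x) ` box_piece a j = {}" by blast
qed

lemma box_piece_lebesgue: "box_piece a j \<in> sets (lebesgue :: (real ^ 'd::finite) measure)"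
proof -
  have "box_piece a j = (\<Inter>k. (\<lambda>x :: real ^ 'd. x $ k) -` {a k (j $ k)..<a k (Suc (j $ k))})"
    by (auto simp: box_piece_def)
  moreover have "(\<lambda>x :: real ^ 'd. x $ k) -` {u..<w} \<in> sets borel" for k u w
    by (rule measurable_sets_borel[of _ borel]) (auto intro: borel_measurable_continuous_onI continuous_intros)
  ultimately have "box_piece a j \<in> sets borel" by (metis (no_types, lifting) UNIV_not_empty finite sets.finite_INT)
  then show ?thesis by (intro sets_completionI_sets) simp
qed

section \<open>The exponential system of the theorem\<close>

text \<open>
  By the case distinction in \<open>delta_star\<close>, \<open>\<beta> (n + \<delta>\<^sup>*)\<close> is the integer nearest to \<open>\<beta> n\<close>, ties being
  rounded up.
\<close>

lemma B_star_frequency: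
  assumes "\<And>k. \<beta> k > 0"
  shows "(\<chi> k. of_int (n $ k)) + delta_star_vec \<beta> n = (\<chi> k. of_int (round (\<beta> k * of_int (n $ k))) / \<beta> k)"
proof -
  have "of_int i + delta_star c i = of_int (round (c * of_int i)) / c" if "c > 0" for c i
  proof (cases "frac (c * of_int i) \<ge> 1 / 2")
    case True
    then have "round (c * of_int i) = \<lfloor>c * of_int i\<rfloor> + 1"
      unfolding round_def frac_def by linarith
    then show ?thesis using True by (simp add: delta_star_def)
  next
    case False
    then have "round (c * of_int i) = \<lfloor>c * of_int i\<rfloor>"
      unfolding round_def frac_def by linarith
    then show ?thesis using False by (simp add: delta_star_def)
  qed
  then show ?thesis using assms by (simp add: vec_eq_iff delta_star_vec_def)
qed

lemma B_star_eq_prod: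
  assumes "\<And>k. \<beta> k > 0"
  shows "B_star \<beta> n x = (\<Prod>k\<in>UNIV. osc (of_int (round (\<beta> k * of_int (n $ k))) / \<beta> k) (x $ k))"
proof -
  let ?f = "\<lambda>k. of_int (round (\<beta> k * of_int (n $ k))) / \<beta> k"
  have "B_star \<beta> n x = exp (2 * of_real pi * \<i> * of_real (\<Sum>k\<in>UNIV. ?f k * x $ k))"
    by (simp add: B_star_def expo_def B_star_frequency[OF assms] inner_vec_def)
  also have "2 * of_real pi * \<i> * of_real (\<Sum>k\<in>UNIV. ?f k * x $ k)
      = (\<Sum>k\<in>UNIV. \<i> * of_real (2 * pi * ?f k * x $ k))"
    by (simp add: sum_distrib_left mult_ac)
  also have "exp \<dots> = (\<Prod>k\<in>UNIV. osc (?f k) (x $ k))"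
    by (simp add: exp_sum osc_def cis_conv_exp)
  finally show ?thesis .
qed

text \<open>
  In each coordinate the frequency times the shift is \<open>round (\<beta> n) (s / \<beta>)\<close>, an integer.
\<close>

lemma B_star_shift_invariant:
  assumes b: "\<And>k. \<beta> k > 0" and int: "\<And>k. s $ k / \<beta> k \<in> \<int>"
  shows "B_star \<beta> n (s + x) = B_star \<beta> n x"
proof -
  have "osc (of_int r / \<beta> k) ((s + x) $ k) = osc (of_int r / \<beta> k) (x $ k)" for r :: int and k
  proof -
    obtain z where z: "s $ k / \<beta> k = of_int z" using int[of k] by (auto elim: Ints_cases)
    have "2 * pi * (of_int r / \<beta> k) * s $ k = 2 * pi * of_int r * (s $ k / \<beta> k)" by simp
    then have "osc (of_int r / \<beta> k) (s $ k) = cis (2 * pi * of_int (r * z))"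
      by (simp only: osc_def z of_int_mult mult.assoc)
    also have "\<dots> = 1" by (simp add: cis.ctr complex_eq_iff del: of_int_mult)
    finally show ?thesis by (simp add: osc_add_right)
  qed
  then show ?thesis by (simp add: B_star_eq_prod[OF b])
qed

lemma B_star_cube_riesz_basis:
  fixes \<beta> :: "'d::finite \<Rightarrow> real"
  assumes b: "\<And>k. \<beta> k \<ge> 1"
  shows "\<exists>A B. riesz_basis half_open_cube (B_star \<beta>) A B"
proof -
  let ?v = "\<lambda>k n. osc (of_int (round (\<beta> k * of_int n)) / \<beta> k)"
  have pos: "\<beta> k > 0" for k using b[of k] by linarith
  have "\<forall>k. \<exists>A B. riesz_basis {0..<1} (?v k) A B" using rounded_frequencies_basis[OF b] by blast
  then obtain A B where "\<And>k. riesz_basis {0..<1} (?v k) (A k) (B k)" by metis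
  then have "riesz_basis half_open_cube (tensor_system ?v) (\<Prod>k\<in>UNIV. A k) (\<Prod>k\<in>UNIV. B k)"
    by (rule tensor_system_riesz_basis) (auto simp: bounded_borel_def)
  moreover have "tensor_system ?v = B_star \<beta>"
    by (simp add: fun_eq_iff tensor_system_def B_star_eq_prod[OF pos])
  ultimately show ?thesis by auto
qed

theorem theorem4p6:
  fixes m :: "'d::finite \<Rightarrow> enat"
    and a b :: "'d \<Rightarrow> nat \<Rightarrow> real"
    and \<beta> :: "'d \<Rightarrow> real"
  assumes "\<And>k. \<beta> k \<ge> 1"
    and "\<And>k. unit_subdivision (m k) (a k)"
    and "\<And>k. shift_sequence (m k) (b k)"
    and "\<And>k j. enat j < m k \<Longrightarrow> b k j / \<beta> k \<in> \<int>"
  shows "exponential_basis (split_cube m a b) (B_star \<beta>) \<and>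
         (\<exists>A B. frame_constants (split_cube m a b) (B_star \<beta>) A B) \<and>
         (\<forall>A B. frame_constants (split_cube m a b) (B_star \<beta>) A B \<longleftrightarrow>
                frame_constants (half_open_cube :: (real ^ 'd) set) (B_star \<beta>) A B)"
proof -
  let ?E = "split_cube m a b"
  have pos: "\<beta> k > 0" for k using assms(1)[of k] by linarith
  have split: "?E = (\<Union>j\<in>piece_index_set m. (\<lambda>x. shift_vec b j + x) ` box_piece a j)"
    by (simp add: split_cube_def piece_index_set_def)
  obtain f where cov: "change_of_variable (\<Union>j\<in>piece_index_set m. box_piece a j) ?E f 1"
    and f: "\<And>j x. j \<in> piece_index_set m \<Longrightarrow> x \<in> box_piece a j \<Longrightarrow> f x = shift_vec b j + x"
    unfolding split
    using piecewise_translation_change_of_variable[of "piece_index_set m" "box_piece a" "shift_vec b",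
        OF countable_subset[OF subset_UNIV countableI_type] box_piece_lebesgue
        box_piece_disjoint[of m a, OF assms(2)] shifted_box_piece_disjoint[of m a b, OF assms(2,3)]]
    by blast
  have cov: "change_of_variable half_open_cube ?E f 1"
    using cov by (simp only: box_piece_Union[of m a, OF assms(2)])
  have invariant: "B_star \<beta> n x = B_star \<beta> n (f x)" if x: "x \<in> half_open_cube" for n x
  proof -
    obtain j where j: "j \<in> piece_index_set m" "x \<in> box_piece a j"
      using x box_piece_Union[of m a, OF assms(2)] by blast
    have "shift_vec b j $ k / \<beta> k \<in> \<int>" for k
      using assms(4) j(1) by (simp add: shift_vec_def piece_index_set_def)
    then show ?thesis using B_star_shift_invariant[of \<beta> "shift_vec b j" n x, OF pos] f[OF j] by simp
  qed
  have frames: "frame_constants ?E (B_star \<beta>) A B \<longleftrightarrow>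
      frame_constants (half_open_cube :: (real ^ 'd) set) (B_star \<beta>) A B" for A B
    by (rule frame_constants_transfer[OF cov]) (rule invariant)
  obtain A B where cube: "riesz_basis half_open_cube (B_star \<beta>) A B"
    using B_star_cube_riesz_basis[of \<beta>, OF assms(1)] by blast
  have E: "?E \<in> sets lebesgue"
    unfolding split
    by (intro sets.countable_UN' image_subsetI countable_subset[OF subset_UNIV countableI_type]
        lebesgue_sets_translation box_piece_lebesgue)
  obtain g where g: "change_of_variable ?E half_open_cube g 1" "\<And>y. y \<in> ?E \<Longrightarrow> f (g y) = y"
    using change_of_variable_inverse[OF cov] by blast
  have "B_star \<beta> n y = 1 * (1 * B_star \<beta> n (g y))" if "y \<in> ?E" for n y
    using invariant[OF change_of_variable_maps[OF g(1) that], of n] g(2)[OF that] by simp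
  then have split_basis: "riesz_basis ?E (B_star \<beta>) (1 * A) (1 * B)"
    by (rule riesz_basis_transfer[OF g(1) cube, of "\<lambda>_. 1" "\<lambda>_. 1", rotated -1]) simp_all
  have "B_star \<beta> = (\<lambda>n. expo ((\<chi> k. of_int (n $ k)) + delta_star_vec \<beta> n))"
    by (rule ext) (rule B_star_def)
  then have "\<exists>freq. B_star \<beta> = (\<lambda>n. expo (freq n))" 
    by (intro exI[of _ "\<lambda>n. (\<chi> k. of_int (n $ k)) + delta_star_vec \<beta> n"])
  then have "exponential_basis ?E (B_star \<beta>)"
    unfolding exponential_basis_def using E riesz_basis_unconditional[OF split_basis] by blast
  then show ?thesis using frames riesz_basis_frame_constants[OF split_basis] by blast
qed

end
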